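(* Let $G\in H^\infty(\mathcal Y,\mathcal V)$ and $K\in H^\infty(\mathcal U,\mathcal V)$, and assume that $T_GT_G^*-T_KT_K^*$ is strictly positive. Let $\Theta\in\mathcal S(\mathcal E,\mathcal Y)$, for some Hilbert space $\mathcal E$, be the inner function such that $\operatorname{Im}T_\Theta=\operatorname{Ker}T_G$. Then the solutions $F$ to the Leech problem associated with $G$ and $K$ are given by $$F(\lambda)=\bigl(\Upsilon_{11}(\lambda)X(\lambda)+\Upsilon_{12}(\lambda)\bigr)\bigl(\Upsilon_{21}(\lambda)X(\lambda)+\Upsilon_{22}(\lambda)\bigr)^{-1},\qquad\lambda\in\mathbb D,$$ where the free parameter $X$ is an arbitrary Schur class function $X\in\mathcal S(\mathcal U,\mathcal E)$, and the coefficients are the analytic functions on $\mathbb D$ given by \begin{align*} \Upsilon_{11}(\lambda)&=\Theta(0)Q_\circ-\lambda E_{\mathcal Y}^*(I-\lambda S_{\mathcal Y}^* )^{-1}T_G^*(T_GT_G^*-T_KT_K^* )^{-1}NQ_\circ,\\ \Upsilon_{12}(\lambda)&=E_{\mathcal Y}^*(I-\lambda S_{\mathcal Y}^* )^{-1}T_G^*(T_GT_G^*-T_KT_K^* )^{-1}T_KE_{\mathcal U}R_\circ,\\ \Upsilon_{21}(\lambda)&=-\lambda E_{\mathcal U}^*(I-\lambda S_{\mathcal U}^* )^{-1}T_K^*(T_GT_G^*-T_KT_K^* )^{-1}NQ_\circ,\\ \Upsilon_{22}(\lambda)&=R_\circ+E_{\mathcal U}^*(I-\lambda S_{\mathcal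 U}^* )^{-1}T_K^*(T_GT_G^*-T_KT_K^* )^{-1}T_KE_{\mathcal U}R_\circ . \end{align*} Here $N=-T_GS_{\mathcal Y}^*T_\Theta E_{\mathcal E}=S_{\mathcal V}^*T_GE_{\mathcal Y}\Theta(0)$, and $Q_\circ$ and $R_\circ$ are the strictly positive operators given by \begin{align*} Q_\circ&=\Bigl(I_{\mathcal E}+N^*\bigl((T_GT_G^*-T_KT_K^* )^{-1}-(T_GT_G^* )^{-1}\bigr)N\Bigr)^{-1/2}:\mathcal E\to\mathcal E,\\ R_\circ&=\bigl(I_{\mathcal U}+E_{\mathcal U}^*T_K^*(T_GT_G^*-T_KT_K^* )^{-1}T_KE_{\mathcal U}\bigr)^{-1/2}:\mathcal U\to\mathcal U. \end{align*} Moreover, this parametrization is proper, that is, the map $X\mapsto F$ is one-to-one.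
   Context: All spaces are complex Hilbert spaces and "operator" means bounded linear operator. An operator is strictly positive if it is non-negative and invertible. $\mathbb D$ is the open unit disc. For a Hilbert space $\mathcal V$, $\ell^2_+(\mathcal V)$ is the space of square summable unilateral sequences in $\mathcal V$, $S_{\mathcal V}$ is the unilateral forward shift on it, and $E_{\mathcal V}:\mathcal V\to\ell^2_+(\mathcal V)$, $E_{\mathcal V}v=(v,0,0,\dots)$. $H^\infty(\mathcal U,\mathcal Y)$ is the space of uniformly bounded analytic functions on $\mathbb D$ with values operators from $\mathcal U$ to $\mathcal Y$; $\mathcal S(\mathcal U,\mathcal Y)$ (Schur class) consists of those $F\in H^\infty(\mathcal U,\mathcal Y)$ with $\sup_{\lambda\in\mathbb D}\|F(\lambda)\|\le1$. For $F\in H^\infty(\mathcal U,\mathcal Y)$, $T_F:\ell^2_+(\mathcal U)\to\ell^2_+(\mathcal Y)$ is the block lower triangular Toeplitz operator defined by its Taylor coefficients. $\Theta\in\mathcal S(\mathcal E,\mathcal Y)$ is inner if $T_\Theta$ is an isometry; an inner $\Theta$ with $\operatorname{Im}T_\Theta=\operatorname{Ker}T_G$ exists (and is unique up to a constant unitary on the right) by the Beurling-Lax-Halmos theorem. The Leech problem associated with $G$ and $K$: find all $F\in\mathcal S(\mathcal U,\mathcal Y)$ such that $G(\lambda)F(\lambda)=K(\lambda)$ for all $\lambda\in\mathbb D$, equivalently $T_GT_F=T_K$. *)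

theory Defs
  imports "HOL-Analysis.Analysis"
begin

section \<open>Complex Hilbert spaces\<close>

class complex_normed_vector = real_normed_vector +
  fixes scaleC :: "complex \<Rightarrow> 'a \<Rightarrow> 'a"  (infixr "*\<^sub>C" 75)
  assumes scaleC_add_right: "c *\<^sub>C (x + y) = c *\<^sub>C x + c *\<^sub>C y"
    and scaleC_add_left: "(c + d) *\<^sub>C x = c *\<^sub>C x + d *\<^sub>C x"
    and scaleC_scaleC: "c *\<^sub>C d *\<^sub>C x = (c * d) *\<^sub>C x"
    and scaleC_of_real: "complex_of_real r *\<^sub>C x = r *\<^sub>R x"
    and norm_scaleC: "norm (c *\<^sub>C x) = cmod c * norm x"

text \<open>
  The complex inner product is linear in its first argument.  Extending \<^class>\<open>real_inner\<close> by
  \<open>inner_eq_Re_cinner\<close> makes \<^term>\<open>inner\<close> the underlying real inner product, so that the norm is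
  the Hilbert space norm.  Separability and nontriviality are not assumed.
\<close>

class complex_hilbert = complex_normed_vector + real_inner + complete_space +
  fixes cinner :: "'a \<Rightarrow> 'a \<Rightarrow> complex"
  assumes cinner_commute: "cinner x y = cnj (cinner y x)"
    and cinner_add_left: "cinner (x + y) z = cinner x z + cinner y z"
    and cinner_scaleC_left: "cinner (c *\<^sub>C x) y = c * cinner x y"
    and inner_eq_Re_cinner: "inner x y = Re (cinner x y)"


section \<open>Bounded linear operators\<close>

typedef (overloaded) ('a, 'b) cblinfun =
  "{f :: 'a::complex_normed_vector \<Rightarrow> 'b::complex_normed_vector.
      bounded_linear f \<and> (\<forall>c x. f (c *\<^sub>C x) = c *\<^sub>C f x)}"
  morphisms cblinfun_apply Cblinfun
proof
  have "(0::'b) = c *\<^sub>C 0" for c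
    using norm_scaleC[of c "0::'b"] by simp
  then show "(\<lambda>_. 0) \<in> {f :: 'a \<Rightarrow> 'b. bounded_linear f \<and> (\<forall>c x. f (c *\<^sub>C x) = c *\<^sub>C f x)}"
    by simp
qed

notation cblinfun_apply (infixr "*\<^sub>V" 70)

setup_lifting type_definition_cblinfun

lemma scaleC_zero_right [simp]: "c *\<^sub>C (0::'a::complex_normed_vector) = 0"
  using norm_scaleC[of c "0::'a"] by simp

lemma scaleC_minus_right: "c *\<^sub>C (- x) = - (c *\<^sub>C (x::'a::complex_normed_vector))"
  by (metis add.right_inverse minus_unique scaleC_add_right scaleC_zero_right)

lemma scaleC_diff_right: "c *\<^sub>C (x - y) = c *\<^sub>C x - c *\<^sub>C (y::'a::complex_normed_vector)"
  using scaleC_add_right[of c x "- y"] by (simp add: scaleC_minus_right)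

lemma scaleC_scaleR_commute: "c *\<^sub>C r *\<^sub>R x = r *\<^sub>R c *\<^sub>C (x::'a::complex_normed_vector)"
  by (simp add: scaleC_of_real[symmetric] scaleC_scaleC mult.commute)

lemma bounded_linear_scaleC: "bounded_linear (\<lambda>x::'a::complex_normed_vector. c *\<^sub>C x)"
  by (rule bounded_linear_intro[where K = "cmod c"])
    (simp_all add: scaleC_add_right scaleC_scaleR_commute norm_scaleC mult.commute)

instantiation cblinfun :: (complex_normed_vector, complex_normed_vector) complex_normed_vector
begin

lift_definition norm_cblinfun :: "('a, 'b) cblinfun \<Rightarrow> real" is onorm .

lift_definition zero_cblinfun :: "('a, 'b) cblinfun" is "\<lambda>x. 0"
  by simp

lift_definition plus_cblinfun :: "('a, 'b) cblinfun \<Rightarrow> ('a, 'b) cblinfun \<Rightarrow> ('a, 'b) cblinfun"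
  is "\<lambda>f g x. f x + g x"
  by (auto simp: bounded_linear_add scaleC_add_right)

lift_definition minus_cblinfun :: "('a, 'b) cblinfun \<Rightarrow> ('a, 'b) cblinfun \<Rightarrow> ('a, 'b) cblinfun"
  is "\<lambda>f g x. f x - g x"
  by (auto simp: bounded_linear_sub scaleC_diff_right)

lift_definition uminus_cblinfun :: "('a, 'b) cblinfun \<Rightarrow> ('a, 'b) cblinfun"
  is "\<lambda>f x. - f x"
  by (auto simp: bounded_linear_minus scaleC_minus_right)

lift_definition scaleR_cblinfun :: "real \<Rightarrow> ('a, 'b) cblinfun \<Rightarrow> ('a, 'b) cblinfun"
  is "\<lambda>r f x. r *\<^sub>R f x"
  by (auto simp: bounded_linear_const_scaleR scaleC_scaleR_commute)

lift_definition scaleC_cblinfun :: "complex \<Rightarrow> ('a, 'b) cblinfun \<Rightarrow> ('a, 'b) cblinfun"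
  is "\<lambda>c f x. c *\<^sub>C f x"
  by (auto simp: bounded_linear_compose[OF bounded_linear_scaleC] scaleC_scaleC mult.commute)

definition dist_cblinfun :: "('a, 'b) cblinfun \<Rightarrow> ('a, 'b) cblinfun \<Rightarrow> real"
  where "dist_cblinfun A B = norm (A - B)"

definition sgn_cblinfun :: "('a, 'b) cblinfun \<Rightarrow> ('a, 'b) cblinfun"
  where "sgn_cblinfun A = inverse (norm A) *\<^sub>R A"

definition [code del]:
  "(uniformity :: (('a, 'b) cblinfun \<times> ('a, 'b) cblinfun) filter) =
     (INF e\<in>{0 <..}. principal {(x, y). dist x y < e})"

definition open_cblinfun :: "('a, 'b) cblinfun set \<Rightarrow> bool"
  where [code del]: "open_cblinfun S = (\<forall>x\<in>S. \<forall>\<^sub>F (x', y) in uniformity. x' = x \<longrightarrow> y \<in> S)"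

instance
proof
  fix c :: complex and A :: "('a, 'b) cblinfun"
  have le: "onorm (\<lambda>x. c *\<^sub>C f x) \<le> cmod c * onorm f"
    if "bounded_linear f" for c and f :: "'a \<Rightarrow> 'b"
  proof (rule onorm_bound)
    fix x
    show "norm (c *\<^sub>C f x) \<le> cmod c * onorm f * norm x"
      using mult_left_mono[OF onorm[OF that, of x], of "cmod c"]
      by (simp add: norm_scaleC mult.assoc)
  qed (simp add: onorm_pos_le[OF that])
  show "norm (c *\<^sub>C A) = cmod c * norm A"
  proof (transfer fixing: c)
    fix f :: "'a \<Rightarrow> 'b" assume "bounded_linear f \<and> (\<forall>c x. f (c *\<^sub>C x) = c *\<^sub>C f x)"
    then have f: "bounded_linear f" by simp
    show "onorm (\<lambda>x. c *\<^sub>C f x) = cmod c * onorm f"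
    proof (cases "c = 0")
      case True
      have "(\<lambda>x. c *\<^sub>C f x) = (\<lambda>x. 0)"
        using norm_scaleC[of c "f x" for x] True by (auto simp: fun_eq_iff)
      then show ?thesis using True by (simp add: onorm_zero)
    next
      case False
      have "onorm (\<lambda>x. inverse c *\<^sub>C (c *\<^sub>C f x)) \<le> cmod (inverse c) * onorm (\<lambda>x. c *\<^sub>C f x)"
        by (rule le) (rule bounded_linear_compose[OF bounded_linear_scaleC f])
      moreover have "inverse c *\<^sub>C (c *\<^sub>C f x) = f x" for x
        using False scaleC_of_real[of 1 "f x"] by (simp add: scaleC_scaleC)
      ultimately have "cmod c * onorm f \<le> onorm (\<lambda>x. c *\<^sub>C f x)"
        using False by (simp add: norm_divide field_simps)
      with le[OF f, of c] show ?thesis by simp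
    qed
  qed
  show "c *\<^sub>C (A + B) = c *\<^sub>C A + c *\<^sub>C B" for B
    by transfer (simp add: scaleC_add_right)
  show "(c + d) *\<^sub>C A = c *\<^sub>C A + d *\<^sub>C A" for d
    by transfer (simp add: scaleC_add_left)
  show "c *\<^sub>C d *\<^sub>C A = (c * d) *\<^sub>C A" for d
    by transfer (simp add: scaleC_scaleC)
  show "complex_of_real r *\<^sub>C A = r *\<^sub>R A" for r
    by transfer (simp add: scaleC_of_real)
qed (unfold dist_cblinfun_def open_cblinfun_def sgn_cblinfun_def uniformity_cblinfun_def,
    (rule refl | (transfer, force simp: onorm_triangle onorm_scaleR onorm_eq_0 algebra_simps))+)

end

lift_definition id_op :: "('a::complex_normed_vector, 'a) cblinfun" is "\<lambda>x. x"
  by (simp add: bounded_linear_ident)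

lift_definition op_comp ::
  "('b::complex_normed_vector, 'c::complex_normed_vector) cblinfun \<Rightarrow>
   ('a::complex_normed_vector, 'b) cblinfun \<Rightarrow> ('a, 'c) cblinfun"  (infixl "o\<^sub>C" 75)
  is "\<lambda>f g x. f (g x)"
  by (auto intro: bounded_linear_compose)

definition adj :: "('a::complex_hilbert, 'b::complex_hilbert) cblinfun \<Rightarrow> ('b, 'a) cblinfun"
    ("_\<^sup>\<dagger>" [1000] 999)
  where "A\<^sup>\<dagger> = (THE B. \<forall>x y. cinner (A *\<^sub>V x) y = cinner x (B *\<^sub>V y))"

definition invertible_op ::
    "('a::complex_normed_vector, 'b::complex_normed_vector) cblinfun \<Rightarrow> bool"
  where "invertible_op A \<longleftrightarrow> (\<exists>B. A o\<^sub>C B = id_op \<and> B o\<^sub>C A = id_op)"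

definition op_inv ::
    "('a::complex_normed_vector, 'b::complex_normed_vector) cblinfun \<Rightarrow> ('b, 'a) cblinfun"
  where "op_inv A = (THE B. A o\<^sub>C B = id_op \<and> B o\<^sub>C A = id_op)"

definition nonneg_op :: "('a::complex_hilbert, 'a) cblinfun \<Rightarrow> bool"
  where "nonneg_op A \<longleftrightarrow> (\<forall>x. cinner (A *\<^sub>V x) x \<in> \<real> \<and> 0 \<le> Re (cinner (A *\<^sub>V x) x))"

definition strictly_positive :: "('a::complex_hilbert, 'a) cblinfun \<Rightarrow> bool"
  where "strictly_positive A \<longleftrightarrow> nonneg_op A \<and> invertible_op A"

definition op_sqrt :: "('a::complex_hilbert, 'a) cblinfun \<Rightarrow> ('a, 'a) cblinfun"
  where "op_sqrt A = (THE B. nonneg_op B \<and> B o\<^sub>C B = A)"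


section \<open>Square summable unilateral sequences\<close>

typedef (overloaded) 'a ell2 = "{x :: nat \<Rightarrow> 'a::real_normed_vector. summable (\<lambda>n. (norm (x n))\<^sup>2)}"
  morphisms ell2_nth Abs_ell2
  by (rule exI[of _ "\<lambda>_. 0"]) simp

setup_lifting type_definition_ell2

lemma norm_add_power2_le: "(norm (x + y :: 'a::real_normed_vector))\<^sup>2 \<le> 2 * (norm x)\<^sup>2 + 2 * (norm y)\<^sup>2"
proof -
  have "(norm (x + y))\<^sup>2 \<le> (norm x + norm y)\<^sup>2"
    by (simp add: norm_triangle_ineq power_mono)
  also have "\<dots> \<le> 2 * (norm x)\<^sup>2 + 2 * (norm y)\<^sup>2"
    using zero_le_power2[of "norm x - norm y"] by (simp add: power2_eq_square algebra_simps)
  finally show ?thesis .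
qed

lemma summable_ell2_add:
  fixes x y :: "nat \<Rightarrow> 'a::real_normed_vector"
  assumes "summable (\<lambda>n. (norm (x n))\<^sup>2)" "summable (\<lambda>n. (norm (y n))\<^sup>2)"
  shows "summable (\<lambda>n. (norm (x n + y n))\<^sup>2)"
  by (rule summable_comparison_test'[where g = "\<lambda>n. 2 * (norm (x n))\<^sup>2 + 2 * (norm (y n))\<^sup>2"])
    (auto intro!: summable_add summable_mult assms norm_add_power2_le)

lemma summable_ell2_diff:
  fixes x y :: "nat \<Rightarrow> 'a::real_normed_vector"
  assumes "summable (\<lambda>n. (norm (x n))\<^sup>2)" "summable (\<lambda>n. (norm (y n))\<^sup>2)"
  shows "summable (\<lambda>n. (norm (x n - y n))\<^sup>2)"
  using summable_ell2_add[of x "\<lambda>n. - y n"] assms by simp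

lemma summable_ell2_mult:
  fixes x y :: "nat \<Rightarrow> 'a::real_normed_vector"
  assumes "summable (\<lambda>n. (norm (x n))\<^sup>2)" "summable (\<lambda>n. (norm (y n))\<^sup>2)"
  shows "summable (\<lambda>n. norm (x n) * norm (y n))"
proof (rule summable_comparison_test'[where g = "\<lambda>n. (norm (x n))\<^sup>2 + (norm (y n))\<^sup>2"])
  fix n
  have "0 \<le> norm (x n) * norm (y n)" by simp
  moreover have "2 * (norm (x n) * norm (y n)) \<le> (norm (x n))\<^sup>2 + (norm (y n))\<^sup>2"
    using sum_squares_bound[of "norm (x n)" "norm (y n)"] by (simp only: mult.assoc)
  ultimately have "norm (x n) * norm (y n) \<le> (norm (x n))\<^sup>2 + (norm (y n))\<^sup>2" by linarith
  then show "norm (norm (x n) * norm (y n)) \<le> (norm (x n))\<^sup>2 + (norm (y n))\<^sup>2"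
    by (simp only: real_norm_def abs_mult abs_norm_cancel)
qed (intro summable_add assms)

lemma summable_ell2_inner:
  fixes x y :: "nat \<Rightarrow> 'a::real_inner"
  assumes "summable (\<lambda>n. (norm (x n))\<^sup>2)" "summable (\<lambda>n. (norm (y n))\<^sup>2)"
  shows "summable (\<lambda>n. inner (x n) (y n))"
  by (rule summable_comparison_test'[OF summable_ell2_mult[OF assms]])
    (simp add: Cauchy_Schwarz_ineq2)

instantiation ell2 :: (real_inner) real_inner
begin

lift_definition zero_ell2 :: "'a ell2" is "\<lambda>n. 0" by simp

lift_definition plus_ell2 :: "'a ell2 \<Rightarrow> 'a ell2 \<Rightarrow> 'a ell2" is "\<lambda>x y n. x n + y n"
  by (rule summable_ell2_add)

lift_definition minus_ell2 :: "'a ell2 \<Rightarrow> 'a ell2 \<Rightarrow> 'a ell2" is "\<lambda>x y n. x n - y n"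
  by (rule summable_ell2_diff)

lift_definition uminus_ell2 :: "'a ell2 \<Rightarrow> 'a ell2" is "\<lambda>x n. - x n" by simp

lift_definition scaleR_ell2 :: "real \<Rightarrow> 'a ell2 \<Rightarrow> 'a ell2" is "\<lambda>r x n. r *\<^sub>R x n"
  by (simp add: power_mult_distrib summable_mult)

lift_definition inner_ell2 :: "'a ell2 \<Rightarrow> 'a ell2 \<Rightarrow> real" is "\<lambda>x y. \<Sum>n. inner (x n) (y n)" .

definition norm_ell2 :: "'a ell2 \<Rightarrow> real"
  where "norm_ell2 x = sqrt (inner x x)"

definition dist_ell2 :: "'a ell2 \<Rightarrow> 'a ell2 \<Rightarrow> real"
  where "dist_ell2 x y = norm (x - y)"

definition sgn_ell2 :: "'a ell2 \<Rightarrow> 'a ell2"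
  where "sgn_ell2 x = inverse (norm x) *\<^sub>R x"

definition [code del]:
  "(uniformity :: ('a ell2 \<times> 'a ell2) filter) =
     (INF e\<in>{0 <..}. principal {(x, y). dist x y < e})"

definition open_ell2 :: "'a ell2 set \<Rightarrow> bool"
  where [code del]: "open_ell2 S = (\<forall>x\<in>S. \<forall>\<^sub>F (x', y) in uniformity. x' = x \<longrightarrow> y \<in> S)"

instance
proof
  fix x y z :: "'a ell2" and r s :: real
  show "x + y + z = x + (y + z)" "x + y = y + x" "0 + x = x" "- x + x = 0" "x - y = x + - y"
    by (transfer, simp add: algebra_simps)+
  show "r *\<^sub>R (x + y) = r *\<^sub>R x + r *\<^sub>R y" "(r + s) *\<^sub>R x = r *\<^sub>R x + s *\<^sub>R x"
    "r *\<^sub>R s *\<^sub>R x = (r * s) *\<^sub>R x" "1 *\<^sub>R x = x"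
    by (transfer, simp add: algebra_simps)+
  show "inner x y = inner y x"
    by transfer (simp add: inner_commute)
  show "inner (x + y) z = inner x z + inner y z"
    by transfer (simp add: inner_add_left suminf_add summable_ell2_inner)
  show "inner (r *\<^sub>R x) y = r * inner x y"
    by transfer (simp add: suminf_mult summable_ell2_inner)
  show "0 \<le> inner x x"
    by transfer (simp add: suminf_nonneg summable_ell2_inner)
  show "inner x x = 0 \<longleftrightarrow> x = 0"
    by transfer (auto simp: suminf_eq_zero_iff summable_ell2_inner fun_eq_iff)
qed (simp_all add: norm_ell2_def dist_ell2_def sgn_ell2_def open_ell2_def uniformity_ell2_def)

end

lemma norm_ell2_power2: "(norm (x::'a::real_inner ell2))\<^sup>2 = (\<Sum>n. (norm (ell2_nth x n))\<^sup>2)"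
  by (simp add: power2_norm_eq_inner inner_ell2.rep_eq)

lemma sum_le_norm_ell2: "(\<Sum>n<N. (norm (ell2_nth x n))\<^sup>2) \<le> (norm (x::'a::real_inner ell2))\<^sup>2"
  unfolding norm_ell2_power2 using ell2_nth[of x] by (intro sum_le_suminf) auto

lemma norm_ell2_nth_le: "norm (ell2_nth x n) \<le> norm (x::'a::real_inner ell2)"
proof (rule power2_le_imp_le)
  have "(norm (ell2_nth x n))\<^sup>2 \<le> (\<Sum>n<Suc n. (norm (ell2_nth x n))\<^sup>2)"
    by (simp add: sum_nonneg)
  also note sum_le_norm_ell2
  finally show "(norm (ell2_nth x n))\<^sup>2 \<le> (norm x)\<^sup>2" .
qed simp

instance ell2 :: ("{real_inner, complete_space}") complete_space
proof
  fix X :: "nat \<Rightarrow> 'a ell2"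
  assume X: "Cauchy X"
  have "Cauchy (\<lambda>k. ell2_nth (X k) n)" for n
  proof (rule CauchyI)
    fix e :: real assume "0 < e"
    from CauchyD[OF X this] obtain M where M: "\<forall>k\<ge>M. \<forall>l\<ge>M. norm (X k - X l) < e" by blast
    have "norm (ell2_nth (X k) n - ell2_nth (X l) n) \<le> norm (X k - X l)" for k l
      using norm_ell2_nth_le[of "X k - X l" n] by (simp add: minus_ell2.rep_eq)
    with M show "\<exists>M. \<forall>k\<ge>M. \<forall>l\<ge>M. norm (ell2_nth (X k) n - ell2_nth (X l) n) < e"
      by (meson le_less_trans)
  qed
  then have "\<forall>n. \<exists>l. (\<lambda>k. ell2_nth (X k) n) \<longlonglongrightarrow> l"
    by (simp add: Cauchy_convergent_iff convergent_def)
  then obtain v where v: "\<And>n. (\<lambda>k. ell2_nth (X k) n) \<longlonglongrightarrow> v n"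
    by metis
  have close: "\<exists>M. \<forall>k\<ge>M. summable (\<lambda>n. (norm (ell2_nth (X k) n - v n))\<^sup>2) \<and>
      (\<Sum>n. (norm (ell2_nth (X k) n - v n))\<^sup>2) \<le> e\<^sup>2" if e: "0 < e" for e
  proof -
    from CauchyD[OF X e] obtain M where M: "\<forall>k\<ge>M. \<forall>l\<ge>M. norm (X k - X l) < e" by blast
    have *: "(\<Sum>n<N. (norm (ell2_nth (X k) n - v n))\<^sup>2) \<le> e\<^sup>2" if k: "k \<ge> M" for k N
    proof (rule LIMSEQ_le_const2)
      show "(\<lambda>l. \<Sum>n<N. (norm (ell2_nth (X k) n - ell2_nth (X l) n))\<^sup>2)
          \<longlonglongrightarrow> (\<Sum>n<N. (norm (ell2_nth (X k) n - v n))\<^sup>2)"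
        by (intro tendsto_intros v)
      have "(\<Sum>n<N. (norm (ell2_nth (X k) n - ell2_nth (X l) n))\<^sup>2) \<le> e\<^sup>2" if "l \<ge> M" for l
      proof -
        have "(\<Sum>n<N. (norm (ell2_nth (X k) n - ell2_nth (X l) n))\<^sup>2) \<le> (norm (X k - X l))\<^sup>2"
          using sum_le_norm_ell2[of "X k - X l" N] by (simp add: minus_ell2.rep_eq)
        also have "\<dots> \<le> e\<^sup>2"
          using M k that by (simp add: less_imp_le power_mono)
        finally show ?thesis .
      qed
      then show "\<exists>L. \<forall>l\<ge>L. (\<Sum>n<N. (norm (ell2_nth (X k) n - ell2_nth (X l) n))\<^sup>2) \<le> e\<^sup>2"
        by blast
    qed
    show ?thesis
    proof (intro exI allI impI conjI)
      fix k assume k: "k \<ge> M"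
      show s: "summable (\<lambda>n. (norm (ell2_nth (X k) n - v n))\<^sup>2)"
        by (rule summableI_nonneg_bounded[where x = "e\<^sup>2"]) (auto simp: *[OF k])
      show "(\<Sum>n. (norm (ell2_nth (X k) n - v n))\<^sup>2) \<le> e\<^sup>2"
        by (rule suminf_le_const[OF s *[OF k]])
    qed
  qed
  from close[OF zero_less_one] obtain k0
    where "summable (\<lambda>n. (norm (ell2_nth (X k0) n - v n))\<^sup>2)" by blast
  from summable_ell2_diff[OF _ this, of "ell2_nth (X k0)"] ell2_nth[of "X k0"]
  have "summable (\<lambda>n. (norm (v n))\<^sup>2)" by simp
  then have nth: "ell2_nth (Abs_ell2 v) = v"
    by (simp add: Abs_ell2_inverse)
  have "X \<longlonglongrightarrow> Abs_ell2 v"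
  proof (rule LIMSEQ_I)
    fix e :: real assume e: "0 < e"
    from close[of "e / 2"] e obtain M
      where M: "\<And>k. k \<ge> M \<Longrightarrow> (\<Sum>n. (norm (ell2_nth (X k) n - v n))\<^sup>2) \<le> (e / 2)\<^sup>2" by auto
    have "norm (X k - Abs_ell2 v) < e" if "k \<ge> M" for k
    proof -
      have "(norm (X k - Abs_ell2 v))\<^sup>2 \<le> (e / 2)\<^sup>2"
        using M[OF that] by (simp add: norm_ell2_power2 minus_ell2.rep_eq nth)
      then have "norm (X k - Abs_ell2 v) \<le> e / 2"
        by (rule power2_le_imp_le) (use e in simp)
      with e show ?thesis by simp
    qed
    then show "\<exists>M. \<forall>k\<ge>M. norm (X k - Abs_ell2 v) < e" by blast
  qed
  then show "convergent X" by (auto simp: convergent_def)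
qed

lemma norm_cinner_le: "cmod (cinner x y) \<le> norm x * norm (y::'a::complex_hilbert)"
proof (cases "cinner x y = 0")
  case False
  define c where "c = cnj (cinner x y) / cmod (cinner x y)"
  have "of_real (cmod (cinner x y)) = c * cinner x y"
    using False complex_norm_square[of "cinner x y"]
    by (simp add: c_def power2_eq_square field_simps)
  then have "cmod (cinner x y) = Re (c * cinner x y)"
    by (metis Re_complex_of_real)
  also have "\<dots> = inner (c *\<^sub>C x) y"
    by (simp add: inner_eq_Re_cinner cinner_scaleC_left)
  also have "\<dots> \<le> norm (c *\<^sub>C x) * norm y"
    by (rule norm_cauchy_schwarz)
  also have "\<dots> = norm x * norm y"
    using False by (simp add: norm_scaleC c_def norm_divide)
  finally show ?thesis .
qed simp

lemma summable_ell2_cinner: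
  fixes x y :: "nat \<Rightarrow> 'a::complex_hilbert"
  assumes "summable (\<lambda>n. (norm (x n))\<^sup>2)" "summable (\<lambda>n. (norm (y n))\<^sup>2)"
  shows "summable (\<lambda>n. cinner (x n) (y n))"
  by (rule summable_comparison_test'[OF summable_ell2_mult[OF assms]])
    (simp add: norm_cinner_le)

instantiation ell2 :: (complex_hilbert) complex_hilbert
begin

lift_definition scaleC_ell2 :: "complex \<Rightarrow> 'a ell2 \<Rightarrow> 'a ell2" is "\<lambda>c x n. c *\<^sub>C x n"
  by (simp add: norm_scaleC power_mult_distrib summable_mult)

lift_definition cinner_ell2 :: "'a ell2 \<Rightarrow> 'a ell2 \<Rightarrow> complex" is "\<lambda>x y. \<Sum>n. cinner (x n) (y n)" .

instance
proof
  fix c d :: complex and x y z :: "'a ell2" and r :: real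
  show "c *\<^sub>C (x + y) = c *\<^sub>C x + c *\<^sub>C y"
    by transfer (simp add: scaleC_add_right)
  show "(c + d) *\<^sub>C x = c *\<^sub>C x + d *\<^sub>C x"
    by transfer (simp add: scaleC_add_left)
  show "c *\<^sub>C d *\<^sub>C x = (c * d) *\<^sub>C x"
    by transfer (simp add: scaleC_scaleC)
  show "complex_of_real r *\<^sub>C x = r *\<^sub>R x"
    by transfer (simp add: scaleC_of_real)
  have "(norm (c *\<^sub>C x))\<^sup>2 = (cmod c * norm x)\<^sup>2"
    using ell2_nth[of x]
    by (simp add: norm_ell2_power2 scaleC_ell2.rep_eq norm_scaleC power_mult_distrib suminf_mult)
  then show "norm (c *\<^sub>C x) = cmod c * norm x"
    by (simp add: power2_eq_iff_nonneg)
  show "cinner (x + y) z = cinner x z + cinner y z"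
    by transfer (simp add: cinner_add_left suminf_add summable_ell2_cinner)
  show "cinner (c *\<^sub>C x) y = c * cinner x y"
    by transfer (simp add: cinner_scaleC_left suminf_mult summable_ell2_cinner)
  show "inner x y = Re (cinner x y)"
    by transfer (simp add: inner_eq_Re_cinner Re_suminf summable_ell2_cinner)
  show "cinner x y = cnj (cinner y x)"
  proof transfer
    fix x y :: "nat \<Rightarrow> 'a"
    assume "summable (\<lambda>n. (norm (x n))\<^sup>2)" "summable (\<lambda>n. (norm (y n))\<^sup>2)"
    then have "(\<lambda>n. cinner (y n) (x n)) sums (\<Sum>n. cinner (y n) (x n))"
      by (simp add: summable_ell2_cinner summable_sums)
    then have "(\<lambda>n. cnj (cinner (y n) (x n))) sums cnj (\<Sum>n. cinner (y n) (x n))"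
      by (simp only: sums_cnj)
    then show "(\<Sum>n. cinner (x n) (y n)) = cnj (\<Sum>n. cinner (y n) (x n))"
      by (subst cinner_commute) (simp add: sums_iff)
  qed
qed

end

lemma summable_ell2_case_nat:
  "summable (\<lambda>n. (norm (case n of 0 \<Rightarrow> a | Suc m \<Rightarrow> x m))\<^sup>2) \<longleftrightarrow>
   summable (\<lambda>n. (norm (x n :: 'a::real_normed_vector))\<^sup>2)"
  by (subst summable_Suc_iff[symmetric]) simp

lift_definition shift_seq :: "'a::complex_hilbert ell2 \<Rightarrow> 'a ell2"
  is "\<lambda>x n. case n of 0 \<Rightarrow> 0 | Suc m \<Rightarrow> x m"
  by (simp add: summable_ell2_case_nat)

lift_definition first_seq :: "'a::complex_hilbert \<Rightarrow> 'a ell2"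
  is "\<lambda>v n. case n of 0 \<Rightarrow> v | Suc m \<Rightarrow> 0"
  by (simp add: summable_ell2_case_nat)

lift_definition shift_op :: "('a::complex_hilbert ell2, 'a ell2) cblinfun" is shift_seq
proof (intro conjI allI)
  show "bounded_linear (shift_seq :: 'a ell2 \<Rightarrow> _)"
  proof (rule bounded_linear_intro[where K = 1])
    fix x y :: "'a ell2" and r :: real
    show "shift_seq (x + y) = shift_seq x + shift_seq y"
      by transfer (simp add: fun_eq_iff split: nat.split)
    show "shift_seq (r *\<^sub>R x) = r *\<^sub>R shift_seq x"
      by transfer (simp add: fun_eq_iff split: nat.split)
    have "(norm (shift_seq x))\<^sup>2 = (norm x)\<^sup>2"
      unfolding norm_ell2_power2 shift_seq.rep_eq
      using ell2_nth[of x]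
        suminf_split_head[of "\<lambda>n. (norm (case n of 0 \<Rightarrow> 0 | Suc m \<Rightarrow> ell2_nth x m))\<^sup>2"]
      by (simp add: summable_ell2_case_nat)
    then show "norm (shift_seq x) \<le> norm x * 1"
      by (simp add: power2_eq_iff_nonneg)
  qed
  show "shift_seq (c *\<^sub>C x) = c *\<^sub>C shift_seq x" for c and x :: "'a ell2"
    by transfer (simp add: fun_eq_iff split: nat.split)
qed

lift_definition E_op :: "('a::complex_hilbert, 'a ell2) cblinfun" is first_seq
proof (intro conjI allI)
  show "bounded_linear (first_seq :: 'a \<Rightarrow> _)"
  proof (rule bounded_linear_intro[where K = 1])
    fix x y :: 'a and r :: real
    show "first_seq (x + y) = first_seq x + first_seq y"
      by transfer (simp add: fun_eq_iff split: nat.split)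
    show "first_seq (r *\<^sub>R x) = r *\<^sub>R first_seq x"
      by transfer (simp add: fun_eq_iff split: nat.split)
    have "(norm (first_seq x))\<^sup>2 = (norm x)\<^sup>2"
      unfolding norm_ell2_power2 first_seq.rep_eq
      using suminf_split_head[of "\<lambda>n. (norm (case n of 0 \<Rightarrow> x | Suc m \<Rightarrow> 0))\<^sup>2"]
      by (simp add: summable_ell2_case_nat)
    then show "norm (first_seq x) \<le> norm x * 1"
      by (simp add: power2_eq_iff_nonneg)
  qed
  show "first_seq (c *\<^sub>C x) = c *\<^sub>C first_seq x" for c and x :: 'a
    by transfer (simp add: fun_eq_iff split: nat.split)
qed


section \<open>Operator-valued functions on the disc\<close>

abbreviation unit_disc :: "complex set"  ("\<bbbD>")
  where "\<bbbD> \<equiv> ball 0 1"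

text \<open>
  Functions on the disc are total functions of which only the values on the disc matter.
  Analyticity is complex differentiability in the operator norm.
\<close>

definition analytic_on_disc ::
    "(complex \<Rightarrow> ('a::complex_hilbert, 'b::complex_hilbert) cblinfun) \<Rightarrow> bool"
  where "analytic_on_disc F \<longleftrightarrow>
    (\<forall>z\<in>\<bbbD>. \<exists>D. (F has_derivative (\<lambda>h. h *\<^sub>C D)) (at z))"

definition H_infinity :: "(complex \<Rightarrow> ('a::complex_hilbert, 'b::complex_hilbert) cblinfun) set"
  where "H_infinity = {F. analytic_on_disc F \<and> bounded (F ` \<bbbD>)}"

definition Schur_class :: "(complex \<Rightarrow> ('a::complex_hilbert, 'b::complex_hilbert) cblinfun) set"
  where "Schur_class = {F \<in> H_infinity. (SUP z\<in>\<bbbD>. norm (F z)) \<le> 1}"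

definition taylor_coeff ::
    "(complex \<Rightarrow> ('a::complex_hilbert, 'b::complex_hilbert) cblinfun) \<Rightarrow> nat \<Rightarrow> ('a, 'b) cblinfun"
  where "taylor_coeff F = (THE c. \<forall>z\<in>\<bbbD>. (\<lambda>n. z ^ n *\<^sub>C c n) sums F z)"

text \<open>The lower triangular block Toeplitz operator with block \<open>F\<^sub>n\<^sub>-\<^sub>k\<close> in position \<open>(n, k)\<close>, \<open>k \<le> n\<close>.\<close>

definition toeplitz ::
    "(complex \<Rightarrow> ('a::complex_hilbert, 'b::complex_hilbert) cblinfun) \<Rightarrow> ('a ell2, 'b ell2) cblinfun"
  where "toeplitz F = (THE T. \<forall>u n.
    ell2_nth (T *\<^sub>V u) n = (\<Sum>k\<le>n. taylor_coeff F (n - k) *\<^sub>V ell2_nth u k))"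

definition inner_function ::
    "(complex \<Rightarrow> ('a::complex_hilbert, 'b::complex_hilbert) cblinfun) \<Rightarrow> bool"
  where "inner_function \<Theta> \<longleftrightarrow> \<Theta> \<in> Schur_class \<and> (\<forall>u. norm (toeplitz \<Theta> *\<^sub>V u) = norm u)"


section \<open>The Leech problem\<close>

definition leech_solutions ::
    "(complex \<Rightarrow> ('y::complex_hilbert, 'v::complex_hilbert) cblinfun) \<Rightarrow>
     (complex \<Rightarrow> ('u::complex_hilbert, 'v) cblinfun) \<Rightarrow> (complex \<Rightarrow> ('u, 'y) cblinfun) set"
  where "leech_solutions G K = {F \<in> Schur_class. \<forall>z\<in>\<bbbD>. G z o\<^sub>C F z = K z}"

definition leech_gap ::
    "(complex \<Rightarrow> ('y::complex_hilbert, 'v::complex_hilbert) cblinfun) \<Rightarrow>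
     (complex \<Rightarrow> ('u::complex_hilbert, 'v) cblinfun) \<Rightarrow> ('v ell2, 'v ell2) cblinfun"
  where "leech_gap G K =
    toeplitz G o\<^sub>C (toeplitz G)\<^sup>\<dagger> - toeplitz K o\<^sub>C (toeplitz K)\<^sup>\<dagger>"

definition leech_N ::
    "(complex \<Rightarrow> ('y::complex_hilbert, 'v::complex_hilbert) cblinfun) \<Rightarrow>
     (complex \<Rightarrow> ('e::complex_hilbert, 'y) cblinfun) \<Rightarrow> ('e, 'v ell2) cblinfun"
  where "leech_N G \<Theta> = - (toeplitz G o\<^sub>C shift_op\<^sup>\<dagger> o\<^sub>C toeplitz \<Theta> o\<^sub>C E_op)"

text \<open>\<open>leech_Q\<close> and \<open>leech_R\<close> below are the inverse positive square roots of the next two operators.\<close>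

definition leech_Q_arg ::
    "(complex \<Rightarrow> ('y::complex_hilbert, 'v::complex_hilbert) cblinfun) \<Rightarrow>
     (complex \<Rightarrow> ('u::complex_hilbert, 'v) cblinfun) \<Rightarrow>
     (complex \<Rightarrow> ('e::complex_hilbert, 'y) cblinfun) \<Rightarrow> ('e, 'e) cblinfun"
  where "leech_Q_arg G K \<Theta> =
    id_op + (leech_N G \<Theta>)\<^sup>\<dagger>
      o\<^sub>C (op_inv (leech_gap G K) - op_inv (toeplitz G o\<^sub>C (toeplitz G)\<^sup>\<dagger>)) o\<^sub>C leech_N G \<Theta>"

definition leech_R_arg ::
    "(complex \<Rightarrow> ('y::complex_hilbert, 'v::complex_hilbert) cblinfun) \<Rightarrow>
     (complex \<Rightarrow> ('u::complex_hilbert, 'v) cblinfun) \<Rightarrow> ('u, 'u) cblinfun"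
  where "leech_R_arg G K =
    id_op + E_op\<^sup>\<dagger> o\<^sub>C (toeplitz K)\<^sup>\<dagger> o\<^sub>C op_inv (leech_gap G K) o\<^sub>C toeplitz K o\<^sub>C E_op"

definition leech_Q ::
    "(complex \<Rightarrow> ('y::complex_hilbert, 'v::complex_hilbert) cblinfun) \<Rightarrow>
     (complex \<Rightarrow> ('u::complex_hilbert, 'v) cblinfun) \<Rightarrow>
     (complex \<Rightarrow> ('e::complex_hilbert, 'y) cblinfun) \<Rightarrow> ('e, 'e) cblinfun"
  where "leech_Q G K \<Theta> = op_inv (op_sqrt (leech_Q_arg G K \<Theta>))"

definition leech_R ::
    "(complex \<Rightarrow> ('y::complex_hilbert, 'v::complex_hilbert) cblinfun) \<Rightarrow>
     (complex \<Rightarrow> ('u::complex_hilbert, 'v) cblinfun) \<Rightarrow> ('u, 'u) cblinfun"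
  where "leech_R G K = op_inv (op_sqrt (leech_R_arg G K))"

text \<open>The point evaluation operator \<open>E\<^sup>* (I - z S\<^sup>*)\<^sup>-\<^sup>1\<close>.\<close>

definition eval_op :: "complex \<Rightarrow> ('a::complex_hilbert ell2, 'a) cblinfun"
  where "eval_op z = E_op\<^sup>\<dagger> o\<^sub>C op_inv (id_op - z *\<^sub>C shift_op\<^sup>\<dagger>)"

definition Upsilon11 ::
    "(complex \<Rightarrow> ('y::complex_hilbert, 'v::complex_hilbert) cblinfun) \<Rightarrow>
     (complex \<Rightarrow> ('u::complex_hilbert, 'v) cblinfun) \<Rightarrow>
     (complex \<Rightarrow> ('e::complex_hilbert, 'y) cblinfun) \<Rightarrow> complex \<Rightarrow> ('e, 'y) cblinfun"
  where "Upsilon11 G K \<Theta> z =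
    \<Theta> 0 o\<^sub>C leech_Q G K \<Theta>
    - z *\<^sub>C (eval_op z o\<^sub>C (toeplitz G)\<^sup>\<dagger> o\<^sub>C op_inv (leech_gap G K) o\<^sub>C leech_N G \<Theta> o\<^sub>C leech_Q G K \<Theta>)"

definition Upsilon12 ::
    "(complex \<Rightarrow> ('y::complex_hilbert, 'v::complex_hilbert) cblinfun) \<Rightarrow>
     (complex \<Rightarrow> ('u::complex_hilbert, 'v) cblinfun) \<Rightarrow> complex \<Rightarrow> ('u, 'y) cblinfun"
  where "Upsilon12 G K z =
    eval_op z o\<^sub>C (toeplitz G)\<^sup>\<dagger> o\<^sub>C op_inv (leech_gap G K) o\<^sub>C toeplitz K o\<^sub>C E_op o\<^sub>C leech_R G K"

definition Upsilon21 ::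
    "(complex \<Rightarrow> ('y::complex_hilbert, 'v::complex_hilbert) cblinfun) \<Rightarrow>
     (complex \<Rightarrow> ('u::complex_hilbert, 'v) cblinfun) \<Rightarrow>
     (complex \<Rightarrow> ('e::complex_hilbert, 'y) cblinfun) \<Rightarrow> complex \<Rightarrow> ('e, 'u) cblinfun"
  where "Upsilon21 G K \<Theta> z =
    - (z *\<^sub>C (eval_op z o\<^sub>C (toeplitz K)\<^sup>\<dagger> o\<^sub>C op_inv (leech_gap G K) o\<^sub>C leech_N G \<Theta> o\<^sub>C leech_Q G K \<Theta>))"

definition Upsilon22 ::
    "(complex \<Rightarrow> ('y::complex_hilbert, 'v::complex_hilbert) cblinfun) \<Rightarrow>
     (complex \<Rightarrow> ('u::complex_hilbert, 'v) cblinfun) \<Rightarrow> complex \<Rightarrow> ('u, 'u) cblinfun"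
  where "Upsilon22 G K z =
    leech_R G K
    + eval_op z o\<^sub>C (toeplitz K)\<^sup>\<dagger> o\<^sub>C op_inv (leech_gap G K) o\<^sub>C toeplitz K o\<^sub>C E_op o\<^sub>C leech_R G K"

definition leech_transform ::
    "(complex \<Rightarrow> ('y::complex_hilbert, 'v::complex_hilbert) cblinfun) \<Rightarrow>
     (complex \<Rightarrow> ('u::complex_hilbert, 'v) cblinfun) \<Rightarrow>
     (complex \<Rightarrow> ('e::complex_hilbert, 'y) cblinfun) \<Rightarrow>
     (complex \<Rightarrow> ('u, 'e) cblinfun) \<Rightarrow> complex \<Rightarrow> ('u, 'y) cblinfun"
  where "leech_transform G K \<Theta> X z =
    (Upsilon11 G K \<Theta> z o\<^sub>C X z + Upsilon12 G K z) o\<^sub>C op_inv (Upsilon21 G K \<Theta> z o\<^sub>C X z + Upsilon22 G K z)"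

end

theory Submission
  imports Defs "HOL-Complex_Analysis.Cauchy_Integral_Formula"
begin

text \<open>
  On pairs of sequences consider the form \<open>[x, y] = \<langle>x\<^sub>1, y\<^sub>1\<rangle> - \<langle>x\<^sub>2, y\<^sub>2\<rangle>\<close> and the shift invariant space \<open>M\<close> of
  pairs with \<open>T\<^sub>G x\<^sub>1 = T\<^sub>K x\<^sub>2\<close>, which is regular for the form because \<open>T\<^sub>G T\<^sub>G\<^sup>* - T\<^sub>K T\<^sub>K\<^sup>*\<close> is invertible.  The columns
  of \<open>\<Upsilon>\<close> span the complement of \<open>S M\<close> in \<open>M\<close>, and \<open>Q\<^sub>\<circ>\<close>, \<open>R\<^sub>\<circ>\<close> normalise their Gram matrix to
  \<open>J = diag(I, - I)\<close>.  At every point of the disc, \<open>\<Upsilon>(z)\<close> maps injectively onto the kernel of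
  \<open>(G(z), - K(z))\<close>, is contractive from \<open>J\<close> to the form, and so is its adjoint in the opposite direction.
  This gives the denominators, the contractivity of \<open>F\<close> and the injectivity of \<open>X \<mapsto> F\<close>.

  Conversely, for a solution \<open>F\<close> put \<open>\<alpha> = \<Upsilon>\<^sub>1\<^sub>1 - F \<Upsilon>\<^sub>2\<^sub>1\<close> and \<open>\<beta> = \<Upsilon>\<^sub>1\<^sub>2 - F \<Upsilon>\<^sub>2\<^sub>2\<close>.  A Schur complement argument
  yields \<open>\<beta> \<beta>\<^sup>* \<le> \<alpha> \<alpha>\<^sup>*\<close>, so that \<open>\<alpha> X = - \<beta>\<close> has a contractive solution as soon as \<open>\<alpha>\<close> maps onto the kernel of
  \<open>G(z)\<close> with a left inverse.  This holds for the solution with \<open>X = 0\<close> and is propagated along the segment from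
  it to \<open>F\<close> by a bound for the left inverse that does not depend on the solution.
\<close>

section \<open>Operators on complex Hilbert spaces\<close>

text \<open>The hard direction is that every solution comes from a parameter. Domination of \<beta>
  by \<alpha> determines the adjoint of X only on the range of the adjoint of \<alpha>, and in
  infinite dimensions injectivity of \<alpha> does not make that range the whole space; a bounded
  left inverse of \<alpha> is what closes this gap. For a solution that already is a fraction the
  left inverse is explicit, so its size is known in advance and steps of equal length suffice. Each
  step needs domination at an intermediate point of the segment; it is available because the
  solution set is convex and every solution is dominated. This is carried out at a fixed point z,
  with single operators as parameters. The parameter function is then chosen pointwise, and its
  analyticity is recovered from a local formula in which the left inverse is frozen at one point.
  The inverse of \<open>A A\<^sup>\<dagger>\<close> enters \<open>Q_arg\<close> because the Gram
  matrix of the columns indexed by \<open>q\<close> is computed by comparison with the isometry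
  \<open>T\<close>.\<close>

instance complex_hilbert \<subseteq> banach ..

lemma scaleC_one [simp]: "1 *\<^sub>C x = (x::'a::complex_normed_vector)"
  using scaleC_of_real[of 1 x] by simp

lemma scaleC_zero_left [simp]: "0 *\<^sub>C x = (0::'a::complex_normed_vector)"
  using scaleC_of_real[of 0 x] by simp

lemma scaleC_sum_right: "c *\<^sub>C sum f I = (\<Sum>i\<in>I. c *\<^sub>C (f i::'a::complex_normed_vector))"
  by (induction I rule: infinite_finite_induct) (simp_all add: scaleC_add_right)

lemma bounded_bilinear_scaleC:
  "bounded_bilinear (\<lambda>c x::'a::complex_normed_vector. c *\<^sub>C x)"
proof
  fix r :: real and c :: complex and x :: 'a
  show "(r *\<^sub>R c) *\<^sub>C x = r *\<^sub>R c *\<^sub>C x"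
    by (simp add: scaleC_of_real[symmetric] scaleC_scaleC scaleR_conv_of_real)
  show "\<exists>K. \<forall>c x::'a. norm (c *\<^sub>C x) \<le> norm c * norm x * K"
    by (rule exI[of _ 1]) (simp add: norm_scaleC)
qed (simp_all add: scaleC_add_left scaleC_add_right scaleC_scaleR_commute)

lemma cinner_add_right: "cinner x (y + z) = cinner x y + cinner x (z::'a::complex_hilbert)"
  by (metis cinner_commute cinner_add_left complex_cnj_add)

lemma cinner_scaleC_right: "cinner x (c *\<^sub>C y) = cnj c * cinner x (y::'a::complex_hilbert)"
  by (metis cinner_commute cinner_scaleC_left complex_cnj_mult)

lemma bounded_linear_cinner_left: "bounded_linear (\<lambda>x. cinner x (y::'a::complex_hilbert))"
proof (rule bounded_linear_intro[where K = "norm y"])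
  show "cinner (r *\<^sub>R x) y = r *\<^sub>R cinner x y" for r x
    by (simp add: scaleC_of_real[symmetric] cinner_scaleC_left scaleR_conv_of_real)
qed (simp_all add: cinner_add_left norm_cinner_le)

text \<open>\<open>cinner\<close> is antilinear in its second argument, so Im c = Re (- i c)
  recovers the imaginary part. The real inner product thus carries all the information, and later
  operator identities are checked with \<open>inner\<close> alone.\<close>

lemma cinner_eq_inner: "cinner x y = Complex (inner x y) (inner x (\<i> *\<^sub>C (y::'a::complex_hilbert)))"
  by (simp add: complex_eq_iff inner_eq_Re_cinner cinner_scaleC_right)

lemma inner_scaleC_left: "inner (c *\<^sub>C x) y = inner x (cnj c *\<^sub>C (y::'a::complex_hilbert))"
  by (simp add: inner_eq_Re_cinner cinner_scaleC_right cinner_scaleC_left)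

lemma cinner_self: "cinner x x = complex_of_real ((norm (x::'a::complex_hilbert))\<^sup>2)"
proof -
  have "cnj (cinner x x) = cinner x x" by (rule cinner_commute[symmetric])
  then have "Im (cinner x x) = 0" by (simp add: complex_eq_iff)
  then show ?thesis
    by (simp add: complex_eq_iff power2_norm_eq_inner inner_eq_Re_cinner)
qed

lemma inner_eqI: "(\<And>y. inner x y = inner x' y) \<Longrightarrow> x = (x'::'a::real_inner)"
  by (metis inner_diff_left inner_eq_zero_iff right_minus_eq diff_self)

lemmas cblinfun_rep_eqs [simp] =
  zero_cblinfun.rep_eq plus_cblinfun.rep_eq minus_cblinfun.rep_eq uminus_cblinfun.rep_eq
  scaleR_cblinfun.rep_eq scaleC_cblinfun.rep_eq id_op.rep_eq op_comp.rep_eq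

lemma cblinfun_eqI: "(\<And>x. A *\<^sub>V x = B *\<^sub>V x) \<Longrightarrow> A = B"
  by (simp add: cblinfun_apply_inject[symmetric] fun_eq_iff)

lemma bounded_linear_cblinfun: "bounded_linear (cblinfun_apply A)"
  using cblinfun_apply[of A] by simp

lemma cblinfun_scaleC [simp]: "A *\<^sub>V (c *\<^sub>C x) = c *\<^sub>C (A *\<^sub>V x)"
  using cblinfun_apply[of A] by simp

lemma cblinfun_zero [simp]: "A *\<^sub>V 0 = 0"
  and cblinfun_add: "A *\<^sub>V (x + y) = A *\<^sub>V x + A *\<^sub>V y"
  and cblinfun_diff: "A *\<^sub>V (x - y) = A *\<^sub>V x - A *\<^sub>V y"
  and cblinfun_minus: "A *\<^sub>V (- x) = - (A *\<^sub>V x)"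
  and cblinfun_scaleR: "A *\<^sub>V (r *\<^sub>R x) = r *\<^sub>R (A *\<^sub>V x)"
  using bounded_linear_cblinfun[of A, THEN bounded_linear.linear]
  by (simp_all add: linear_0 linear_add linear_diff linear_neg linear_cmul)

lemmas cblinfun_linear = cblinfun_add cblinfun_diff cblinfun_minus cblinfun_scaleR

lemma norm_cblinfun_apply_le: "norm (A *\<^sub>V x) \<le> norm A * norm x"
  unfolding norm_cblinfun.rep_eq by (rule onorm[OF bounded_linear_cblinfun])

lemma norm_cblinfun_le: "0 \<le> b \<Longrightarrow> (\<And>x. norm (A *\<^sub>V x) \<le> b * norm x) \<Longrightarrow> norm A \<le> b"
  unfolding norm_cblinfun.rep_eq by (rule onorm_bound)

lemma norm_op_comp_le: "norm (A o\<^sub>C B) \<le> norm A * norm B"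
proof (rule norm_cblinfun_le)
  fix x
  have "norm (A *\<^sub>V B *\<^sub>V x) \<le> norm A * (norm B * norm x)"
    by (rule order_trans[OF norm_cblinfun_apply_le mult_left_mono[OF norm_cblinfun_apply_le]]) simp
  then show "norm ((A o\<^sub>C B) *\<^sub>V x) \<le> norm A * norm B * norm x" by (simp add: mult.assoc)
qed simp

lemma bounded_bilinear_op_comp: "bounded_bilinear (o\<^sub>C)"
proof
  show "\<exists>K. \<forall>A B. norm (A o\<^sub>C B :: ('c, 'b) cblinfun) \<le> norm (A::('a, 'b) cblinfun) * norm B * K"
    by (rule exI[of _ 1]) (simp add: norm_op_comp_le)
qed (auto intro!: cblinfun_eqI simp: cblinfun_linear)

lemma bounded_bilinear_cblinfun_apply: "bounded_bilinear (*\<^sub>V)"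
proof
  show "\<exists>K. \<forall>A x. norm ((A::('a, 'b) cblinfun) *\<^sub>V x) \<le> norm A * norm x * K"
    by (rule exI[of _ 1]) (simp add: norm_cblinfun_apply_le)
qed (auto simp: cblinfun_linear)

lemma op_comp_assoc: "(A o\<^sub>C B) o\<^sub>C C = A o\<^sub>C (B o\<^sub>C C)"
  by (rule cblinfun_eqI) simp

lemma op_comp_id [simp]: "A o\<^sub>C id_op = A" "id_op o\<^sub>C A = A"
  by (rule cblinfun_eqI, simp)+

lemma Cblinfun_apply:
  "bounded_linear f \<Longrightarrow> (\<And>c x. f (c *\<^sub>C x) = c *\<^sub>C f x) \<Longrightarrow> Cblinfun f *\<^sub>V x = f x"
  by (simp add: Cblinfun_inverse)

text \<open>Completeness in the operator norm supports the fixed point construction of square roots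
  and the convergence of operator Taylor series.\<close>

instance cblinfun :: (complex_normed_vector, "{complex_normed_vector, complete_space}") complete_space
proof
  fix X :: "nat \<Rightarrow> ('a, 'b) cblinfun"
  assume X: "Cauchy X"
  have X_le: "norm (X m *\<^sub>V x - X n *\<^sub>V x) \<le> norm (X m - X n) * norm x" for m n x
    using norm_cblinfun_apply_le[of "X m - X n" x] by simp
  have lim: "convergent (\<lambda>n. X n *\<^sub>V x)" for x
  proof (rule Cauchy_convergent, rule CauchyI)
    fix e :: real assume e: "0 < e"
    then have "0 < e / (norm x + 1)" by (simp add: add_nonneg_pos)
    from CauchyD[OF X this] obtain M
      where M: "\<And>m n. m \<ge> M \<Longrightarrow> n \<ge> M \<Longrightarrow> norm (X m - X n) < e / (norm x + 1)" by blast
    have "norm (X m *\<^sub>V x - X n *\<^sub>V x) < e" if "m \<ge> M" "n \<ge> M" for m n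
    proof -
      have "norm (X m - X n) * norm x \<le> norm (X m - X n) * (norm x + 1)"
        by (simp add: mult_left_mono)
      also have "\<dots> < e"
        using M[OF that] by (simp add: pos_less_divide_eq add_nonneg_pos)
      finally show ?thesis using X_le[of m x n] by linarith
    qed
    then show "\<exists>M. \<forall>m\<ge>M. \<forall>n\<ge>M. norm (X m *\<^sub>V x - X n *\<^sub>V x) < e" by blast
  qed
  define f where "f x = lim (\<lambda>n. X n *\<^sub>V x)" for x
  have f: "(\<lambda>n. X n *\<^sub>V x) \<longlonglongrightarrow> f x" for x
    unfolding f_def by (rule convergent_LIMSEQ_iff[THEN iffD1, OF lim])
  obtain B where B: "\<And>n. norm (X n) \<le> B"
    using cauchy_imp_bounded[OF X] unfolding bounded_iff by blast
  have f_bl: "bounded_linear f"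
  proof (rule bounded_linear_intro[where K = B])
    fix x y :: 'a and r :: real
    show "f (x + y) = f x + f y"
      by (rule LIMSEQ_unique[OF f]) (simp add: cblinfun_add tendsto_add f)
    show "f (r *\<^sub>R x) = r *\<^sub>R f x"
      by (rule LIMSEQ_unique[OF f]) (simp add: cblinfun_scaleR tendsto_scaleR f)
    have "norm (X n *\<^sub>V x) \<le> norm x * B" for n
      by (rule order_trans[OF norm_cblinfun_apply_le])
        (subst mult.commute, rule mult_left_mono[OF B], simp)
    then show "norm (f x) \<le> norm x * B"
      by (intro LIMSEQ_le_const2[OF tendsto_norm[OF f]]) blast
  qed
  have f_C: "f (c *\<^sub>C x) = c *\<^sub>C f x" for c x
    by (rule LIMSEQ_unique[OF f])
      (simp add: bounded_linear.tendsto[OF bounded_linear_scaleC] f)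
  have "X \<longlonglongrightarrow> Cblinfun f"
  proof (rule LIMSEQ_I)
    fix e :: real assume e: "0 < e"
    then have "0 < e / 2" by simp
    from CauchyD[OF X this] obtain M
      where M: "\<And>m n. m \<ge> M \<Longrightarrow> n \<ge> M \<Longrightarrow> norm (X m - X n) < e / 2" by blast
    have "norm (X m - Cblinfun f) < e" if m: "m \<ge> M" for m
    proof -
      \<comment> \<open>The Cauchy estimate is uniform in \<open>x\<close>; sending only the second
        index to infinity keeps it so.\<close>
      have "norm (X m *\<^sub>V x - f x) \<le> e / 2 * norm x" for x
      proof (rule LIMSEQ_le_const2)
        show "(\<lambda>n. norm (X m *\<^sub>V x - X n *\<^sub>V x)) \<longlonglongrightarrow> norm (X m *\<^sub>V x - f x)"
          by (intro tendsto_intros f)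
        have "norm (X m *\<^sub>V x - X n *\<^sub>V x) \<le> e / 2 * norm x" if "n \<ge> M" for n
          using X_le[of m x n] mult_right_mono[OF less_imp_le[OF M[OF m that]], of "norm x"] by simp
        then show "\<exists>N. \<forall>n\<ge>N. norm (X m *\<^sub>V x - X n *\<^sub>V x) \<le> e / 2 * norm x" by blast
      qed
      then have "norm (X m - Cblinfun f) \<le> e / 2"
        using e by (intro norm_cblinfun_le) (simp_all add: Cblinfun_apply[OF f_bl f_C])
      with e show ?thesis by simp
    qed
    then show "\<exists>M. \<forall>n\<ge>M. norm (X n - Cblinfun f) < e" by blast
  qed
  then show "convergent X" by (auto simp: convergent_def)
qed

subsection \<open>Riesz representation and adjoints\<close>

text \<open>The representing vector v is found as the minimiser of \<phi>, which in hindsight is |x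
  - v|^2 - |v|^2. The parallelogram law makes a minimising sequence Cauchy, and stationarity at its
  limit is the representation.\<close>

lemma riesz_real:
  fixes f :: "'a::{real_inner, complete_space} \<Rightarrow> real"
  assumes f: "bounded_linear f"
  shows "\<exists>v. \<forall>x. f x = inner v x"
proof -
  interpret f: bounded_linear f by fact
  define \<phi> where "\<phi> x = (norm x)\<^sup>2 - 2 * f x" for x
  define m where "m = Inf (range \<phi>)"
  obtain K where K: "\<And>x. norm (f x) \<le> norm x * K" using f.bounded by blast
  have "- K\<^sup>2 \<le> \<phi> x" for x
    using K[of x] zero_le_power2[of "norm x - K"]
    by (simp add: \<phi>_def power2_diff)
  then have bdd: "bdd_below (range \<phi>)" by (auto intro!: bdd_belowI)
  have m_le: "m \<le> \<phi> x" for x unfolding m_def by (rule cInf_lower[OF _ bdd]) simp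
  have par: "(norm (x - y))\<^sup>2 \<le> 2 * (\<phi> x - m) + 2 * (\<phi> y - m)" for x y
  proof -
    define w where "w = (1/2) *\<^sub>R (x + y)"
    have "(norm (x - y))\<^sup>2 = 2 * \<phi> x + 2 * \<phi> y - 4 * \<phi> w"
      by (simp add: w_def \<phi>_def power2_norm_eq_inner f.scaleR f.add inner_add_left inner_add_right
          inner_diff_left inner_diff_right inner_commute algebra_simps)
    moreover have "4 * m \<le> 4 * \<phi> w" using m_le[of w] by simp
    ultimately show ?thesis by (simp add: algebra_simps)
  qed
  have "\<exists>x. \<phi> x < m + inverse (real (Suc n))" for n
    using cInf_lessD[of "range \<phi>" "m + inverse (real (Suc n))"] by (auto simp: m_def)
  then obtain X where X: "\<And>n. \<phi> (X n) < m + inverse (real (Suc n))" by metis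
  have "Cauchy X"
  proof (rule CauchyI)
    fix e :: real assume e: "0 < e"
    then obtain N where N: "inverse (real (Suc N)) < e\<^sup>2 / 4"
      using reals_Archimedean[of "e\<^sup>2 / 4"] by auto
    have le: "\<phi> (X n) - m < e\<^sup>2 / 4" if "n \<ge> N" for n
    proof -
      have "inverse (real (Suc n)) \<le> inverse (real (Suc N))" using that by simp
      with N X[of n] show ?thesis by linarith
    qed
    have "norm (X a - X b) < e" if "a \<ge> N" "b \<ge> N" for a b
    proof -
      have "(norm (X a - X b))\<^sup>2 < e\<^sup>2"
        using par[of "X a" "X b"] le[OF that(1)] le[OF that(2)] by (simp add: algebra_simps)
      with e show ?thesis using power2_less_imp_less by fastforce
    qed
    then show "\<exists>N. \<forall>a\<ge>N. \<forall>b\<ge>N. norm (X a - X b) < e" by blast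
  qed
  then obtain v where v: "X \<longlonglongrightarrow> v" using Cauchy_convergent convergent_def by blast
  have "(\<lambda>n. \<phi> (X n)) \<longlonglongrightarrow> \<phi> v"
    unfolding \<phi>_def by (intro tendsto_intros v f.tendsto)
  moreover have "(\<lambda>n. m + inverse (real (Suc n))) \<longlonglongrightarrow> m + 0"
    by (intro tendsto_intros LIMSEQ_inverse_real_of_nat)
  ultimately have \<phi>v: "\<phi> v \<le> m"
    using X by (intro LIMSEQ_le[of "\<lambda>n. \<phi> (X n)" "\<phi> v" "\<lambda>n. m + inverse (real (Suc n))"])
      (auto intro!: less_imp_le)
  have "f y = inner v y" for y
  proof (rule ccontr)
    define d where "d = inner v y - f y"
    assume "f y \<noteq> inner v y"
    then have d: "d \<noteq> 0" by (simp add: d_def)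
    have y: "y \<noteq> 0" using d by (auto simp: d_def f.zero)
    \<comment> \<open>The minimiser of the quadratic polynomial
      \<open>\<phi> (v + t *\<^sub>R y)\<close> in \<open>t\<close>; its minimum lies below
      \<phi>(v) unless d = 0.\<close>
    define t where "t = - d / (norm y)\<^sup>2"
    have "\<phi> (v + t *\<^sub>R y) = \<phi> v + 2 * t * d + t\<^sup>2 * (norm y)\<^sup>2"
      unfolding \<phi>_def d_def power2_norm_eq_inner
      by (simp add: f.scaleR f.add inner_add_left inner_add_right
          inner_commute algebra_simps power2_eq_square)
    also have "\<dots> = \<phi> v - d\<^sup>2 / (norm y)\<^sup>2"
      using y by (simp add: t_def power2_eq_square field_simps)
    also have "\<dots> < \<phi> v" using d y by simp
    finally show False using m_le[of "v + t *\<^sub>R y"] \<phi>v by linarith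
  qed
  then show ?thesis by blast
qed

lemma riesz_complex:
  fixes g :: "'a::complex_hilbert \<Rightarrow> complex"
  assumes add: "\<And>x y. g (x + y) = g x + g y"
    and scale: "\<And>c x. g (c *\<^sub>C x) = cnj c * g x"
    and bound: "\<And>x. cmod (g x) \<le> M * norm x"
  shows "\<exists>v. \<forall>x. cinner v x = g x"
proof -
  have "bounded_linear (\<lambda>x. Re (g x))"
  proof (rule bounded_linear_intro[where K = M])
    fix x y :: 'a and r :: real
    show "Re (g (r *\<^sub>R x)) = r *\<^sub>R Re (g x)"
      by (simp add: scaleC_of_real[symmetric] scale)
    show "norm (Re (g x)) \<le> norm x * M"
      using bound[of x] abs_Re_le_cmod[of "g x"] by (simp add: mult.commute)
  qed (simp add: add)
  from riesz_real[OF this] obtain v where v: "\<And>x. Re (g x) = inner v x" by blast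
  have "cinner v x = g x" for x
    using v[of x] v[of "\<i> *\<^sub>C x"] by (simp add: complex_eq_iff cinner_eq_inner scale)
  then show ?thesis by blast
qed

lemma cinner_eqI: "(\<And>y. cinner x y = cinner x' y) \<Longrightarrow> x = (x'::'a::complex_hilbert)"
  by (rule inner_eqI) (simp add: inner_eq_Re_cinner)

text \<open>The source of operators that are not given by a formula: adjoints arise from the form
  <y, A x>, Taylor coefficients from the scalar coefficients of <F(z) x, y>.\<close>

lemma sesquilinear_form_operator:
  fixes a :: "'a::complex_hilbert \<Rightarrow> 'b::complex_hilbert \<Rightarrow> complex"
  assumes add_left: "\<And>x x' y. a (x + x') y = a x y + a x' y"
    and scale_left: "\<And>c x y. a (c *\<^sub>C x) y = c * a x y"
    and add_right: "\<And>x y y'. a x (y + y') = a x y + a x y'"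
    and scale_right: "\<And>c x y. a x (c *\<^sub>C y) = cnj c * a x y"
    and bound: "\<And>x y. cmod (a x y) \<le> M * norm x * norm y" and M: "0 \<le> M"
  shows "\<exists>B. (\<forall>x y. cinner (B *\<^sub>V x) y = a x y) \<and> norm B \<le> M"
proof -
  have "\<exists>v. \<forall>y. cinner v y = a x y" for x
    by (rule riesz_complex[where M = "M * norm x"]) (simp_all add: add_right scale_right bound)
  then obtain f where f: "\<And>x y. cinner (f x) y = a x y" by metis
  have f_add: "f (x + y) = f x + f y" for x y
    by (rule cinner_eqI) (simp add: f add_left cinner_add_left)
  have f_C: "f (c *\<^sub>C x) = c *\<^sub>C f x" for c x
    by (rule cinner_eqI) (simp add: f scale_left cinner_scaleC_left)
  have f_le: "norm (f x) \<le> M * norm x" for x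
  proof (cases "f x = 0")
    case False
    have "norm (f x) * norm (f x) \<le> M * norm x * norm (f x)"
      using bound[of x "f x"] unfolding f[symmetric] cinner_self norm_of_real
      by (simp add: power2_eq_square)
    with False show ?thesis by simp
  qed (simp add: M)
  have f_bl: "bounded_linear f"
    by (rule bounded_linear_intro[where K = M])
      (simp_all add: f_add f_le mult.commute scaleC_of_real[symmetric] f_C)
  have "norm (Cblinfun f) \<le> M"
    by (rule norm_cblinfun_le[OF M]) (simp add: Cblinfun_apply[OF f_bl f_C] f_le)
  then show ?thesis
    by (intro exI[of _ "Cblinfun f"]) (simp add: Cblinfun_apply[OF f_bl f_C] f)
qed

lemma cinner_adj: "cinner (A *\<^sub>V x) y = cinner x (A\<^sup>\<dagger> *\<^sub>V y)"
proof -
  have "cmod (cinner y (A *\<^sub>V x)) \<le> norm A * norm y * norm x" for x y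
    using order_trans[OF norm_cinner_le mult_left_mono[OF norm_cblinfun_apply_le[of A x], of "norm y"]]
    by (simp add: mult_ac)
  then have "\<exists>B. (\<forall>y x. cinner (B *\<^sub>V y) x = cinner y (A *\<^sub>V x)) \<and> norm B \<le> norm A"
    by (intro sesquilinear_form_operator)
      (simp_all add: cinner_add_left cinner_add_right cinner_scaleC_left cinner_scaleC_right cblinfun_add)
  then obtain B where B: "\<And>x y. cinner (B *\<^sub>V y) x = cinner y (A *\<^sub>V x)" by blast
  have B': "cinner (A *\<^sub>V x) y = cinner x (B *\<^sub>V y)" for x y
    by (subst (1 2) cinner_commute) (simp add: B)
  have "A\<^sup>\<dagger> = B"
    unfolding adj_def
  proof (rule the_equality)
    fix B' assume B'': "\<forall>x y. cinner (A *\<^sub>V x) y = cinner x (B' *\<^sub>V y)"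
    show "B' = B"
    proof (rule cblinfun_eqI, rule cinner_eqI)
      show "cinner (B' *\<^sub>V y) x = cinner (B *\<^sub>V y) x" for x y
        by (subst (1 2) cinner_commute) (simp add: B'[symmetric] B''[rule_format, symmetric])
    qed
  qed (simp add: B')
  then show ?thesis by (simp add: B')
qed

lemma inner_adj: "inner (A *\<^sub>V x) y = inner x (A\<^sup>\<dagger> *\<^sub>V y)"
  by (simp add: inner_eq_Re_cinner cinner_adj)

lemma inner_adj': "inner x (A *\<^sub>V y) = inner (A\<^sup>\<dagger> *\<^sub>V x) y"
  by (simp add: inner_commute[of _ "A *\<^sub>V y"] inner_adj inner_commute[of y])

lemma adj_eqI: "(\<And>x y. inner (A *\<^sub>V x) y = inner x (B *\<^sub>V y)) \<Longrightarrow> A\<^sup>\<dagger> = B"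
  by (rule cblinfun_eqI, rule inner_eqI) (simp add: inner_adj'[symmetric] inner_commute[of _ "A *\<^sub>V _"] inner_commute[of "B *\<^sub>V _"])

lemma adj_adj [simp]: "(A\<^sup>\<dagger>)\<^sup>\<dagger> = A"
  by (rule adj_eqI) (simp add: inner_adj')

lemma adj_comp: "(A o\<^sub>C B)\<^sup>\<dagger> = B\<^sup>\<dagger> o\<^sub>C A\<^sup>\<dagger>"
  by (rule adj_eqI) (simp add: inner_adj)

lemma adj_diff: "(A - B)\<^sup>\<dagger> = A\<^sup>\<dagger> - B\<^sup>\<dagger>"
  by (rule adj_eqI) (simp add: inner_adj inner_diff_left inner_diff_right)

text \<open>Testing with \<open>A\<^sup>\<dagger> *\<^sub>V y\<close> itself bounds its squared norm
  by c times its norm times |y|, and one factor cancels.\<close>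

lemma norm_adj_apply_le:
  assumes "\<And>x. norm (A *\<^sub>V x) \<le> c * norm x" and c: "0 \<le> c"
  shows "norm (A\<^sup>\<dagger> *\<^sub>V y) \<le> c * norm y"
proof (cases "A\<^sup>\<dagger> *\<^sub>V y = 0")
  case False
  have "(norm (A\<^sup>\<dagger> *\<^sub>V y))\<^sup>2 = inner (A *\<^sub>V (A\<^sup>\<dagger> *\<^sub>V y)) y"
    by (simp add: power2_norm_eq_inner inner_adj)
  also have "\<dots> \<le> norm (A *\<^sub>V (A\<^sup>\<dagger> *\<^sub>V y)) * norm y" by (rule norm_cauchy_schwarz)
  also have "\<dots> \<le> c * norm (A\<^sup>\<dagger> *\<^sub>V y) * norm y" by (rule mult_right_mono[OF assms(1)]) simp
  finally show ?thesis using False by (simp add: power2_eq_square mult_ac)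
qed (simp add: c)

subsection \<open>Inverses and square roots\<close>

lemma op_inv_eqI:
  assumes "A o\<^sub>C B = id_op" "B o\<^sub>C A = id_op"
  shows "op_inv A = B"
  unfolding op_inv_def
proof (rule the_equality)
  fix B' assume B': "A o\<^sub>C B' = id_op \<and> B' o\<^sub>C A = id_op"
  have "B' = B' o\<^sub>C (A o\<^sub>C B)" using assms by simp
  also have "\<dots> = B" using B' by (simp add: op_comp_assoc[symmetric])
  finally show "B' = B" .
qed (use assms in simp)

lemma op_comp_op_inv:
  assumes "invertible_op A"
  shows "A o\<^sub>C op_inv A = id_op" "op_inv A o\<^sub>C A = id_op"
proof -
  obtain B where B: "A o\<^sub>C B = id_op" "B o\<^sub>C A = id_op"
    using assms by (auto simp: invertible_op_def)
  show "A o\<^sub>C op_inv A = id_op" "op_inv A o\<^sub>C A = id_op"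
    unfolding op_inv_eqI[OF B] by (rule B)+
qed

lemma op_inv_apply:
  assumes "invertible_op A"
  shows "A *\<^sub>V op_inv A *\<^sub>V y = y" "op_inv A *\<^sub>V A *\<^sub>V x = x"
  using arg_cong[OF op_comp_op_inv(1)[OF assms], of "\<lambda>T. T *\<^sub>V y"]
    arg_cong[OF op_comp_op_inv(2)[OF assms], of "\<lambda>T. T *\<^sub>V x"] by simp_all

lemma invertible_opI: "A o\<^sub>C B = id_op \<Longrightarrow> B o\<^sub>C A = id_op \<Longrightarrow> invertible_op A"
  by (auto simp: invertible_op_def)

lemma invertible_op_inv: "invertible_op A \<Longrightarrow> invertible_op (op_inv A)"
  by (metis invertible_opI op_comp_op_inv)

lemma invertible_op_comp: "invertible_op A \<Longrightarrow> invertible_op B \<Longrightarrow> invertible_op (A o\<^sub>C B)"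
  by (rule invertible_opI[where B = "op_inv B o\<^sub>C op_inv A"]; rule cblinfun_eqI)
    (simp_all add: op_inv_apply)

lemma invertible_op_surjI:
  assumes surj: "\<And>y. \<exists>x. A *\<^sub>V x = y"
    and lower: "\<And>x. c * norm x \<le> norm (A *\<^sub>V x)" and c: "0 < c"
  shows "invertible_op A" "norm (op_inv A) \<le> 1 / c"
proof -
  obtain g where g: "\<And>y. A *\<^sub>V g y = y" using surj by metis
  have inj: "x = x'" if "A *\<^sub>V x = A *\<^sub>V x'" for x x'
  proof -
    have "c * norm (x - x') \<le> 0" using lower[of "x - x'"] that by (simp add: cblinfun_diff)
    with c show ?thesis by (simp add: mult_le_0_iff)
  qed
  have g_le: "norm (g y) \<le> 1 / c * norm y" for y
    using lower[of "g y"] c by (simp add: g field_simps)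
  have g_C: "g (a *\<^sub>C y) = a *\<^sub>C g y" for a y by (rule inj) (simp add: g)
  have g_bl: "bounded_linear g"
  proof (rule bounded_linear_intro[where K = "1 / c"])
    show "g (x + y) = g x + g y" for x y by (rule inj) (simp add: g cblinfun_add)
    show "g (r *\<^sub>R x) = r *\<^sub>R g x" for r x by (rule inj) (simp add: g cblinfun_scaleR)
    show "norm (g x) \<le> norm x * (1 / c)" for x using g_le[of x] by simp
  qed
  have inv: "A o\<^sub>C Cblinfun g = id_op" "Cblinfun g o\<^sub>C A = id_op"
    by (rule cblinfun_eqI, simp add: Cblinfun_apply[OF g_bl g_C] g inj)+
  then show "invertible_op A" by (rule invertible_opI)
  show "norm (op_inv A) \<le> 1 / c"
    unfolding op_inv_eqI[OF inv]
    by (rule norm_cblinfun_le) (use c in \<open>simp_all add: Cblinfun_apply[OF g_bl g_C] g_le[simplified]\<close>)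
qed

text \<open>A solution of x - W x = y is the fixed point of the contraction x -> y + W x; the lower
  bound is the reverse triangle inequality.\<close>

lemma invertible_id_minus:
  fixes W :: "('a::complex_hilbert, 'a) cblinfun"
  assumes W: "norm W < 1"
  shows "invertible_op (id_op - W)"
proof (rule invertible_op_surjI(1))
  fix y
  have "\<exists>!x. y + W *\<^sub>V x = x"
  proof (rule banach_fix_type[of "norm W"])
    show "\<forall>x x'. dist (y + W *\<^sub>V x) (y + W *\<^sub>V x') \<le> norm W * dist x x'"
      by (simp add: dist_norm cblinfun_diff[symmetric] norm_cblinfun_apply_le)
  qed (use W in simp_all)
  then obtain x where "y + W *\<^sub>V x = x" by blast
  then show "\<exists>x. (id_op - W) *\<^sub>V x = y" by (intro exI[of _ x]) (simp add: diff_eq_eq)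
next
  fix x
  show "(1 - norm W) * norm x \<le> norm ((id_op - W) *\<^sub>V x)"
    using norm_triangle_ineq2[of x "W *\<^sub>V x"] norm_cblinfun_apply_le[of W x]
    by (simp add: algebra_simps)
qed (use W in simp)

lemma invertible_id_plus: "norm W < 1 \<Longrightarrow> invertible_op (id_op + (W::('a::complex_hilbert, 'a) cblinfun))"
  using invertible_id_minus[of "- W"] by simp

lemma norm_id_minus_scaled_less:
  fixes T :: "('a::complex_hilbert, 'a) cblinfun"
  assumes T: "\<And>x. \<delta> * (norm x)\<^sup>2 \<le> inner (T *\<^sub>V x) x" and \<delta>: "0 < \<delta>"
  shows "\<exists>k>0. norm (id_op - inverse k *\<^sub>R T) < 1"
proof -
  \<comment> \<open>Any k with |T|^2 <= \<delta> k gives |x - T x / k|^2 <= (1 - \<delta> / k)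
    |x|^2. The summand 1 keeps k positive when T = 0.\<close>
  define k where "k = ((norm T)\<^sup>2 + 1) / \<delta>"
  have k: "0 < k" using \<delta> by (simp add: k_def add_nonneg_pos)
  have kT: "(norm T)\<^sup>2 \<le> \<delta> * k" using \<delta> by (simp add: k_def)
  \<comment> \<open>The maximum covers the zero space, on which every \<delta> is admissible and
    \<delta> / k may exceed 1.\<close>
  define q where "q = max 0 (1 - \<delta> / k)"
  have q: "0 \<le> q" "q < 1" using \<delta> k by (auto simp: q_def)
  have "norm (id_op - inverse k *\<^sub>R T) \<le> sqrt q"
  proof (rule norm_cblinfun_le)
    fix x
    define a where "a = inner (T *\<^sub>V x) x"
    define n where "n = (norm x)\<^sup>2"
    have "(norm (T *\<^sub>V x))\<^sup>2 \<le> (norm T * norm x)\<^sup>2"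
      by (rule power_mono[OF norm_cblinfun_apply_le]) simp
    also have "\<dots> \<le> \<delta> * k * n"
      unfolding power_mult_distrib n_def by (rule mult_right_mono[OF kT]) simp
    finally have Tx: "(norm (T *\<^sub>V x))\<^sup>2 / k\<^sup>2 \<le> \<delta> * n / k"
      using k by (simp add: power2_eq_square field_simps)
    have a: "\<delta> * n \<le> a" unfolding a_def n_def by (rule T)
    have "(norm ((id_op - inverse k *\<^sub>R T) *\<^sub>V x))\<^sup>2 = n - 2 / k * a + (norm (T *\<^sub>V x))\<^sup>2 / k\<^sup>2"
      using k unfolding a_def n_def power2_norm_eq_inner
      by (simp add: inner_diff_left inner_diff_right inner_commute field_simps power2_eq_square)
    also have "\<dots> \<le> n - 2 / k * (\<delta> * n) + \<delta> * n / k"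
      using mult_left_mono[OF a, of "2 / k"] k Tx by (simp add: add_mono diff_mono)
    also have "\<dots> = (1 - \<delta> / k) * n" by (simp add: field_simps)
    also have "\<dots> \<le> q * n" by (rule mult_right_mono) (simp_all add: q_def n_def)
    also have "\<dots> = (sqrt q * norm x)\<^sup>2" using q by (simp add: power_mult_distrib n_def)
    finally show "norm ((id_op - inverse k *\<^sub>R T) *\<^sub>V x) \<le> sqrt q * norm x"
      by (rule power2_le_imp_le) (simp add: q)
  qed (simp add: q)
  also have "\<dots> < 1" using q by simp
  finally show ?thesis using k by blast
qed

text \<open>Lax-Milgram: after scaling, T is a perturbation of the identity of norm less than
  1.\<close>

lemma coercive_invertible:
  fixes T :: "('a::complex_hilbert, 'a) cblinfun"
  assumes T: "\<And>x. \<delta> * (norm x)\<^sup>2 \<le> inner (T *\<^sub>V x) x" and \<delta>: "0 < \<delta>"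
  shows "invertible_op T"
proof -
  from norm_id_minus_scaled_less[OF assms] obtain k
    where k: "0 < k" and n: "norm (id_op - inverse k *\<^sub>R T) < 1" by blast
  from invertible_id_minus[OF n] have inv: "invertible_op (inverse k *\<^sub>R T)" by simp
  show ?thesis
  proof (rule invertible_op_surjI(1)[OF _ _ \<delta>])
    fix y
    have "T *\<^sub>V (inverse k *\<^sub>R op_inv (inverse k *\<^sub>R T) *\<^sub>V y) = y"
      using op_inv_apply(1)[OF inv, of y] by (simp add: cblinfun_scaleR)
    then show "\<exists>x. T *\<^sub>V x = y" by blast
  next
    fix x
    have "\<delta> * norm x * norm x \<le> norm (T *\<^sub>V x) * norm x"
      using order_trans[OF T norm_cauchy_schwarz] by (simp add: power2_eq_square mult.assoc)
    then show "\<delta> * norm x \<le> norm (T *\<^sub>V x)" by (cases "x = 0") simp_all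
  qed
qed

text \<open>The bound for the adjoint makes \<open>A o\<^sub>C A\<^sup>\<dagger>\<close> coercive,
  hence A surjective; the bound for A makes the inverse bounded.\<close>

lemma bounded_below_invertible:
  assumes A: "\<And>x. c * norm x \<le> norm (A *\<^sub>V x)" and c: "0 < c"
    and A': "\<And>x. d * norm x \<le> norm (A\<^sup>\<dagger> *\<^sub>V x)" and d: "0 < d"
  shows "invertible_op A"
proof (rule invertible_op_surjI(1)[OF _ A c])
  fix y
  have "invertible_op (A o\<^sub>C A\<^sup>\<dagger>)"
  proof (rule coercive_invertible)
    show "d\<^sup>2 * (norm x)\<^sup>2 \<le> inner ((A o\<^sub>C A\<^sup>\<dagger>) *\<^sub>V x) x" for x
      using power_mono[OF A', of x 2] d
      by (simp add: inner_adj power2_norm_eq_inner[symmetric] power_mult_distrib)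
  qed (use d in simp)
  then have "A *\<^sub>V A\<^sup>\<dagger> *\<^sub>V op_inv (A o\<^sub>C A\<^sup>\<dagger>) *\<^sub>V y = y"
    using op_inv_apply(1)[of "A o\<^sub>C A\<^sup>\<dagger>"] by simp
  then show "\<exists>x. A *\<^sub>V x = y" by blast
qed

lemma adj_op_inv:
  assumes "invertible_op T" "T\<^sup>\<dagger> = T"
  shows "(op_inv T)\<^sup>\<dagger> = op_inv T"
proof (rule adj_eqI)
  fix x y
  have "inner (op_inv T *\<^sub>V x) (T *\<^sub>V op_inv T *\<^sub>V y) = inner (T *\<^sub>V op_inv T *\<^sub>V x) (op_inv T *\<^sub>V y)"
    by (simp add: inner_adj assms(2))
  then show "inner (op_inv T *\<^sub>V x) y = inner x (op_inv T *\<^sub>V y)"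
    by (simp add: op_inv_apply[OF assms(1)])
qed

lemma nonneg_opI:
  assumes "A\<^sup>\<dagger> = A" "\<And>x. 0 \<le> inner (A *\<^sub>V x) x"
  shows "nonneg_op A"
  unfolding nonneg_op_def
proof (intro allI conjI)
  fix x
  have "cinner (A *\<^sub>V x) x = cnj (cinner (A *\<^sub>V x) x)"
    by (metis assms(1) cinner_adj cinner_commute)
  then show "cinner (A *\<^sub>V x) x \<in> \<real>" by (simp add: Reals_cnj_iff)
  show "0 \<le> Re (cinner (A *\<^sub>V x) x)" using assms(2)[of x] by (simp add: inner_eq_Re_cinner)
qed

lemma strictly_positive_op_inv:
  assumes "strictly_positive T" "T\<^sup>\<dagger> = T"
  shows "strictly_positive (op_inv T)"
proof -
  have inv: "invertible_op T" and T: "nonneg_op T" using assms by (auto simp: strictly_positive_def)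
  have "nonneg_op (op_inv T)"
  proof (rule nonneg_opI[OF adj_op_inv[OF inv assms(2)]])
    fix x
    have "0 \<le> inner (T *\<^sub>V op_inv T *\<^sub>V x) (op_inv T *\<^sub>V x)"
      using T by (simp add: nonneg_op_def inner_eq_Re_cinner)
    then show "0 \<le> inner (op_inv T *\<^sub>V x) x"
      by (simp add: op_inv_apply[OF inv] inner_commute)
  qed
  then show ?thesis by (simp add: strictly_positive_def invertible_op_inv inv)
qed

text \<open>With y = T x, nonnegativity of T at x - y / k gives |T x|^2 <= k <T x, x>, and
  invertibility bounds |x| by a multiple of |T x|. The summands 1 in k and l only keep the divisors
  positive.\<close>

lemma strictly_positive_coercive:
  assumes "strictly_positive T" and sa: "T\<^sup>\<dagger> = T"
  shows "\<exists>\<delta>>0. \<forall>x. \<delta> * (norm x)\<^sup>2 \<le> inner (T *\<^sub>V x) x"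
proof -
  have inv: "invertible_op T" and T: "\<And>x. 0 \<le> inner (T *\<^sub>V x) x"
    using assms by (auto simp: strictly_positive_def nonneg_op_def inner_eq_Re_cinner)
  define k where "k = norm T + 1"
  define l where "l = norm (op_inv T) + 1"
  have kl: "0 < k" "0 < l" by (simp_all add: k_def l_def add_nonneg_pos)
  have "1 / (k * l\<^sup>2) * (norm x)\<^sup>2 \<le> inner (T *\<^sub>V x) x" for x
  proof -
    define y where "y = T *\<^sub>V x"
    have "inner (T *\<^sub>V y) y \<le> norm T * norm y * norm y"
      by (rule order_trans[OF norm_cauchy_schwarz mult_right_mono[OF norm_cblinfun_apply_le]]) simp
    also have "\<dots> \<le> k * (norm y)\<^sup>2"
      by (simp add: k_def power2_eq_square mult.assoc mult_right_mono)
    finally have y: "inner (T *\<^sub>V y) y \<le> k * (norm y)\<^sup>2" .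
    have "inner (T *\<^sub>V x) y = (norm y)\<^sup>2" "inner (T *\<^sub>V y) x = (norm y)\<^sup>2"
      by (simp_all add: y_def inner_adj sa power2_norm_eq_inner)
    then have "inner (T *\<^sub>V (x - inverse k *\<^sub>R y)) (x - inverse k *\<^sub>R y)
        = inner (T *\<^sub>V x) x - 2 / k * (norm y)\<^sup>2 + inner (T *\<^sub>V y) y / k\<^sup>2"
      using kl by (simp add: cblinfun_linear inner_diff_left inner_diff_right power2_eq_square field_simps)
    also have "inner (T *\<^sub>V y) y / k\<^sup>2 \<le> (norm y)\<^sup>2 / k"
      using y kl by (simp add: power2_eq_square field_simps)
    finally have "(norm y)\<^sup>2 / k \<le> inner (T *\<^sub>V x) x"
      using T[of "x - inverse k *\<^sub>R y"] by (simp add: field_simps)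
    moreover have "norm x \<le> l * norm y"
      using norm_cblinfun_apply_le[of "op_inv T" y]
      by (simp add: y_def op_inv_apply[OF inv] l_def distrib_right)
        (meson add_increasing2 norm_ge_zero order_trans)
    then have "(norm x)\<^sup>2 \<le> l\<^sup>2 * (norm y)\<^sup>2"
      using power_mono[of "norm x" "l * norm y" 2] by (simp add: power_mult_distrib)
    then have "1 / (k * l\<^sup>2) * (norm x)\<^sup>2 \<le> (norm y)\<^sup>2 / k"
      using kl by (simp add: field_simps)
    ultimately show ?thesis by linarith
  qed
  then show ?thesis using kl by (intro exI[of _ "1 / (k * l\<^sup>2)"]) simp
qed

lemma strictly_positiveI:
  fixes T :: "('a::complex_hilbert, 'a) cblinfun"
  assumes "T\<^sup>\<dagger> = T" "\<And>x. \<delta> * (norm x)\<^sup>2 \<le> inner (T *\<^sub>V x) x" "0 < \<delta>"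
  shows "strictly_positive T"
  unfolding strictly_positive_def
proof
  show "nonneg_op T"
  proof (rule nonneg_opI[OF assms(1)])
    fix x :: 'a
    have "0 \<le> \<delta> * (norm x)\<^sup>2" using assms(3) by simp
    then show "0 \<le> inner (T *\<^sub>V x) x" using assms(2)[of x] by linarith
  qed
  show "invertible_op T" by (rule coercive_invertible[OF assms(2,3)])
qed

text \<open>
  With \<open>W = I - T / k\<close> of norm \<open>q < 1\<close>, the square root of \<open>T / k\<close> is \<open>I - Y\<close> for the fixed point
  \<open>Y\<close> of the contraction \<open>Y \<mapsto> (W + Y\<^sup>2) / 2\<close> of the ball of radius \<open>q\<close>.  Working inside the
  bicommutant of \<open>T\<close> makes the root commute with every other root, which gives uniqueness.
\<close>

lemma op_sqrt:
  fixes T :: "('a::complex_hilbert, 'a) cblinfun"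
  assumes sa: "T\<^sup>\<dagger> = T" and T: "\<And>x. \<delta> * (norm x)\<^sup>2 \<le> inner (T *\<^sub>V x) x" and \<delta>: "0 < \<delta>"
  shows "op_sqrt T o\<^sub>C op_sqrt T = T" "(op_sqrt T)\<^sup>\<dagger> = op_sqrt T" "strictly_positive (op_sqrt T)"
proof -
  from norm_id_minus_scaled_less[OF T \<delta>] obtain k
    where k: "0 < k" and n: "norm (id_op - inverse k *\<^sub>R T) < 1" by blast
  define W where "W = id_op - inverse k *\<^sub>R T"
  define q where "q = norm W"
  have q: "0 \<le> q" "q < 1" using n by (simp_all add: q_def W_def)
  define M where "M = {Y. norm Y \<le> q \<and> (\<forall>x y. inner (Y *\<^sub>V x) y = inner x (Y *\<^sub>V y))
    \<and> (\<forall>C. C o\<^sub>C T = T o\<^sub>C C \<longrightarrow> C o\<^sub>C Y = Y o\<^sub>C C)}"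
  define h where "h Y = (1/2) *\<^sub>R (W + Y o\<^sub>C Y)" for Y
  have sa': "inner (T *\<^sub>V x) y = inner x (T *\<^sub>V y)" for x y by (simp add: inner_adj sa)
  have M_norm: "norm Y \<le> q" and M_sa: "inner (Y *\<^sub>V x) y = inner x (Y *\<^sub>V y)"
    if "Y \<in> M" for Y x y using that unfolding M_def by blast+
  have M_comm: "C *\<^sub>V Y *\<^sub>V x = Y *\<^sub>V C *\<^sub>V x"
    if "Y \<in> M" "C o\<^sub>C T = T o\<^sub>C C" for Y C x
  proof -
    have "C o\<^sub>C Y = Y o\<^sub>C C" using that unfolding M_def by blast
    then have "(C o\<^sub>C Y) *\<^sub>V x = (Y o\<^sub>C C) *\<^sub>V x" by (rule arg_cong)
    then show ?thesis by simp
  qed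
  have M_I: "Y \<in> M" if "norm Y \<le> q" "\<And>x y. inner (Y *\<^sub>V x) y = inner x (Y *\<^sub>V y)"
    "\<And>C x. C o\<^sub>C T = T o\<^sub>C C \<Longrightarrow> C *\<^sub>V Y *\<^sub>V x = Y *\<^sub>V C *\<^sub>V x" for Y
    using that unfolding M_def by (auto intro!: cblinfun_eqI)
  have "complete M"
    unfolding complete_eq_closed closed_sequential_limits
  proof (intro allI impI, elim conjE)
    fix X Y assume XM: "\<forall>n. X n \<in> M" and X: "X \<longlonglongrightarrow> Y"
    have Xx: "(\<lambda>n. X n *\<^sub>V x) \<longlonglongrightarrow> Y *\<^sub>V x" for x
      by (rule bounded_bilinear.tendsto[OF bounded_bilinear_cblinfun_apply X tendsto_const])
    show "Y \<in> M"
    proof (rule M_I)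
      show "norm Y \<le> q"
        by (rule LIMSEQ_le_const2[OF tendsto_norm[OF X]]) (use XM M_norm in blast)
    next
      fix x y
      have "(\<lambda>n. inner (X n *\<^sub>V x) y) \<longlonglongrightarrow> inner (Y *\<^sub>V x) y" by (intro tendsto_intros Xx)
      moreover have "(\<lambda>n. inner x (X n *\<^sub>V y)) \<longlonglongrightarrow> inner x (Y *\<^sub>V y)" by (intro tendsto_intros Xx)
      moreover have "inner (X n *\<^sub>V x) y = inner x (X n *\<^sub>V y)" for n using XM M_sa by blast
      ultimately show "inner (Y *\<^sub>V x) y = inner x (Y *\<^sub>V y)" by (simp add: LIMSEQ_unique)
    next
      fix C x assume C: "C o\<^sub>C T = T o\<^sub>C C"
      have "(\<lambda>n. C *\<^sub>V X n *\<^sub>V x) \<longlonglongrightarrow> C *\<^sub>V Y *\<^sub>V x"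
        by (rule bounded_linear.tendsto[OF bounded_linear_cblinfun Xx])
      moreover have "C *\<^sub>V X n *\<^sub>V x = X n *\<^sub>V C *\<^sub>V x" for n using XM M_comm[OF _ C] by blast
      ultimately show "C *\<^sub>V Y *\<^sub>V x = Y *\<^sub>V C *\<^sub>V x" using Xx[of "C *\<^sub>V x"] by (simp add: LIMSEQ_unique)
    qed
  qed
  moreover have "M \<noteq> {}"
  proof -
    have "0 \<in> M" using q by (intro M_I) simp_all
    then show ?thesis by blast
  qed
  moreover have "h ` M \<subseteq> M"
  proof safe
    fix Y assume Y: "Y \<in> M"
    have "norm (h Y) \<le> (q + q * q) / 2"
    proof -
      have "norm (W + Y o\<^sub>C Y) \<le> q + norm Y * norm Y"
        using norm_triangle_ineq[of W "Y o\<^sub>C Y"] norm_op_comp_le[of Y Y] by (simp add: q_def)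
      also have "\<dots> \<le> q + q * q" using q by (intro add_left_mono mult_mono M_norm[OF Y]) simp_all
      finally show ?thesis by (simp add: h_def)
    qed
    also have "\<dots> \<le> q" using q mult_left_mono[of q 1 q] by simp
    finally have "norm (h Y) \<le> q" .
    moreover have "inner (h Y *\<^sub>V x) y = inner x (h Y *\<^sub>V y)" for x y
      by (simp add: h_def W_def inner_add_left inner_add_right inner_diff_left
          inner_diff_right sa' M_sa[OF Y])
    moreover have "C *\<^sub>V h Y *\<^sub>V x = h Y *\<^sub>V C *\<^sub>V x" if C: "C o\<^sub>C T = T o\<^sub>C C" for C x
    proof -
      have "(C o\<^sub>C T) *\<^sub>V x = (T o\<^sub>C C) *\<^sub>V x" using C by (rule arg_cong)
      then have "C *\<^sub>V T *\<^sub>V x = T *\<^sub>V C *\<^sub>V x" by simp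
      then show ?thesis by (simp add: h_def W_def cblinfun_linear M_comm[OF Y C])
    qed
    ultimately show "h Y \<in> M" by (rule M_I)
  qed
  moreover have "\<forall>Y\<in>M. \<forall>Z\<in>M. dist (h Y) (h Z) \<le> q * dist Y Z"
  proof (intro ballI)
    fix Y Z assume Y: "Y \<in> M" and Z: "Z \<in> M"
    \<comment> \<open>A factorisation of the difference of squares that holds without commuting Y
      and Z; it yields the Lipschitz constant (q + q) / 2.\<close>
    have eq: "h Y - h Z = (1/2) *\<^sub>R (Y o\<^sub>C (Y - Z) + (Y - Z) o\<^sub>C Z)"
      by (rule cblinfun_eqI) (simp add: h_def cblinfun_linear algebra_simps)
    have "norm (Y o\<^sub>C (Y - Z) + (Y - Z) o\<^sub>C Z) \<le> norm Y * norm (Y - Z) + norm (Y - Z) * norm Z"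
      by (rule order_trans[OF norm_triangle_ineq add_mono[OF norm_op_comp_le norm_op_comp_le]])
    also have "\<dots> \<le> q * norm (Y - Z) + norm (Y - Z) * q"
      by (intro add_mono mult_right_mono mult_left_mono M_norm Y Z) simp_all
    finally show "dist (h Y) (h Z) \<le> q * dist Y Z" by (simp add: dist_norm eq)
  qed
  ultimately have "\<exists>!Y\<in>M. h Y = Y" by (intro Banach_fix[OF _ _ q]) blast+
  then obtain Y where Y: "Y \<in> M" and hY: "h Y = Y" by blast
  have YY: "2 *\<^sub>R Y = W + Y o\<^sub>C Y"
    using arg_cong[OF hY, of "\<lambda>Z. 2 *\<^sub>R Z"] by (simp add: h_def)
  define B where "B = sqrt k *\<^sub>R (id_op - Y)"
  have BB: "B o\<^sub>C B = T"
  proof (rule cblinfun_eqI)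
    fix x
    have "2 *\<^sub>R (Y *\<^sub>V x) = W *\<^sub>V x + Y *\<^sub>V Y *\<^sub>V x"
      using arg_cong[OF YY, of "\<lambda>Z. Z *\<^sub>V x"] by simp
    then have "x - 2 *\<^sub>R (Y *\<^sub>V x) + Y *\<^sub>V Y *\<^sub>V x = inverse k *\<^sub>R (T *\<^sub>V x)" by (simp add: W_def)
    moreover have "(B o\<^sub>C B) *\<^sub>V x = k *\<^sub>R (x - 2 *\<^sub>R (Y *\<^sub>V x) + Y *\<^sub>V Y *\<^sub>V x)"
      using k by (simp add: B_def cblinfun_linear algebra_simps scaleR_2)
    ultimately show "(B o\<^sub>C B) *\<^sub>V x = T *\<^sub>V x" using k by simp
  qed
  have B_sa: "B\<^sup>\<dagger> = B"
    by (rule adj_eqI) (simp add: B_def M_sa[OF Y] inner_diff_left inner_diff_right)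
  have B_co: "sqrt k * (1 - q) * (norm x)\<^sup>2 \<le> inner (B *\<^sub>V x) x" for x
  proof -
    have "inner (Y *\<^sub>V x) x \<le> norm Y * norm x * norm x"
      by (rule order_trans[OF norm_cauchy_schwarz mult_right_mono[OF norm_cblinfun_apply_le]]) simp
    also have "\<dots> \<le> q * norm x * norm x"
      by (intro mult_right_mono M_norm[OF Y]) simp_all
    finally have "(1 - q) * (norm x)\<^sup>2 \<le> inner (x - Y *\<^sub>V x) x"
      by (simp add: inner_diff_left power2_norm_eq_inner[symmetric] power2_eq_square algebra_simps)
    then show ?thesis
      using k by (simp add: B_def mult.assoc mult_left_mono)
  qed
  have B_pos: "0 < sqrt k * (1 - q)" using k q by simp
  have B: "strictly_positive B" by (rule strictly_positiveI[OF B_sa B_co B_pos])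
  have "op_sqrt T = B"
    unfolding op_sqrt_def
  proof (rule the_equality)
    show "nonneg_op B \<and> B o\<^sub>C B = T" using B BB by (simp add: strictly_positive_def)
    fix C assume C: "nonneg_op C \<and> C o\<^sub>C C = T"
    then have "C o\<^sub>C T = T o\<^sub>C C" by (metis op_comp_assoc)
    then have CY: "C *\<^sub>V Y *\<^sub>V x = Y *\<^sub>V C *\<^sub>V x" for x by (rule M_comm[OF Y])
    have "inner (C *\<^sub>V x) x \<ge> 0" for x
      using C by (simp add: nonneg_op_def inner_eq_Re_cinner)
    then have "sqrt k * (1 - q) * (norm x)\<^sup>2 \<le> inner ((B + C) *\<^sub>V x) x" for x
      using B_co[of x] by (simp add: inner_add_left add_increasing2)
    from coercive_invertible[OF this B_pos] have inv: "invertible_op (B + C)" .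
    \<comment> \<open>The cross terms cancel because C commutes with T and therefore with Y. Since B
      + C is coercive, hence invertible, B - C must vanish.\<close>
    have "(B - C) *\<^sub>V (B + C) *\<^sub>V x = (B o\<^sub>C B) *\<^sub>V x - (C o\<^sub>C C) *\<^sub>V x" for x
      by (simp add: B_def cblinfun_linear CY algebra_simps)
    then have 0: "(B - C) *\<^sub>V (B + C) *\<^sub>V x = 0" for x using BB C by simp
    show "C = B"
    proof (rule cblinfun_eqI)
      show "C *\<^sub>V x = B *\<^sub>V x" for x
        using 0[of "op_inv (B + C) *\<^sub>V x"] op_inv_apply(1)[OF inv, of x] by simp
    qed
  qed
  then show "op_sqrt T o\<^sub>C op_sqrt T = T" "(op_sqrt T)\<^sup>\<dagger> = op_sqrt T" "strictly_positive (op_sqrt T)"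
    using BB B_sa B by simp_all
qed

section \<open>Analytic operator functions\<close>

lemma op_comp_scaleC: "(c *\<^sub>C A) o\<^sub>C B = c *\<^sub>C (A o\<^sub>C B)" "A o\<^sub>C (c *\<^sub>C B) = c *\<^sub>C (A o\<^sub>C B)"
  by (rule cblinfun_eqI, simp)+

definition analytic_at :: "(complex \<Rightarrow> 'a::complex_normed_vector) \<Rightarrow> complex \<Rightarrow> bool"
  where "analytic_at F z \<longleftrightarrow> (\<exists>D. (F has_derivative (\<lambda>h. h *\<^sub>C D)) (at z))"

lemma analytic_on_disc_iff: "analytic_on_disc F \<longleftrightarrow> (\<forall>z\<in>\<bbbD>. analytic_at F z)"
  by (simp add: analytic_on_disc_def analytic_at_def)

lemma analytic_at_const [simp]: "analytic_at (\<lambda>z. A) z"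
  unfolding analytic_at_def by (rule exI[of _ 0]) simp

lemma analytic_at_scaleC:
  assumes "analytic_at F z"
  shows "analytic_at (\<lambda>z. z *\<^sub>C F z) z"
proof -
  obtain D where D: "(F has_derivative (\<lambda>h. h *\<^sub>C D)) (at z)" using assms by (auto simp: analytic_at_def)
  have "((\<lambda>z. z *\<^sub>C F z) has_derivative (\<lambda>h. z *\<^sub>C h *\<^sub>C D + h *\<^sub>C F z)) (at z)"
    by (rule bounded_bilinear.FDERIV[OF bounded_bilinear_scaleC has_derivative_ident D])
  also have "(\<lambda>h. z *\<^sub>C h *\<^sub>C D + h *\<^sub>C F z) = (\<lambda>h. h *\<^sub>C (z *\<^sub>C D + F z))"
    by (simp add: scaleC_add_right scaleC_scaleC mult.commute)
  finally show ?thesis by (auto simp: analytic_at_def)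
qed

lemma analytic_at_add:
  assumes "analytic_at F z" "analytic_at G z"
  shows "analytic_at (\<lambda>z. F z + G z) z"
proof -
  obtain D D' where "(F has_derivative (\<lambda>h. h *\<^sub>C D)) (at z)" "(G has_derivative (\<lambda>h. h *\<^sub>C D')) (at z)"
    using assms by (auto simp: analytic_at_def)
  from has_derivative_add[OF this] show ?thesis
    by (auto simp: analytic_at_def scaleC_add_right[symmetric])
qed

lemma analytic_at_op_comp:
  assumes "analytic_at F z" "analytic_at G z"
  shows "analytic_at (\<lambda>z. F z o\<^sub>C G z) z"
proof -
  obtain D D' where "(F has_derivative (\<lambda>h. h *\<^sub>C D)) (at z)" "(G has_derivative (\<lambda>h. h *\<^sub>C D')) (at z)"
    using assms by (auto simp: analytic_at_def)
  from bounded_bilinear.FDERIV[OF bounded_bilinear_op_comp this] show ?thesis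
    by (auto simp: analytic_at_def scaleC_add_right[symmetric] op_comp_scaleC)
qed

lemma analytic_at_minus: "analytic_at F z \<Longrightarrow> analytic_at (\<lambda>z. - F z) z"
  unfolding analytic_at_def by (metis (no_types, lifting) ext has_derivative_minus scaleC_minus_right)

lemma analytic_at_diff: "analytic_at F z \<Longrightarrow> analytic_at G z \<Longrightarrow> analytic_at (\<lambda>z. F z - G z) z"
  using analytic_at_add[of F z "\<lambda>z. - G z"] analytic_at_minus by force

lemma analytic_at_transform:
  assumes "analytic_at F z" "open S" "z \<in> S" "\<And>w. w \<in> S \<Longrightarrow> F w = G w"
  shows "analytic_at G z"
  using assms has_derivative_transform_within_open[of F _ z UNIV S G]
  by (auto simp: analytic_at_def)

lemma analytic_at_isCont: "analytic_at F z \<Longrightarrow> isCont F z"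
  by (auto simp: analytic_at_def intro: has_derivative_continuous)

text \<open>B factors as A (I - W) with |W| <= 1/2, and the factor 2 is 1 / (1 - 1/2). The smallness
  condition is stated through the inverse of A so that one bound serves for all nearby B.\<close>

lemma invertible_perturb:
  fixes A :: "('a::complex_hilbert, 'b::complex_hilbert) cblinfun"
  assumes A: "invertible_op A" and AB: "norm (op_inv A) * norm (B - A) \<le> 1/2"
  shows "invertible_op B" "norm (op_inv B) \<le> 2 * norm (op_inv A)"
proof -
  define W where "W = op_inv A o\<^sub>C (A - B)"
  have "norm W < 1"
    using norm_op_comp_le[of "op_inv A" "A - B"] AB by (simp add: W_def norm_minus_commute)
  then have "invertible_op (A o\<^sub>C (id_op - W))"
    by (intro invertible_op_comp A invertible_id_minus)
  also have "A o\<^sub>C (id_op - W) = B"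
    by (rule cblinfun_eqI) (simp add: W_def cblinfun_linear op_inv_apply[OF A])
  finally show B: "invertible_op B" .
  show "norm (op_inv B) \<le> 2 * norm (op_inv A)"
  proof (rule norm_cblinfun_le)
    fix y
    define x where "x = op_inv B *\<^sub>V y"
    have y: "B *\<^sub>V x = y" by (simp add: x_def op_inv_apply[OF B])
    have "x = op_inv A *\<^sub>V (y + (A - B) *\<^sub>V x)"
      using op_inv_apply(2)[OF A, of x] by (simp add: y)
    then have "norm x = norm (op_inv A *\<^sub>V y + (op_inv A o\<^sub>C (A - B)) *\<^sub>V x)"
      by (simp add: cblinfun_linear)
    also have "\<dots> \<le> norm (op_inv A) * norm y + norm (op_inv A o\<^sub>C (A - B)) * norm x"
      by (rule order_trans[OF norm_triangle_ineq add_mono[OF norm_cblinfun_apply_le norm_cblinfun_apply_le]])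
    also have "\<dots> \<le> norm (op_inv A) * norm y + 1/2 * norm x"
      by (intro add_left_mono mult_right_mono order_trans[OF norm_op_comp_le])
        (use AB in \<open>simp_all add: norm_minus_commute\<close>)
    finally show "norm (op_inv B *\<^sub>V y) \<le> 2 * norm (op_inv A) * norm y" by (simp add: x_def)
  qed simp
qed

text \<open>The resolvent identity J - I = - J (A w - A z) I suggests the derivative - I D I. The
  error consists of the remainder of A and of a term containing J - I; both are controlled once J is
  bounded near z by \<open>invertible_perturb\<close>.\<close>

lemma analytic_at_op_inv:
  fixes A :: "complex \<Rightarrow> ('a::complex_hilbert, 'b::complex_hilbert) cblinfun"
  assumes an: "analytic_at A z" and inv: "invertible_op (A z)"
  shows "analytic_at (\<lambda>w. op_inv (A w)) z"
proof -
  obtain D where D: "(A has_derivative (\<lambda>h. h *\<^sub>C D)) (at z)" using an by (auto simp: analytic_at_def)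
  define I where "I = op_inv (A z)"
  define r where "r w = norm (A w - A z - (w - z) *\<^sub>C D) / norm (w - z)" for w
  have r: "(r \<longlongrightarrow> 0) (at z)" using D by (simp add: has_derivative_iff_norm r_def[abs_def])
  have A: "(A \<longlongrightarrow> A z) (at z)" using analytic_at_isCont[OF an] by (simp add: isCont_def)
  have "((\<lambda>w. norm I * norm (A w - A z)) \<longlongrightarrow> norm I * norm (A z - A z)) (at z)"
    by (intro tendsto_intros A)
  then have "eventually (\<lambda>w. norm I * norm (A w - A z) < 1/2) (at z)"
    by (rule order_tendstoD) simp
  then have close: "eventually (\<lambda>w. norm I * norm (A w - A z) \<le> 1/2) (at z)"
    by eventually_elim simp
  have bnd: "norm (op_inv (A w) - I - (w - z) *\<^sub>C (- (I o\<^sub>C D o\<^sub>C I))) / norm (w - z)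
      \<le> 2 * norm I * r w * norm I + (2 * norm I * norm (A w - A z) * norm I) * norm D * norm I"
    if w: "norm I * norm (A w - A z) \<le> 1/2" and wz: "w \<noteq> z" for w
  proof -
    define J where "J = op_inv (A w)"
    define \<rho> where "\<rho> = A w - A z - (w - z) *\<^sub>C D"
    have invw: "invertible_op (A w)" and J: "norm J \<le> 2 * norm I"
      using invertible_perturb[OF inv, of "A w"] w by (simp_all add: I_def J_def)
    have JI: "J - I = - (J o\<^sub>C (A w - A z) o\<^sub>C I)"
      by (rule cblinfun_eqI)
        (simp add: J_def I_def cblinfun_linear op_inv_apply[OF inv] op_inv_apply[OF invw])
    have "norm (J - I) \<le> norm J * norm (A w - A z) * norm I"
      unfolding JI norm_minus_cancel
      by (intro order_trans[OF norm_op_comp_le] mult_right_mono norm_op_comp_le) simp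
    also have "\<dots> \<le> 2 * norm I * norm (A w - A z) * norm I"
      by (intro mult_right_mono J) simp_all
    finally have nJI: "norm (J - I) \<le> 2 * norm I * norm (A w - A z) * norm I" .
    have "J - I - (w - z) *\<^sub>C (- (I o\<^sub>C D o\<^sub>C I)) = - (J o\<^sub>C \<rho> o\<^sub>C I) - (w - z) *\<^sub>C ((J - I) o\<^sub>C D o\<^sub>C I)"
    proof (rule cblinfun_eqI)
      fix x
      have JIx: "J *\<^sub>V x - I *\<^sub>V x = - (J *\<^sub>V (A w *\<^sub>V I *\<^sub>V x - A z *\<^sub>V I *\<^sub>V x))"
        using arg_cong[OF JI, of "\<lambda>T. T *\<^sub>V x"] by simp
      show "(J - I - (w - z) *\<^sub>C (- (I o\<^sub>C D o\<^sub>C I))) *\<^sub>V x =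
        (- (J o\<^sub>C \<rho> o\<^sub>C I) - (w - z) *\<^sub>C ((J - I) o\<^sub>C D o\<^sub>C I)) *\<^sub>V x"
        by (simp add: JIx \<rho>_def cblinfun_linear scaleC_minus_right scaleC_diff_right)
    qed
    then have "norm (J - I - (w - z) *\<^sub>C (- (I o\<^sub>C D o\<^sub>C I)))
        \<le> norm (J o\<^sub>C \<rho> o\<^sub>C I) + cmod (w - z) * norm ((J - I) o\<^sub>C D o\<^sub>C I)"
      using norm_triangle_ineq4[of "- (J o\<^sub>C \<rho> o\<^sub>C I)" "(w - z) *\<^sub>C ((J - I) o\<^sub>C D o\<^sub>C I)"] by (simp add: norm_scaleC)
    also have "\<dots> \<le> norm J * norm \<rho> * norm I + cmod (w - z) * (norm (J - I) * norm D * norm I)"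
      by (intro add_mono mult_left_mono order_trans[OF norm_op_comp_le] mult_right_mono norm_op_comp_le) simp_all
    also have "\<dots> \<le> 2 * norm I * norm \<rho> * norm I
        + cmod (w - z) * ((2 * norm I * norm (A w - A z) * norm I) * norm D * norm I)"
      by (intro add_mono mult_left_mono mult_right_mono J nJI) simp_all
    finally have "norm (J - I - (w - z) *\<^sub>C (- (I o\<^sub>C D o\<^sub>C I))) / norm (w - z)
       \<le> (2 * norm I * norm \<rho> * norm I
        + cmod (w - z) * ((2 * norm I * norm (A w - A z) * norm I) * norm D * norm I)) / norm (w - z)"
      by (rule divide_right_mono) simp
    also have "\<dots> = 2 * norm I * r w * norm I + (2 * norm I * norm (A w - A z) * norm I) * norm D * norm I"
      using wz by (simp add: r_def \<rho>_def add_divide_distrib)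
    finally show ?thesis by (simp add: J_def)
  qed
  have "((\<lambda>w. op_inv (A w)) has_derivative (\<lambda>h. h *\<^sub>C (- (I o\<^sub>C D o\<^sub>C I)))) (at z)"
    unfolding has_derivative_iff_norm
  proof
    show "bounded_linear (\<lambda>h. h *\<^sub>C (- (I o\<^sub>C D o\<^sub>C I)))"
      by (rule bounded_bilinear.bounded_linear_left[OF bounded_bilinear_scaleC])
    show "((\<lambda>w. norm (op_inv (A w) - op_inv (A z) - (w - z) *\<^sub>C (- (I o\<^sub>C D o\<^sub>C I))) / norm (w - z)) \<longlongrightarrow> 0) (at z)"
    proof (rule Lim_null_comparison)
      have "eventually (\<lambda>w. w \<noteq> z) (at z)" by (rule eventually_neq_at_within)
      with close show "eventually (\<lambda>w. norm (norm (op_inv (A w) - op_inv (A z) - (w - z) *\<^sub>C (- (I o\<^sub>C D o\<^sub>C I))) / norm (w - z))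
        \<le> 2 * norm I * r w * norm I + (2 * norm I * norm (A w - A z) * norm I) * norm D * norm I) (at z)"
        by eventually_elim (use bnd in \<open>simp add: I_def\<close>)
      have "((\<lambda>w. 2 * norm I * r w * norm I + (2 * norm I * norm (A w - A z) * norm I) * norm D * norm I)
        \<longlongrightarrow> 2 * norm I * 0 * norm I + (2 * norm I * norm (A z - A z) * norm I) * norm D * norm I) (at z)"
        by (intro tendsto_intros r A)
      then show "((\<lambda>w. 2 * norm I * r w * norm I + (2 * norm I * norm (A w - A z) * norm I) * norm D * norm I)
        \<longlongrightarrow> 0) (at z)" by simp
    qed
  qed
  then show ?thesis by (auto simp: analytic_at_def)
qed

lemma bounded_linear_apply: "bounded_linear (\<lambda>T. T *\<^sub>V x)"
  by (rule bounded_bilinear.bounded_linear_left[OF bounded_bilinear_cblinfun_apply])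

lemma bounded_linear_cinner_apply: "bounded_linear (\<lambda>T. cinner (T *\<^sub>V x) y)"
  by (rule bounded_linear_compose[OF bounded_linear_cinner_left bounded_linear_apply])

lemma analytic_at_cinner:
  assumes "analytic_at F z"
  shows "(\<lambda>z. cinner (F z *\<^sub>V x) y) field_differentiable (at z)"
proof -
  obtain D where D: "(F has_derivative (\<lambda>h. h *\<^sub>C D)) (at z)" using assms by (auto simp: analytic_at_def)
  from bounded_linear.has_derivative[OF bounded_linear_cinner_apply D]
  have "((\<lambda>z. cinner (F z *\<^sub>V x) y) has_derivative (\<lambda>h. h * cinner (D *\<^sub>V x) y)) (at z)"
    by (simp add: cinner_scaleC_left)
  then have "((\<lambda>z. cinner (F z *\<^sub>V x) y) has_field_derivative cinner (D *\<^sub>V x) y) (at z)"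
    by (simp add: has_field_derivative_def mult.commute[of _ "cinner (D *\<^sub>V x) y"])
  then show ?thesis by (auto simp: field_differentiable_def)
qed

section \<open>The shift, point evaluation and operators commuting with the shift\<close>

lemma ell2_nth_simps [simp]:
  "ell2_nth (0::'a::complex_hilbert ell2) n = 0"
  "ell2_nth (x + y) n = ell2_nth x n + ell2_nth (y::'a ell2) n"
  "ell2_nth (x - y) n = ell2_nth x n - ell2_nth (y::'a ell2) n"
  "ell2_nth (c *\<^sub>C x) n = c *\<^sub>C ell2_nth (x::'a ell2) n"
  by (simp_all add: zero_ell2.rep_eq plus_ell2.rep_eq minus_ell2.rep_eq scaleC_ell2.rep_eq)

lemma ell2_eqI: "(\<And>n. ell2_nth x n = ell2_nth y n) \<Longrightarrow> x = y"
  by (simp add: ell2_nth_inject[symmetric] fun_eq_iff)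

lemma nth_shift_op [simp]: "ell2_nth (shift_op *\<^sub>V x) n = (case n of 0 \<Rightarrow> 0 | Suc m \<Rightarrow> ell2_nth x m)"
  by (simp add: shift_op.rep_eq shift_seq.rep_eq)

lemma nth_E_op [simp]: "ell2_nth (E_op *\<^sub>V v) n = (case n of 0 \<Rightarrow> v | Suc m \<Rightarrow> 0)"
  by (simp add: E_op.rep_eq first_seq.rep_eq)

lift_definition tail_seq :: "'a::complex_hilbert ell2 \<Rightarrow> 'a ell2" is "\<lambda>x n. x (Suc n)"
  by (subst summable_Suc_iff)

lemma inner_ell2_split:
  "inner x y = inner (ell2_nth x 0) (ell2_nth y 0) + (\<Sum>n. inner (ell2_nth x (Suc n)) (ell2_nth y (Suc n)))"
  for x y :: "'a::complex_hilbert ell2"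
  using suminf_split_head[OF summable_ell2_inner, of "ell2_nth x" "ell2_nth y"] ell2_nth[of x] ell2_nth[of y]
  by (simp add: inner_ell2.rep_eq)

lemma shift_adj: "shift_op\<^sup>\<dagger> *\<^sub>V y = tail_seq y"
proof (rule inner_eqI)
  fix x
  have "inner (shift_op *\<^sub>V x) y = inner x (tail_seq y)"
    by (subst inner_ell2_split) (simp add: inner_ell2.rep_eq tail_seq.rep_eq)
  then show "inner (shift_op\<^sup>\<dagger> *\<^sub>V y) x = inner (tail_seq y) x"
    unfolding inner_adj'[symmetric] by (simp add: inner_commute)
qed

lemma nth_shift_adj [simp]: "ell2_nth (shift_op\<^sup>\<dagger> *\<^sub>V y) n = ell2_nth y (Suc n)"
  by (simp add: shift_adj tail_seq.rep_eq)

lemma E_adj [simp]: "E_op\<^sup>\<dagger> *\<^sub>V y = ell2_nth y 0"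
proof (rule inner_eqI)
  fix v
  have "inner (E_op *\<^sub>V v) y = inner v (ell2_nth y 0)"
    by (subst inner_ell2_split) simp
  then show "inner (E_op\<^sup>\<dagger> *\<^sub>V y) v = inner (ell2_nth y 0) v"
    unfolding inner_adj'[symmetric] by (simp add: inner_commute)
qed

lemma shift_adj_shift [simp]: "shift_op\<^sup>\<dagger> *\<^sub>V shift_op *\<^sub>V x = x"
  and shift_adj_E [simp]: "shift_op\<^sup>\<dagger> *\<^sub>V E_op *\<^sub>V v = 0"
  by (rule ell2_eqI, simp)+

text \<open>The resolution \<open>E E\<^sup>\<dagger> + S S\<^sup>\<dagger> = I\<close>: a sequence
  is recovered from its zeroth entry and its backward shift.\<close>

lemma E_plus_shift: "E_op *\<^sub>V ell2_nth x 0 + shift_op *\<^sub>V shift_op\<^sup>\<dagger> *\<^sub>V x = x"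
  by (rule ell2_eqI) (simp split: nat.split)

lemma inner_shift_op [simp]: "inner (shift_op *\<^sub>V x) (shift_op *\<^sub>V y) = inner x y"
  by (simp add: inner_adj)

lemma inner_E_op [simp]: "inner (E_op *\<^sub>V x) (E_op *\<^sub>V y) = inner x y"
  by (simp add: inner_adj)

lemma inner_E_shift [simp]: "inner (E_op *\<^sub>V x) (shift_op *\<^sub>V y) = 0" "inner (shift_op *\<^sub>V y) (E_op *\<^sub>V x) = 0"
  by (simp_all add: inner_adj)

lemma norm_shift_op [simp]: "norm (shift_op *\<^sub>V x) = norm x"
  by (simp add: norm_eq_sqrt_inner)

lemma norm_shift_adj_le: "norm (shift_op\<^sup>\<dagger> *\<^sub>V x) \<le> norm x"
  using norm_adj_apply_le[of shift_op 1 x] by simp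

text \<open>An isometry preserves norms, so it has no eigenvalue inside the disc.\<close>

lemma shift_eq_scaleC_iff:
  assumes "z \<in> \<bbbD>"
  shows "shift_op *\<^sub>V g = z *\<^sub>C g \<longleftrightarrow> g = 0"
proof
  assume "shift_op *\<^sub>V g = z *\<^sub>C g"
  then have "norm g = cmod z * norm g" by (metis norm_shift_op norm_scaleC)
  with assms show "g = 0" by auto
qed simp

definition resolvent :: "complex \<Rightarrow> ('a::complex_hilbert ell2, 'a ell2) cblinfun"
  where "resolvent z = op_inv (id_op - z *\<^sub>C shift_op\<^sup>\<dagger>)"

lemma eval_op_resolvent: "eval_op z *\<^sub>V u = ell2_nth (resolvent z *\<^sub>V u) 0"
  by (simp add: eval_op_def resolvent_def)

lemma invertible_id_minus_shift_adj:
  assumes "z \<in> \<bbbD>"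
  shows "invertible_op (id_op - z *\<^sub>C (shift_op::('a::complex_hilbert ell2, 'a ell2) cblinfun)\<^sup>\<dagger>)"
proof (rule invertible_id_minus)
  have "norm ((shift_op::('a ell2, 'a ell2) cblinfun)\<^sup>\<dagger>) \<le> 1"
    by (rule norm_cblinfun_le) (simp_all add: norm_shift_adj_le)
  then have "cmod z * norm ((shift_op::('a ell2, 'a ell2) cblinfun)\<^sup>\<dagger>) \<le> cmod z"
    by (rule mult_left_le) simp
  with assms show "norm (z *\<^sub>C (shift_op::('a ell2, 'a ell2) cblinfun)\<^sup>\<dagger>) < 1"
    by (simp add: norm_scaleC)
qed

context
  fixes z :: complex
  assumes z: "z \<in> \<bbbD>"
begin

lemma resolvent_right: "resolvent z *\<^sub>V u - z *\<^sub>C (shift_op\<^sup>\<dagger> *\<^sub>V resolvent z *\<^sub>V u) = u"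
  using op_inv_apply(1)[OF invertible_id_minus_shift_adj[OF z], of u] by (simp add: resolvent_def)

lemma resolvent_left: "resolvent z *\<^sub>V (u - z *\<^sub>C (shift_op\<^sup>\<dagger> *\<^sub>V u)) = u"
  using op_inv_apply(2)[OF invertible_id_minus_shift_adj[OF z], of u] by (simp add: resolvent_def)

lemma resolvent_eqI: "w - z *\<^sub>C (shift_op\<^sup>\<dagger> *\<^sub>V w) = u \<Longrightarrow> resolvent z *\<^sub>V u = w"
  using resolvent_left by blast

lemma resolvent_shift_adj: "resolvent z *\<^sub>V shift_op\<^sup>\<dagger> *\<^sub>V u = shift_op\<^sup>\<dagger> *\<^sub>V resolvent z *\<^sub>V u"
  by (rule resolvent_eqI) (metis cblinfun_diff cblinfun_scaleC resolvent_right)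

lemma eval_op_E [simp]: "eval_op z *\<^sub>V E_op *\<^sub>V v = v"
proof -
  have "resolvent z *\<^sub>V E_op *\<^sub>V v = E_op *\<^sub>V v" by (rule resolvent_eqI) simp
  then show ?thesis by (simp add: eval_op_resolvent)
qed

lemma eval_op_shift [simp]: "eval_op z *\<^sub>V shift_op *\<^sub>V x = z *\<^sub>C (eval_op z *\<^sub>V x)"
proof -
  define w where "w = resolvent z *\<^sub>V x"
  have w: "x = w - z *\<^sub>C (shift_op\<^sup>\<dagger> *\<^sub>V w)" by (simp add: w_def resolvent_right)
  have "resolvent z *\<^sub>V shift_op *\<^sub>V x = shift_op *\<^sub>V x + z *\<^sub>C w"
    by (rule resolvent_eqI) (simp add: cblinfun_add scaleC_add_right, subst w, simp add: scaleC_diff_right)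
  then show ?thesis by (simp add: eval_op_resolvent w_def)
qed

text \<open>Division with remainder by S - z: the remainder is the value at z, the quotient is
  \<open>S\<^sup>\<dagger> *\<^sub>V resolvent z *\<^sub>V u\<close>, that is, the difference
  quotient (u(w) - u(z)) / (w - z).\<close>

lemma eval_op_decomp:
  "u = E_op *\<^sub>V eval_op z *\<^sub>V u + (shift_op *\<^sub>V shift_op\<^sup>\<dagger> *\<^sub>V resolvent z *\<^sub>V u - z *\<^sub>C (shift_op\<^sup>\<dagger> *\<^sub>V resolvent z *\<^sub>V u))"
  using E_plus_shift[of "resolvent z *\<^sub>V u"] resolvent_right[of u]
  by (simp add: eval_op_resolvent add_diff_eq)

text \<open>This justifies the name point evaluation. With w the resolvent applied to u, the entries
  satisfy u_n = w_n - z w_{n+1}, so the partial sums telescope.\<close>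

lemma eval_op_sums: "(\<lambda>n. z ^ n *\<^sub>C ell2_nth u n) sums (eval_op z *\<^sub>V u)"
proof -
  define w where "w = resolvent z *\<^sub>V u"
  have w: "ell2_nth u n = ell2_nth w n - z *\<^sub>C ell2_nth w (Suc n)" for n
    using arg_cong[OF resolvent_right[of u], of "\<lambda>x. ell2_nth x n"] by (simp add: w_def)
  have part: "(\<Sum>n<N. z ^ n *\<^sub>C ell2_nth u n) = eval_op z *\<^sub>V u - z ^ N *\<^sub>C ell2_nth w N" for N
    by (induction N) (simp_all add: eval_op_resolvent w_def[symmetric] w scaleC_diff_right scaleC_scaleC mult.commute)
  have "(\<lambda>N. z ^ N *\<^sub>C ell2_nth w N) \<longlonglongrightarrow> 0"
  proof (rule Lim_null_comparison)
    show "\<forall>\<^sub>F N in sequentially. norm (z ^ N *\<^sub>C ell2_nth w N) \<le> cmod z ^ N * norm w"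
      by (simp add: norm_scaleC norm_power mult_left_mono norm_ell2_nth_le)
    show "(\<lambda>N. cmod z ^ N * norm w) \<longlonglongrightarrow> 0"
      using tendsto_mult_right[OF LIMSEQ_realpow_zero[of "cmod z"], of "norm w"] z by simp
  qed
  then have "(\<lambda>N. eval_op z *\<^sub>V u - z ^ N *\<^sub>C ell2_nth w N) \<longlonglongrightarrow> eval_op z *\<^sub>V u - 0"
    by (intro tendsto_intros)
  then show ?thesis by (simp add: sums_def part)
qed

lemma analytic_at_eval_op: "analytic_at (\<lambda>z. eval_op z) z"
  unfolding eval_op_def
  by (intro analytic_at_op_comp analytic_at_const analytic_at_op_inv analytic_at_diff analytic_at_scaleC
      invertible_id_minus_shift_adj z)

end

lemma eval_op_0 [simp]: "eval_op 0 *\<^sub>V x = ell2_nth x 0"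
  using resolvent_right[of 0 x] by (simp add: eval_op_resolvent)

text \<open>The zeroth entry is the value at 0. Once it vanishes, u is the shift of its backward
  shift, so the latter vanishes at every nonzero point of the disc and, by continuity, at 0.
  Induction peels off all entries.\<close>

lemma ell2_eqI_eval:
  assumes "\<And>z. z \<in> \<bbbD> \<Longrightarrow> eval_op z *\<^sub>V u = 0"
  shows "u = 0"
proof -
  have step: "ell2_nth u 0 = 0 \<and> (\<forall>z\<in>\<bbbD>. eval_op z *\<^sub>V shift_op\<^sup>\<dagger> *\<^sub>V u = 0)"
    if u: "\<forall>z\<in>\<bbbD>. eval_op z *\<^sub>V u = 0" for u :: "'a ell2"
  proof
    show u0: "ell2_nth u 0 = 0" using u[rule_format, of 0] by simp
    have nz: "eval_op z *\<^sub>V shift_op\<^sup>\<dagger> *\<^sub>V u = 0" if "z \<in> \<bbbD>" "z \<noteq> 0" for z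
    proof -
      have "z *\<^sub>C (eval_op z *\<^sub>V shift_op\<^sup>\<dagger> *\<^sub>V u) = eval_op z *\<^sub>V u"
        using E_plus_shift[of u] u0 that by (metis add_0 cblinfun_zero eval_op_shift)
      then show ?thesis using that u by (metis norm_eq_zero norm_scaleC mult_eq_0_iff)
    qed
    have "isCont (\<lambda>z. eval_op z :: ('a ell2, 'a) cblinfun) 0"
      by (rule analytic_at_isCont[OF analytic_at_eval_op]) simp
    then have "((\<lambda>z. eval_op z *\<^sub>V shift_op\<^sup>\<dagger> *\<^sub>V u) \<longlongrightarrow> eval_op 0 *\<^sub>V shift_op\<^sup>\<dagger> *\<^sub>V u) (at 0)"
      unfolding isCont_def
      by (rule bounded_bilinear.tendsto[OF bounded_bilinear_cblinfun_apply _ tendsto_const])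
    moreover have "((\<lambda>z. eval_op z *\<^sub>V shift_op\<^sup>\<dagger> *\<^sub>V u) \<longlongrightarrow> 0) (at 0)"
    proof (rule tendsto_eventually)
      show "\<forall>\<^sub>F z in at 0. eval_op z *\<^sub>V shift_op\<^sup>\<dagger> *\<^sub>V u = 0"
        using nz unfolding eventually_at by (intro exI[of _ 1]) (auto simp: dist_commute)
    qed
    ultimately have "eval_op 0 *\<^sub>V shift_op\<^sup>\<dagger> *\<^sub>V u = 0" by (rule LIM_unique)
    then show "\<forall>z\<in>\<bbbD>. eval_op z *\<^sub>V shift_op\<^sup>\<dagger> *\<^sub>V u = 0" using nz by metis
  qed
  have "ell2_nth u n = 0" if "\<forall>z\<in>\<bbbD>. eval_op z *\<^sub>V u = 0" for n and u :: "'a ell2"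
    using that
  proof (induction n arbitrary: u)
    case 0 then show ?case using step by blast
  next
    case (Suc n)
    have "ell2_nth (shift_op\<^sup>\<dagger> *\<^sub>V u) n = 0" using Suc step by blast
    then show ?case by simp
  qed
  then show ?thesis using assms by (intro ell2_eqI) simp
qed

definition commutes_shift :: "('a::complex_hilbert ell2, 'b::complex_hilbert ell2) cblinfun \<Rightarrow> bool"
  where "commutes_shift T \<longleftrightarrow> (\<forall>x. T *\<^sub>V shift_op *\<^sub>V x = shift_op *\<^sub>V T *\<^sub>V x)"

definition op_symbol :: "('a::complex_hilbert ell2, 'b::complex_hilbert ell2) cblinfun \<Rightarrow> complex \<Rightarrow> ('a, 'b) cblinfun"
  where "op_symbol T z = eval_op z o\<^sub>C T o\<^sub>C E_op"

lemma commutes_shift_adj: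
  assumes "commutes_shift T"
  shows "T\<^sup>\<dagger> *\<^sub>V shift_op\<^sup>\<dagger> *\<^sub>V x = shift_op\<^sup>\<dagger> *\<^sub>V T\<^sup>\<dagger> *\<^sub>V x"
  by (rule inner_eqI) (use assms in \<open>simp add: inner_adj'[symmetric] commutes_shift_def\<close>)

text \<open>By \<open>eval_op_decomp\<close>, u differs from the constant u(z) by an element of the
  range of S - z; T preserves that range and evaluation at z annihilates it.\<close>

lemma eval_op_commute:
  assumes T: "commutes_shift T" and z: "z \<in> \<bbbD>"
  shows "eval_op z *\<^sub>V T *\<^sub>V u = op_symbol T z *\<^sub>V eval_op z *\<^sub>V u"
  by (subst eval_op_decomp[OF z, of u])
    (use T z in \<open>simp add: cblinfun_linear op_symbol_def commutes_shift_def\<close>)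

text \<open>The vector is the Szego kernel with entries conj(z)^n x, an eigenvector of the backward
  shift. The norm comes from k = E x + conj(z) S k, whose summands are orthogonal.\<close>

lemma eval_op_adj:
  assumes z: "z \<in> \<bbbD>"
  shows shift_adj_eval_adj: "shift_op\<^sup>\<dagger> *\<^sub>V (eval_op z)\<^sup>\<dagger> *\<^sub>V x = cnj z *\<^sub>C ((eval_op z)\<^sup>\<dagger> *\<^sub>V x)"
    and norm_eval_adj: "(1 - (cmod z)\<^sup>2) * (norm ((eval_op z)\<^sup>\<dagger> *\<^sub>V x))\<^sup>2 = (norm x)\<^sup>2"
proof -
  define k where "k = (eval_op z)\<^sup>\<dagger> *\<^sub>V x"
  have k0: "ell2_nth k 0 = x"
    unfolding E_adj[symmetric] k_def
    by (rule inner_eqI) (simp only: inner_adj'[symmetric] eval_op_E[OF z])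
  have Sk: "shift_op\<^sup>\<dagger> *\<^sub>V k = cnj z *\<^sub>C k"
    unfolding k_def by (rule inner_eqI) (simp add: inner_adj'[symmetric] inner_scaleC_left eval_op_shift[OF z])
  have "k = E_op *\<^sub>V x + cnj z *\<^sub>C (shift_op *\<^sub>V k)"
    using E_plus_shift[of k] by (simp add: k0 Sk)
  then have "inner k k = inner (E_op *\<^sub>V x + shift_op *\<^sub>V (cnj z *\<^sub>C k)) (E_op *\<^sub>V x + shift_op *\<^sub>V (cnj z *\<^sub>C k))"
    by simp
  also have "\<dots> = inner x x + inner (cnj z *\<^sub>C k) (cnj z *\<^sub>C k)"
    by (simp only: inner_add_left inner_add_right inner_shift_op inner_E_op inner_E_shift add_0 add_0_right)
  finally have "(norm k)\<^sup>2 = (norm x)\<^sup>2 + (cmod z)\<^sup>2 * (norm k)\<^sup>2"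
    by (simp only: power2_norm_eq_inner[symmetric] norm_scaleC power_mult_distrib complex_mod_cnj)
  with Sk show
    "shift_op\<^sup>\<dagger> *\<^sub>V (eval_op z)\<^sup>\<dagger> *\<^sub>V x = cnj z *\<^sub>C ((eval_op z)\<^sup>\<dagger> *\<^sub>V x)"
    "(1 - (cmod z)\<^sup>2) * (norm ((eval_op z)\<^sup>\<dagger> *\<^sub>V x))\<^sup>2 = (norm x)\<^sup>2"
    by (simp_all add: k_def algebra_simps)
qed

text \<open>Adjoints of operators commuting with the shift carry Szego kernels at z to Szego kernels
  at z, which turns operator inequalities into inequalities at a point.\<close>

lemma adj_eval_adj:
  assumes T: "commutes_shift T" and z: "z \<in> \<bbbD>"
  shows "T\<^sup>\<dagger> *\<^sub>V (eval_op z)\<^sup>\<dagger> *\<^sub>V y = (eval_op z)\<^sup>\<dagger> *\<^sub>V (op_symbol T z)\<^sup>\<dagger> *\<^sub>V y"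
  by (rule inner_eqI) (simp add: inner_adj'[symmetric] eval_op_commute[OF assms])

section \<open>Taylor coefficients and Toeplitz operators\<close>

instance cblinfun :: (complex_normed_vector, "{complex_normed_vector, complete_space}") banach ..

lemma H_infinity_iff:
  "F \<in> H_infinity \<longleftrightarrow> analytic_on_disc F \<and> (\<exists>M\<ge>0. \<forall>z\<in>\<bbbD>. norm (F z) \<le> M)"
proof -
  have "bounded (F ` \<bbbD>) \<longleftrightarrow> (\<exists>M\<ge>0. \<forall>z\<in>\<bbbD>. norm (F z) \<le> M)"
  proof
    assume "bounded (F ` \<bbbD>)"
    then obtain M where "\<forall>z\<in>\<bbbD>. norm (F z) \<le> M" by (auto simp: bounded_iff)
    then have "\<forall>z\<in>\<bbbD>. norm (F z) \<le> max 0 M" by (auto simp: le_max_iff_disj)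
    then show "\<exists>M\<ge>0. \<forall>z\<in>\<bbbD>. norm (F z) \<le> M" by (intro exI[of _ "max 0 M"]) simp
  qed (auto simp: bounded_iff)
  then show ?thesis by (simp add: H_infinity_def)
qed

lemma Schur_class_iff:
  "F \<in> Schur_class \<longleftrightarrow> analytic_on_disc F \<and> (\<forall>z\<in>\<bbbD>. norm (F z) \<le> 1)"
proof
  assume F: "F \<in> Schur_class"
  then have "bounded (F ` \<bbbD>)" by (simp add: Schur_class_def H_infinity_def)
  then have "bdd_above ((\<lambda>z. norm (F z)) ` \<bbbD>)" by (auto simp: bounded_iff bdd_above_def)
  from cSUP_upper[OF _ this] F show "analytic_on_disc F \<and> (\<forall>z\<in>\<bbbD>. norm (F z) \<le> 1)"
    by (fastforce simp: Schur_class_def H_infinity_def)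
next
  assume F: "analytic_on_disc F \<and> (\<forall>z\<in>\<bbbD>. norm (F z) \<le> 1)"
  then have "F \<in> H_infinity" by (auto simp: H_infinity_iff intro: exI[of _ 1])
  moreover have "(SUP z\<in>\<bbbD>. norm (F z)) \<le> 1" using F by (intro cSUP_least) auto
  ultimately show "F \<in> Schur_class" by (simp add: Schur_class_def)
qed

lemma power_series_zero_unique:
  fixes a :: "nat \<Rightarrow> complex"
  assumes a: "\<And>z. z \<in> \<bbbD> \<Longrightarrow> (\<lambda>n. a n * z ^ n) sums 0"
  shows "a n = 0"
proof (rule ccontr)
  assume n: "a n \<noteq> 0"
  have "(\<lambda>n. a n * 0 ^ n) sums a 0" by (rule powser_sums_zero)
  with a[of 0] have "a 0 = 0" by (simp add: sums_unique2)
  with n have "n > 0" by (cases n) auto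
  show False
  proof (rule powser_0_nonzero[of 1 0 a "\<lambda>_. 0" n])
    show "(\<lambda>n. a n * (z - 0) ^ n) sums 0" if "norm (z - 0) < 1" for z
      using a[of z] that by simp
    fix s :: real assume "0 < s" "\<And>z::complex. z \<in> cball 0 s - {0} \<Longrightarrow> (0::complex) \<noteq> 0"
    from this(2)[of "of_real s"] this(1) show False by simp
  qed (use n \<open>n > 0\<close> in simp_all)
qed

lemma cinner_sums:
  assumes "f sums (T :: ('a::complex_hilbert, 'b::complex_hilbert) cblinfun)"
  shows "(\<lambda>n. cinner (f n *\<^sub>V x) y) sums cinner (T *\<^sub>V x) y"
  by (rule bounded_linear.sums[OF bounded_linear_cinner_apply assms])

lemma operator_power_series_unique:
  fixes c d :: "nat \<Rightarrow> ('a::complex_hilbert, 'b::complex_hilbert) cblinfun"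
  assumes c: "\<And>z. z \<in> \<bbbD> \<Longrightarrow> (\<lambda>n. z ^ n *\<^sub>C c n) sums F z"
    and d: "\<And>z. z \<in> \<bbbD> \<Longrightarrow> (\<lambda>n. z ^ n *\<^sub>C d n) sums F z"
  shows "c = d"
proof (rule ext, rule cblinfun_eqI, rule cinner_eqI)
  fix n x y
  have "cinner (c n *\<^sub>V x) y - cinner (d n *\<^sub>V x) y = 0"
  proof (rule power_series_zero_unique)
    fix z :: complex assume z: "z \<in> \<bbbD>"
    from sums_diff[OF cinner_sums[OF c[OF z], of x y] cinner_sums[OF d[OF z], of x y]]
    show "(\<lambda>n. (cinner (c n *\<^sub>V x) y - cinner (d n *\<^sub>V x) y) * z ^ n) sums 0"
      by (simp add: cinner_scaleC_left algebra_simps)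
  qed
  then show "cinner (c n *\<^sub>V x) y = cinner (d n *\<^sub>V x) y" by simp
qed

text \<open>Complex analysis is applied to the scalar functions <F(z) x, y>. Their coefficients are
  sesquilinear in (x, y) with the bound M, hence come from operators; the operator series converges
  by comparison with a geometric one.\<close>

lemma taylor_expansion:
  fixes F :: "complex \<Rightarrow> ('a::complex_hilbert, 'b::complex_hilbert) cblinfun"
  assumes an: "analytic_on_disc F" and M: "\<And>z. z \<in> \<bbbD> \<Longrightarrow> norm (F z) \<le> M"
  shows "\<exists>c. (\<forall>n. norm (c n) \<le> M) \<and> (\<forall>z\<in>\<bbbD>. (\<lambda>n. z ^ n *\<^sub>C c n) sums F z)"
proof -
  define f where "f x y z = cinner (F z *\<^sub>V x) y" for x y z
  define a where "a n x y = (deriv ^^ n) (f x y) 0 / fact n" for n x y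
  have M0: "0 \<le> M" using order_trans[OF norm_ge_zero M[of 0]] by simp
  have hol: "f x y holomorphic_on \<bbbD>" for x y
    unfolding holomorphic_on_def f_def[abs_def]
    using an analytic_at_cinner[of F] by (auto simp: analytic_on_disc_iff field_differentiable_at_within)
  have f_le: "cmod (f x y z) \<le> M * norm x * norm y" if "z \<in> \<bbbD>" for x y z
  proof -
    have "cmod (f x y z) \<le> norm (F z) * norm x * norm y"
      unfolding f_def
      by (rule order_trans[OF norm_cinner_le mult_right_mono[OF norm_cblinfun_apply_le]]) simp
    also have "\<dots> \<le> M * norm x * norm y" by (intro mult_right_mono M that) simp_all
    finally show ?thesis .
  qed
  have sums: "(\<lambda>n. a n x y * z ^ n) sums f x y z" if "z \<in> \<bbbD>" for x y z
    using holomorphic_power_series[OF hol that, of x y] by (simp add: a_def)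
  have a_le: "cmod (a n x y) \<le> M * norm x * norm y" for n x y
  proof -
    have "cmod (a n x y) * r ^ n \<le> M * norm x * norm y" if r: "0 < r" "r < 1" for r
    proof -
      have "cmod ((deriv ^^ n) (f x y) 0) \<le> fact n * (M * norm x * norm y) / r ^ n"
      proof (rule Cauchy_inequality)
        show "f x y holomorphic_on ball 0 r"
          by (rule holomorphic_on_subset[OF hol]) (use r in auto)
        show "continuous_on (cball 0 r) (f x y)"
          by (rule continuous_on_subset[OF holomorphic_on_imp_continuous_on[OF hol]]) (use r in auto)
        show "cmod (f x y z) \<le> M * norm x * norm y" if "cmod (0 - z) = r" for z
          by (rule f_le) (use that r in simp)
      qed (use r in simp)
      then show ?thesis using r by (simp add: a_def norm_divide field_simps)
    qed
    \<comment> \<open>Cauchy's inequality on circles of radius r loses the factor r^n; the limit r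
      -> 1 restores the sharp constant M.\<close>
    then have "\<forall>\<^sub>F r in at_left 1. cmod (a n x y) * r ^ n \<le> M * norm x * norm y"
      using eventually_at_left_real[of 0 "1::real"] by (auto elim!: eventually_mono)
    moreover have "((\<lambda>r. cmod (a n x y) * r ^ n) \<longlongrightarrow> cmod (a n x y) * 1 ^ n) (at_left 1)"
      by (intro tendsto_intros)
    ultimately show ?thesis
      using tendsto_upperbound[of "\<lambda>r. cmod (a n x y) * r ^ n" "cmod (a n x y)" "at_left 1"]
      by simp
  qed
  have "\<exists>C. (\<forall>x y. cinner (C *\<^sub>V x) y = a n x y) \<and> norm C \<le> M" for n
  proof (rule sesquilinear_form_operator)
    fix x x' :: 'a and y y' :: 'b and k :: complex
    have "f (x + x') y = (\<lambda>z. f x y z + f x' y z)"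
      by (simp add: f_def fun_eq_iff cblinfun_add cinner_add_left)
    then show "a n (x + x') y = a n x y + a n x' y"
      by (simp add: a_def higher_deriv_add[OF hol hol] add_divide_distrib)
    have "f x (y + y') = (\<lambda>z. f x y z + f x y' z)"
      by (simp add: f_def fun_eq_iff cinner_add_right)
    then show "a n x (y + y') = a n x y + a n x y'"
      by (simp add: a_def higher_deriv_add[OF hol hol] add_divide_distrib)
    have "f (k *\<^sub>C x) y = (\<lambda>z. k * f x y z)"
      by (simp add: f_def fun_eq_iff cinner_scaleC_left)
    then show "a n (k *\<^sub>C x) y = k * a n x y"
      by (simp add: a_def higher_deriv_cmult[OF hol])
    have "f x (k *\<^sub>C y) = (\<lambda>z. cnj k * f x y z)"
      by (simp add: f_def fun_eq_iff cinner_scaleC_right)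
    then show "a n x (k *\<^sub>C y) = cnj k * a n x y"
      by (simp add: a_def higher_deriv_cmult[OF hol])
  qed (simp_all add: a_le M0)
  then obtain c where c: "\<And>n x y. cinner (c n *\<^sub>V x) y = a n x y" and c_le: "\<And>n. norm (c n) \<le> M" by metis
  have "(\<lambda>n. z ^ n *\<^sub>C c n) sums F z" if z: "z \<in> \<bbbD>" for z
  proof -
    have "summable (\<lambda>n. z ^ n *\<^sub>C c n)"
    proof (rule summable_comparison_test')
      show "summable (\<lambda>n. cmod z ^ n * M)"
        by (rule summable_mult2[OF summable_geometric]) (use z in simp)
      show "norm (z ^ n *\<^sub>C c n) \<le> cmod z ^ n * M" for n
        by (simp add: norm_scaleC norm_power mult_left_mono c_le)
    qed
    then obtain L where L: "(\<lambda>n. z ^ n *\<^sub>C c n) sums L" by (auto simp: summable_def)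
    have "L = F z"
    proof (rule cblinfun_eqI, rule cinner_eqI)
      fix x y
      have "(\<lambda>n. a n x y * z ^ n) sums cinner (L *\<^sub>V x) y"
        using cinner_sums[OF L, of x y] by (simp add: cinner_scaleC_left c mult.commute)
      then show "cinner (L *\<^sub>V x) y = cinner (F z *\<^sub>V x) y"
        using sums[OF z, of x y] by (simp add: f_def sums_unique2)
    qed
    with L show ?thesis by simp
  qed
  with c_le show ?thesis by blast
qed

lemma taylor_coeff:
  fixes F :: "complex \<Rightarrow> ('a::complex_hilbert, 'b::complex_hilbert) cblinfun"
  assumes an: "analytic_on_disc F" and M: "\<And>z. z \<in> \<bbbD> \<Longrightarrow> norm (F z) \<le> M"
  shows "norm (taylor_coeff F n) \<le> M" "z \<in> \<bbbD> \<Longrightarrow> (\<lambda>n. z ^ n *\<^sub>C taylor_coeff F n) sums F z"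
proof -
  from taylor_expansion[OF assms] obtain c
    where c: "\<And>n. norm (c n) \<le> M" "\<forall>z\<in>\<bbbD>. (\<lambda>n. z ^ n *\<^sub>C c n) sums F z" by blast
  have "taylor_coeff F = c"
    unfolding taylor_coeff_def
  proof (rule the_equality)
    show "d = c" if "\<forall>z\<in>\<bbbD>. (\<lambda>n. z ^ n *\<^sub>C d n) sums F z" for d
      using that c(2) by (intro operator_power_series_unique) blast+
  qed (rule c(2))
  with c show "norm (taylor_coeff F n) \<le> M" "z \<in> \<bbbD> \<Longrightarrow> (\<lambda>n. z ^ n *\<^sub>C taylor_coeff F n) sums F z"
    by auto
qed

subsection \<open>Boundedness of Toeplitz operators\<close>

lemma cinner_zero_left [simp]: "cinner 0 (y::'a::complex_hilbert) = 0"
  using cinner_scaleC_left[of 0 0 y] by simp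

lemma cinner_zero_right [simp]: "cinner y (0::'a::complex_hilbert) = 0"
  using cinner_scaleC_right[of y 0 0] by simp

lemma cinner_sum_left: "cinner (sum f I) y = (\<Sum>i\<in>I. cinner (f i) (y::'a::complex_hilbert))"
  by (induction I rule: infinite_finite_induct) (simp_all add: cinner_add_left)

lemma cinner_sum_right: "cinner y (sum f I) = (\<Sum>i\<in>I. cinner (y::'a::complex_hilbert) (f i))"
  by (induction I rule: infinite_finite_induct) (simp_all add: cinner_add_right)

definition unity_root :: "nat \<Rightarrow> nat \<Rightarrow> complex"
  where "unity_root R j = exp (2 * of_real pi * \<i> * of_nat j / of_nat R)"

lemma norm_unity_root [simp]: "cmod (unity_root R j) = 1"
proof -
  have "unity_root R j = exp (\<i> * of_real (2 * pi * real j / real R))"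
    by (simp add: unity_root_def mult_ac)
  then show ?thesis by (simp only: norm_exp_i_times)
qed

lemma unity_root_power_commute: "unity_root R j ^ n = unity_root R n ^ j"
  by (simp add: unity_root_def exp_of_nat_mult[symmetric] mult_ac)

lemma unity_root_orthogonal:
  assumes "m < R" "n < R"
  shows "(\<Sum>j<R. unity_root R j ^ m * cnj (unity_root R j ^ n)) = (if m = n then of_nat R else 0)"
proof -
  define q where "q = unity_root R m * cnj (unity_root R n)"
  have unit: "unity_root R n * cnj (unity_root R n) = 1"
    by (simp add: complex_norm_square[symmetric])
  have *: "unity_root R j ^ m * cnj (unity_root R j ^ n) = q ^ j" for j
    by (simp only: unity_root_power_commute[of R j] q_def power_mult_distrib complex_cnj_power)
  have qR: "q ^ R = 1"
    using complex_root_unity[of R m] complex_root_unity[of R n] assms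
    by (simp add: q_def unity_root_def power_mult_distrib complex_cnj_power[symmetric] del: complex_cnj_power)
  show ?thesis
  proof (cases "m = n")
    case True
    then show ?thesis unfolding * using unit by (simp add: q_def)
  next
    case False
    have "q \<noteq> 1"
    proof
      assume "q = 1"
      then have "unity_root R m * (unity_root R n * cnj (unity_root R n)) = unity_root R n"
        by (simp add: q_def mult_ac)
      then have "unity_root R m = unity_root R n" by (simp add: unit)
      with False assms show False by (simp add: unity_root_def complex_root_unity_eq)
    qed
    then show ?thesis unfolding * using False qR by (simp add: sum_gp_strict)
  qed
qed

text \<open>All indices lie below R, so summation over the roots of unity of order R kills every
  off-diagonal term of the expanded squares.\<close>

lemma discrete_parseval:
  fixes a :: "nat \<Rightarrow> 'a::complex_hilbert"
  shows "(\<Sum>j<R. (norm (\<Sum>n<R. unity_root R j ^ n *\<^sub>C a n))\<^sup>2) = R * (\<Sum>n<R. (norm (a n))\<^sup>2)"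
proof -
  have "complex_of_real (\<Sum>j<R. (norm (\<Sum>n<R. unity_root R j ^ n *\<^sub>C a n))\<^sup>2)
    = (\<Sum>j<R. \<Sum>n<R. \<Sum>m<R. unity_root R j ^ m * cnj (unity_root R j ^ n) * cinner (a m) (a n))"
    by (simp only: of_real_sum cinner_self[symmetric] cinner_sum_left cinner_sum_right
        cinner_scaleC_left cinner_scaleC_right mult.assoc)
      (simp add: mult_ac sum_distrib_left)
  also have "\<dots> = (\<Sum>n<R. \<Sum>m<R. \<Sum>j<R. unity_root R j ^ m * cnj (unity_root R j ^ n) * cinner (a m) (a n))"
    by (subst sum.swap, rule sum.cong[OF refl], rule sum.swap)
  also have "\<dots> = (\<Sum>n<R. \<Sum>m<R. (if m = n then of_nat R else 0) * cinner (a m) (a n))"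
    by (intro sum.cong refl) (simp only: sum_distrib_right[symmetric] unity_root_orthogonal lessThan_iff)
  also have "\<dots> = (\<Sum>n<R. \<Sum>m<R. if m = n then of_nat R * cinner (a m) (a n) else 0)"
    by (intro sum.cong refl) simp
  also have "\<dots> = (\<Sum>n<R. of_nat R * cinner (a n) (a n))"
    by simp
  also have "\<dots> = complex_of_real (R * (\<Sum>n<R. (norm (a n))\<^sup>2))"
    by (simp add: cinner_self sum_distrib_left)
  finally show ?thesis by (simp only: of_real_eq_iff)
qed

lemma power_series_tail_le:
  fixes a :: "nat \<Rightarrow> 'a::banach"
  assumes a: "a sums s" and le: "\<And>n. norm (a n) \<le> C * r ^ n" and r: "0 \<le> r" "r < 1"
  shows "norm (s - (\<Sum>n<R. a n)) \<le> C * r ^ R / (1 - r)"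
proof -
  have "(\<lambda>n. a (n + R)) sums (s - (\<Sum>n<R. a n))"
    using a by (simp add: sums_iff_shift)
  moreover have g: "(\<lambda>n. C * r ^ R * r ^ n) sums (C * r ^ R * (1 / (1 - r)))"
    by (intro sums_mult geometric_sums) (use r in simp)
  moreover have "norm (a (n + R)) \<le> C * r ^ R * r ^ n" for n
    using le[of "n + R"] by (simp add: power_add mult_ac)
  ultimately show ?thesis
    using norm_suminf_le[of "\<lambda>n. a (n + R)" "\<lambda>n. C * r ^ R * r ^ n"] by (simp add: sums_iff)
qed

text \<open>
  Parseval's identity on the circle of radius \<open>r < 1\<close>, discretised at the roots of unity of order
  \<open>R\<close>; the limits \<open>R \<rightarrow> \<infinity>\<close> and \<open>r \<rightarrow> 1\<close> then give the bound by the supremum norm.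
\<close>

lemma toeplitz_finite_bound:
  fixes F :: "complex \<Rightarrow> ('a::complex_hilbert, 'b::complex_hilbert) cblinfun"
  assumes an: "analytic_on_disc F" and M: "\<And>z. z \<in> \<bbbD> \<Longrightarrow> norm (F z) \<le> M"
  shows "(\<Sum>n<N. (norm (\<Sum>k\<le>n. taylor_coeff F (n - k) *\<^sub>V u k))\<^sup>2) \<le> M\<^sup>2 * (\<Sum>k<N. (norm (u k))\<^sup>2)"
proof -
  define c where "c = taylor_coeff F"
  \<comment> \<open>The convolution with u cut off at N, for all n, so that the series of v is
    exactly F(z) U(z) with the polynomial U. For n < N the cutoff is invisible.\<close>
  define v where "v n = (\<Sum>k<N. if k \<le> n then c (n - k) *\<^sub>V u k else 0)" for n
  define U where "U z = (\<Sum>k<N. z ^ k *\<^sub>C u k)" for z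
  define L where "L = (\<Sum>k<N. norm (u k))"
  have M0: "0 \<le> M" using order_trans[OF norm_ge_zero M[of 0]] by simp
  have L0: "0 \<le> L" by (simp add: L_def sum_nonneg)
  have c_le: "norm (c n) \<le> M" for n unfolding c_def by (rule taylor_coeff[OF an M])
  have v_eq: "(\<Sum>k\<le>n. taylor_coeff F (n - k) *\<^sub>V u k) = v n" if "n < N" for n
  proof -
    have "v n = (\<Sum>k\<in>{..<N} \<inter> {k. k \<le> n}. c (n - k) *\<^sub>V u k)"
      unfolding v_def by (subst sum.inter_restrict) simp_all
    also have "{..<N} \<inter> {k. k \<le> n} = {..n}" using that by auto
    finally show ?thesis by (simp add: c_def)
  qed
  have v_le: "norm (v n) \<le> M * L" for n
  proof -
    have "norm (v n) \<le> (\<Sum>k<N. norm (if k \<le> n then c (n - k) *\<^sub>V u k else 0))"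
      unfolding v_def by (rule norm_sum)
    also have "\<dots> \<le> (\<Sum>k<N. M * norm (u k))"
      by (rule sum_mono)
        (auto intro!: order_trans[OF norm_cblinfun_apply_le] mult_right_mono c_le simp: M0)
    finally show ?thesis by (simp add: L_def sum_distrib_left)
  qed
  have v_sums: "(\<lambda>n. z ^ n *\<^sub>C v n) sums (F z *\<^sub>V U z)" if z: "z \<in> \<bbbD>" for z
  proof -
    have 1: "(\<lambda>n. if k \<le> n then z ^ n *\<^sub>C (c (n - k) *\<^sub>V u k) else 0) sums (F z *\<^sub>V z ^ k *\<^sub>C u k)" for k
    proof -
      have "(\<lambda>n. (z ^ n *\<^sub>C c n) *\<^sub>V (z ^ k *\<^sub>C u k)) sums (F z *\<^sub>V z ^ k *\<^sub>C u k)"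
        unfolding c_def
        by (rule bounded_linear.sums[OF bounded_linear_apply
              taylor_coeff(2)[OF an M z]])
      then have "(\<lambda>n. if k \<le> n + k then z ^ (n + k) *\<^sub>C (c (n + k - k) *\<^sub>V u k) else 0) sums (F z *\<^sub>V z ^ k *\<^sub>C u k)"
        by (simp add: scaleC_scaleC power_add)
      then show ?thesis
        by (subst (asm) sums_zero_iff_shift[where f = "\<lambda>n. if k \<le> n then z ^ n *\<^sub>C (c (n - k) *\<^sub>V u k) else 0"]) auto
    qed
    have "(\<lambda>n. \<Sum>k<N. if k \<le> n then z ^ n *\<^sub>C (c (n - k) *\<^sub>V u k) else 0) sums (\<Sum>k<N. F z *\<^sub>V z ^ k *\<^sub>C u k)"
      by (rule sums_sum[OF 1])
    moreover have "(\<Sum>k<N. F z *\<^sub>V z ^ k *\<^sub>C u k) = F z *\<^sub>V U z"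
      unfolding U_def by (rule linear_sum[OF bounded_linear.linear[OF bounded_linear_cblinfun], symmetric])
    moreover have "(\<Sum>k<N. if k \<le> n then z ^ n *\<^sub>C (c (n - k) *\<^sub>V u k) else 0) = z ^ n *\<^sub>C v n" for n
      unfolding v_def scaleC_sum_right by (rule sum.cong) auto
    ultimately show ?thesis by simp
  qed
  have U_le: "norm (U z) \<le> L" if "z \<in> \<bbbD>" for z
  proof -
    have "norm (U z) \<le> (\<Sum>k<N. norm (z ^ k *\<^sub>C u k))" unfolding U_def by (rule norm_sum)
    also have "\<dots> \<le> (\<Sum>k<N. norm (u k))"
      using that by (intro sum_mono) (simp add: norm_scaleC norm_power mult_left_le_one_le power_le_one)
    finally show ?thesis by (simp add: L_def)
  qed
  have main: "(\<Sum>n<N. r\<^sup>2 ^ n * (norm (v n))\<^sup>2) \<le> M\<^sup>2 * (\<Sum>k<N. (norm (u k))\<^sup>2)" if r: "0 < r" "r < 1" for r :: real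
  proof -
    \<comment> \<open>Bounds the tail of the series of v after R terms on the circle of radius r, by
      a geometric series with coefficients at most M L.\<close>
    define \<epsilon> where "\<epsilon> R = M * L * r ^ R / (1 - r)" for R
    have \<epsilon>0: "0 \<le> \<epsilon> R" for R using M0 L0 r by (simp add: \<epsilon>_def)
    have bound: "(\<Sum>n<N. r\<^sup>2 ^ n * (norm (v n))\<^sup>2) \<le> M\<^sup>2 * (\<Sum>k<N. (norm (u k))\<^sup>2) + 2 * M * L * \<epsilon> R + (\<epsilon> R)\<^sup>2"
      if R: "R \<ge> N" "R > 0" for R
    proof -
      define z where "z j = r *\<^sub>R unity_root R j" for j
      have z: "z j \<in> \<bbbD>" "cmod (z j) = r" for j using r by (simp_all add: z_def)
      have zn: "z j ^ n *\<^sub>C w = unity_root R j ^ n *\<^sub>C (r ^ n *\<^sub>R w)" for j n and w :: "'c::complex_hilbert"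
        by (simp add: z_def scaleC_of_real[symmetric] scaleC_scaleC scaleR_conv_of_real power_mult_distrib mult.commute)
      have p: "(norm (\<Sum>n<R. z j ^ n *\<^sub>C v n))\<^sup>2 \<le> M\<^sup>2 * (norm (U (z j)))\<^sup>2 + 2 * M * L * \<epsilon> R + (\<epsilon> R)\<^sup>2" for j
      proof -
        have "norm (F (z j) *\<^sub>V U (z j) - (\<Sum>n<R. z j ^ n *\<^sub>C v n)) \<le> \<epsilon> R"
          unfolding \<epsilon>_def
        proof (rule power_series_tail_le[OF v_sums[OF z(1)]])
          show "norm (z j ^ n *\<^sub>C v n) \<le> M * L * r ^ n" for n
            using mult_left_mono[OF v_le[of n], of "r ^ n"] r by (simp add: norm_scaleC norm_power z mult_ac)
        qed (use r in simp_all)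
        moreover have "norm (F (z j) *\<^sub>V U (z j)) \<le> M * norm (U (z j))"
          by (intro order_trans[OF norm_cblinfun_apply_le] mult_right_mono M z) simp
        ultimately have "norm (\<Sum>n<R. z j ^ n *\<^sub>C v n) \<le> M * norm (U (z j)) + \<epsilon> R"
          using norm_triangle_sub[of "\<Sum>n<R. z j ^ n *\<^sub>C v n" "F (z j) *\<^sub>V U (z j)"]
          by (simp add: norm_minus_commute)
        then have "(norm (\<Sum>n<R. z j ^ n *\<^sub>C v n))\<^sup>2 \<le> (M * norm (U (z j)) + \<epsilon> R)\<^sup>2"
          by (rule power_mono) simp
        also have "\<dots> = M\<^sup>2 * (norm (U (z j)))\<^sup>2 + 2 * (M * norm (U (z j))) * \<epsilon> R + (\<epsilon> R)\<^sup>2"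
          by (simp add: power2_sum power_mult_distrib)
        also have "\<dots> \<le> M\<^sup>2 * (norm (U (z j)))\<^sup>2 + 2 * (M * L) * \<epsilon> R + (\<epsilon> R)\<^sup>2"
          by (intro add_mono order_refl mult_right_mono mult_left_mono U_le z \<epsilon>0 M0) simp
        finally show ?thesis by (simp add: mult_ac)
      qed
      have norms: "(norm (r ^ n *\<^sub>R w))\<^sup>2 = r\<^sup>2 ^ n * (norm w)\<^sup>2" for n and w :: "'c::complex_hilbert"
        using r by (simp add: power_mult_distrib power_mult[symmetric] mult.commute)
      have parsU: "(\<Sum>j<R. (norm (U (z j)))\<^sup>2) = R * (\<Sum>k<N. r\<^sup>2 ^ k * (norm (u k))\<^sup>2)"
      proof -
        \<comment> \<open>Padding with zeros gives U the R coefficients that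
          \<open>discrete_parseval\<close> expects.\<close>
        define u' where "u' k = (if k < N then u k else 0)" for k
        have sub: "sum g {..<N} = sum g {..<R}" if "\<And>k. k \<ge> N \<Longrightarrow> g k = 0" for g :: "nat \<Rightarrow> 'c::comm_monoid_add"
          using R that by (intro sum.mono_neutral_left) auto
        have "U (z j) = (\<Sum>k<N. z j ^ k *\<^sub>C u' k)" for j
          unfolding U_def by (rule sum.cong) (simp_all add: u'_def)
        also have "(\<Sum>k<N. z j ^ k *\<^sub>C u' k) = (\<Sum>k<R. z j ^ k *\<^sub>C u' k)" for j
          by (rule sub) (simp add: u'_def)
        finally have "(\<Sum>j<R. (norm (U (z j)))\<^sup>2) = R * (\<Sum>k<R. r\<^sup>2 ^ k * (norm (u' k))\<^sup>2)"
          by (simp only: zn discrete_parseval norms)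
        also have "(\<Sum>k<R. r\<^sup>2 ^ k * (norm (u' k))\<^sup>2) = (\<Sum>k<N. r\<^sup>2 ^ k * (norm (u' k))\<^sup>2)"
          by (rule sub[symmetric]) (simp add: u'_def)
        also have "\<dots> = (\<Sum>k<N. r\<^sup>2 ^ k * (norm (u k))\<^sup>2)"
          by (rule sum.cong) (simp_all add: u'_def)
        finally show ?thesis .
      qed
      have "R * (\<Sum>n<N. r\<^sup>2 ^ n * (norm (v n))\<^sup>2) \<le> R * (\<Sum>n<R. r\<^sup>2 ^ n * (norm (v n))\<^sup>2)"
        using R by (intro mult_left_mono sum_mono2) auto
      also have "\<dots> = (\<Sum>j<R. (norm (\<Sum>n<R. z j ^ n *\<^sub>C v n))\<^sup>2)"
        by (simp only: zn discrete_parseval norms)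
      also have "\<dots> \<le> (\<Sum>j<R. M\<^sup>2 * (norm (U (z j)))\<^sup>2 + 2 * M * L * \<epsilon> R + (\<epsilon> R)\<^sup>2)"
        by (rule sum_mono[OF p])
      also have "\<dots> = M\<^sup>2 * (R * (\<Sum>k<N. r\<^sup>2 ^ k * (norm (u k))\<^sup>2)) + R * (2 * M * L * \<epsilon> R + (\<epsilon> R)\<^sup>2)"
        by (simp add: sum.distrib sum_distrib_left[symmetric] parsU algebra_simps)
      also have "\<dots> \<le> M\<^sup>2 * (R * (\<Sum>k<N. (norm (u k))\<^sup>2)) + R * (2 * M * L * \<epsilon> R + (\<epsilon> R)\<^sup>2)"
        using r by (intro add_right_mono mult_left_mono sum_mono mult_left_le_one_le)
          (simp_all add: power_le_one)
      also have "\<dots> = R * (M\<^sup>2 * (\<Sum>k<N. (norm (u k))\<^sup>2) + 2 * M * L * \<epsilon> R + (\<epsilon> R)\<^sup>2)"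
        by (simp add: algebra_simps)
      finally show ?thesis using R by (simp add: mult_le_cancel_left_pos)
    qed
    have "\<epsilon> \<longlonglongrightarrow> M * L * 0 / (1 - r)"
      unfolding \<epsilon>_def[abs_def] by (intro tendsto_intros LIMSEQ_realpow_zero) (use r in simp_all)
    then have "(\<lambda>R. M\<^sup>2 * (\<Sum>k<N. (norm (u k))\<^sup>2) + 2 * M * L * \<epsilon> R + (\<epsilon> R)\<^sup>2)
      \<longlonglongrightarrow> M\<^sup>2 * (\<Sum>k<N. (norm (u k))\<^sup>2) + 2 * M * L * (M * L * 0 / (1 - r)) + (M * L * 0 / (1 - r))\<^sup>2"
      by (intro tendsto_intros)
    \<comment> \<open>Starting at \<open>Suc N\<close> also excludes R = 0, where the factor R could
      not be cancelled.\<close>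
    moreover have "\<exists>R0. \<forall>R\<ge>R0. (\<Sum>n<N. r\<^sup>2 ^ n * (norm (v n))\<^sup>2)
      \<le> M\<^sup>2 * (\<Sum>k<N. (norm (u k))\<^sup>2) + 2 * M * L * \<epsilon> R + (\<epsilon> R)\<^sup>2"
      using bound by (intro exI[of _ "Suc N"]) auto
    ultimately show ?thesis
      by (auto dest: LIMSEQ_le_const)
  qed
  have "((\<lambda>r. \<Sum>n<N. r\<^sup>2 ^ n * (norm (v n))\<^sup>2) \<longlongrightarrow> (\<Sum>n<N. 1\<^sup>2 ^ n * (norm (v n))\<^sup>2)) (at_left (1::real))"
    by (intro tendsto_intros)
  moreover have "\<forall>\<^sub>F r in at_left 1. (\<Sum>n<N. r\<^sup>2 ^ n * (norm (v n))\<^sup>2) \<le> M\<^sup>2 * (\<Sum>k<N. (norm (u k))\<^sup>2)"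
    using eventually_at_left_real[of 0 "1::real"] main by (auto elim!: eventually_mono)
  ultimately have "(\<Sum>n<N. 1\<^sup>2 ^ n * (norm (v n))\<^sup>2) \<le> M\<^sup>2 * (\<Sum>k<N. (norm (u k))\<^sup>2)"
    by (rule tendsto_upperbound) simp
  then show ?thesis by (simp add: v_eq)
qed

text \<open>The uniform bound on finite sections makes the convolution a bounded operator, so the
  definite description in \<open>toeplitz\<close> denotes; entries determine an operator, which
  gives uniqueness.\<close>

lemma toeplitz_properties:
  fixes F :: "complex \<Rightarrow> ('a::complex_hilbert, 'b::complex_hilbert) cblinfun"
  assumes an: "analytic_on_disc F" and M: "\<And>z. z \<in> \<bbbD> \<Longrightarrow> norm (F z) \<le> M"
  shows toeplitz_nth: "ell2_nth (toeplitz F *\<^sub>V u) n = (\<Sum>k\<le>n. taylor_coeff F (n - k) *\<^sub>V ell2_nth u k)"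
    and norm_toeplitz_apply_le: "norm (toeplitz F *\<^sub>V u) \<le> M * norm u"
proof -
  define w where "w u n = (\<Sum>k\<le>n. taylor_coeff F (n - k) *\<^sub>V ell2_nth u k)" for u n
  have M0: "0 \<le> M" using order_trans[OF norm_ge_zero M[of 0]] by simp
  have part: "(\<Sum>n<N. (norm (w u n))\<^sup>2) \<le> M\<^sup>2 * (norm u)\<^sup>2" for u N
  proof -
    have "(\<Sum>n<N. (norm (w u n))\<^sup>2) \<le> M\<^sup>2 * (\<Sum>k<N. (norm (ell2_nth u k))\<^sup>2)"
      unfolding w_def by (rule toeplitz_finite_bound[OF an M])
    also have "\<dots> \<le> M\<^sup>2 * (norm u)\<^sup>2" by (intro mult_left_mono sum_le_norm_ell2) simp
    finally show ?thesis .
  qed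
  have summ: "summable (\<lambda>n. (norm (w u n))\<^sup>2)" for u
    by (rule summableI_nonneg_bounded[OF _ part]) simp
  define T where "T u = Abs_ell2 (w u)" for u
  have nth: "ell2_nth (T u) n = w u n" for u n
    using summ by (simp add: T_def Abs_ell2_inverse)
  have T_le: "norm (T u) \<le> M * norm u" for u
  proof (rule power2_le_imp_le)
    show "(norm (T u))\<^sup>2 \<le> (M * norm u)\<^sup>2"
      unfolding norm_ell2_power2[of "T u"] nth power_mult_distrib by (rule suminf_le_const[OF summ part])
  qed (simp add: M0)
  have T_C: "T (a *\<^sub>C u) = a *\<^sub>C T u" for a u
    by (rule ell2_eqI) (simp add: nth w_def scaleC_sum_right)
  have T_bl: "bounded_linear T"
  proof (rule bounded_linear_intro[where K = M])
    show "T (x + y) = T x + T y" for x y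
      by (rule ell2_eqI) (simp add: nth w_def cblinfun_add sum.distrib)
    show "T (r *\<^sub>R x) = r *\<^sub>R T x" for r x by (simp add: scaleC_of_real[symmetric] T_C)
    show "norm (T x) \<le> norm x * M" for x using T_le[of x] by (simp add: mult.commute)
  qed
  have "toeplitz F = Cblinfun T"
    unfolding toeplitz_def
  proof (rule the_equality)
    show "\<forall>u n. ell2_nth (Cblinfun T *\<^sub>V u) n = (\<Sum>k\<le>n. taylor_coeff F (n - k) *\<^sub>V ell2_nth u k)"
      by (simp add: Cblinfun_apply[OF T_bl T_C] nth w_def)
    fix T' assume T': "\<forall>u n. ell2_nth (T' *\<^sub>V u) n = (\<Sum>k\<le>n. taylor_coeff F (n - k) *\<^sub>V ell2_nth u k)"
    show "T' = Cblinfun T"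
      by (rule cblinfun_eqI, rule ell2_eqI) (simp add: T' Cblinfun_apply[OF T_bl T_C] nth w_def)
  qed
  then have "toeplitz F *\<^sub>V u = T u" by (simp add: Cblinfun_apply[OF T_bl T_C])
  then show "ell2_nth (toeplitz F *\<^sub>V u) n = (\<Sum>k\<le>n. taylor_coeff F (n - k) *\<^sub>V ell2_nth u k)"
    "norm (toeplitz F *\<^sub>V u) \<le> M * norm u"
    using T_le by (simp_all add: nth w_def)
qed

lemma commutes_shift_toeplitz:
  assumes "F \<in> H_infinity"
  shows "commutes_shift (toeplitz F)"
proof -
  from assms obtain M where an: "analytic_on_disc F" and M: "\<And>z. z \<in> \<bbbD> \<Longrightarrow> norm (F z) \<le> M"
    unfolding H_infinity_iff by blast
  have T: "ell2_nth (toeplitz F *\<^sub>V u) n = (\<Sum>k\<le>n. taylor_coeff F (n - k) *\<^sub>V ell2_nth u k)" for u n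
    by (rule toeplitz_nth[OF an M])
  have "ell2_nth (toeplitz F *\<^sub>V shift_op *\<^sub>V x) n = ell2_nth (shift_op *\<^sub>V toeplitz F *\<^sub>V x) n" for x n
  proof (cases n)
    case (Suc m)
    show ?thesis
      unfolding nth_shift_op[of "toeplitz F *\<^sub>V x"] T Suc
      by (subst sum.atMost_Suc_shift) (simp add: T)
  qed (simp add: T)
  then show ?thesis by (auto simp: commutes_shift_def intro: ell2_eqI)
qed

lemma op_symbol_toeplitz:
  assumes "F \<in> H_infinity" and z: "z \<in> \<bbbD>"
  shows "op_symbol (toeplitz F) z = F z"
proof (rule cblinfun_eqI)
  fix x
  from assms obtain M where an: "analytic_on_disc F" and M: "\<And>z. z \<in> \<bbbD> \<Longrightarrow> norm (F z) \<le> M"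
    unfolding H_infinity_iff by blast
  have T: "ell2_nth (toeplitz F *\<^sub>V u) n = (\<Sum>k\<le>n. taylor_coeff F (n - k) *\<^sub>V ell2_nth u k)" for u n
    by (rule toeplitz_nth[OF an M])
  have nth: "ell2_nth (toeplitz F *\<^sub>V E_op *\<^sub>V x) n = taylor_coeff F n *\<^sub>V x" for n
  proof -
    have "ell2_nth (toeplitz F *\<^sub>V E_op *\<^sub>V x) n = (\<Sum>k\<in>{0}. taylor_coeff F (n - k) *\<^sub>V ell2_nth (E_op *\<^sub>V x) k)"
      unfolding T
      by (rule sum.mono_neutral_right) (auto split: nat.split)
    then show ?thesis by simp
  qed
  have "(\<lambda>n. z ^ n *\<^sub>C (taylor_coeff F n *\<^sub>V x)) sums (eval_op z *\<^sub>V toeplitz F *\<^sub>V E_op *\<^sub>V x)"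
    using eval_op_sums[OF z, of "toeplitz F *\<^sub>V E_op *\<^sub>V x"] by (simp add: nth)
  moreover have "(\<lambda>n. (z ^ n *\<^sub>C taylor_coeff F n) *\<^sub>V x) sums (F z *\<^sub>V x)"
    by (rule bounded_linear.sums[OF bounded_linear_apply
          taylor_coeff(2)[OF an M z]])
  ultimately show "op_symbol (toeplitz F) z *\<^sub>V x = F z *\<^sub>V x"
    by (simp add: op_symbol_def sums_unique2)
qed

section \<open>The indefinite form on the kernel of \<open>(T\<^sub>G, - T\<^sub>K)\<close>\<close>

lemma inner_preserving:
  assumes "\<And>u. norm (T *\<^sub>V u) = norm u"
  shows "inner (T *\<^sub>V x) (T *\<^sub>V y) = inner x y"
  unfolding dot_norm cblinfun_add[symmetric] assms ..

lemma resolvent_adj_commute: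
  assumes T: "commutes_shift T" and z: "z \<in> \<bbbD>"
  shows "resolvent z *\<^sub>V T\<^sup>\<dagger> *\<^sub>V x = T\<^sup>\<dagger> *\<^sub>V resolvent z *\<^sub>V x"
proof (rule resolvent_eqI[OF z])
  have "T\<^sup>\<dagger> *\<^sub>V (resolvent z *\<^sub>V x - z *\<^sub>C (shift_op\<^sup>\<dagger> *\<^sub>V resolvent z *\<^sub>V x)) = T\<^sup>\<dagger> *\<^sub>V x"
    by (simp add: resolvent_right[OF z])
  then show "T\<^sup>\<dagger> *\<^sub>V resolvent z *\<^sub>V x - z *\<^sub>C (shift_op\<^sup>\<dagger> *\<^sub>V T\<^sup>\<dagger> *\<^sub>V resolvent z *\<^sub>V x) = T\<^sup>\<dagger> *\<^sub>V x"
    by (simp add: cblinfun_diff commutes_shift_adj[OF T])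
qed

lemma power2_norm_add: "(norm (x + y))\<^sup>2 = (norm x)\<^sup>2 + 2 * inner x y + (norm (y::'a::real_inner))\<^sup>2"
  by (simp add: power2_norm_eq_inner inner_add_left inner_add_right inner_commute)

lemma norm_E_op [simp]: "norm (E_op *\<^sub>V v) = norm v"
  by (simp add: norm_eq_sqrt_inner)

lemma inner_comp_adj: "inner (T *\<^sub>V T\<^sup>\<dagger> *\<^sub>V x) y = inner (T\<^sup>\<dagger> *\<^sub>V x) (T\<^sup>\<dagger> *\<^sub>V y)"
  by (rule inner_adj)

lemma power2_norm_E_plus_shift:
  "(norm (E_op *\<^sub>V v + shift_op *\<^sub>V x))\<^sup>2 = (norm v)\<^sup>2 + (norm x)\<^sup>2"
  by (simp add: power2_norm_add)

locale leech =
  fixes G :: "complex \<Rightarrow> ('y::complex_hilbert, 'v::complex_hilbert) cblinfun"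
    and K :: "complex \<Rightarrow> ('u::complex_hilbert, 'v) cblinfun"
    and \<Theta> :: "complex \<Rightarrow> ('e::complex_hilbert, 'y) cblinfun"
  assumes G: "G \<in> H_infinity"
    and K: "K \<in> H_infinity"
    and gap: "strictly_positive (toeplitz G o\<^sub>C (toeplitz G)\<^sup>\<dagger> - toeplitz K o\<^sub>C (toeplitz K)\<^sup>\<dagger>)"
    and inner_\<Theta>: "inner_function \<Theta>"
    and range_\<Theta>: "range (cblinfun_apply (toeplitz \<Theta>)) = {x. toeplitz G *\<^sub>V x = 0}"
begin

abbreviation S :: "('a::complex_hilbert ell2, 'a ell2) cblinfun" where "S \<equiv> shift_op"
abbreviation E :: "('a::complex_hilbert, 'a ell2) cblinfun" where "E \<equiv> E_op"
abbreviation A where "A \<equiv> toeplitz G"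
abbreviation B where "B \<equiv> toeplitz K"
abbreviation T where "T \<equiv> toeplitz \<Theta>"
abbreviation P where "P \<equiv> leech_gap G K"
abbreviation P_inv where "P_inv \<equiv> op_inv (leech_gap G K)"
abbreviation AA_inv where "AA_inv \<equiv> op_inv (A o\<^sub>C A\<^sup>\<dagger>)"
abbreviation N where "N \<equiv> leech_N G \<Theta>"
abbreviation Q_arg where "Q_arg \<equiv> leech_Q_arg G K \<Theta>"
abbreviation R_arg where "R_arg \<equiv> leech_R_arg G K"
abbreviation Q where "Q \<equiv> leech_Q G K \<Theta>"
abbreviation R where "R \<equiv> leech_R G K"
abbreviation sQ where "sQ \<equiv> op_sqrt Q_arg"
abbreviation sR where "sR \<equiv> op_sqrt R_arg"

section \<open>The gap operator and the kernel of \<open>A\<close>\<close>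

lemma A_comm: "commutes_shift A" by (rule commutes_shift_toeplitz[OF G])
lemma B_comm: "commutes_shift B" by (rule commutes_shift_toeplitz[OF K])

lemma \<Theta>_H_infinity: "\<Theta> \<in> H_infinity"
  using inner_\<Theta> by (simp add: inner_function_def Schur_class_def)

lemma T_comm: "commutes_shift T" by (rule commutes_shift_toeplitz[OF \<Theta>_H_infinity])

lemma A_S: "A *\<^sub>V S *\<^sub>V x = S *\<^sub>V A *\<^sub>V x" using A_comm by (simp add: commutes_shift_def)
lemma B_S: "B *\<^sub>V S *\<^sub>V x = S *\<^sub>V B *\<^sub>V x" using B_comm by (simp add: commutes_shift_def)

lemmas S_adj = commutes_shift_adj[OF A_comm, symmetric] commutes_shift_adj[OF B_comm, symmetric]
  commutes_shift_adj[OF T_comm, symmetric]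

lemma eval_A: "z \<in> \<bbbD> \<Longrightarrow> eval_op z *\<^sub>V A *\<^sub>V x = G z *\<^sub>V eval_op z *\<^sub>V x"
  using eval_op_commute[OF A_comm] op_symbol_toeplitz[OF G] by simp
lemma eval_B: "z \<in> \<bbbD> \<Longrightarrow> eval_op z *\<^sub>V B *\<^sub>V x = K z *\<^sub>V eval_op z *\<^sub>V x"
  using eval_op_commute[OF B_comm] op_symbol_toeplitz[OF K] by simp
lemma nth_A: "ell2_nth (A *\<^sub>V x) 0 = G 0 *\<^sub>V ell2_nth x 0" using eval_A[of 0 x] by simp
lemma nth_B: "ell2_nth (B *\<^sub>V x) 0 = K 0 *\<^sub>V ell2_nth x 0" using eval_B[of 0 x] by simp
lemma nth_T: "ell2_nth (T *\<^sub>V x) 0 = \<Theta> 0 *\<^sub>V ell2_nth x 0"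
  using eval_op_commute[OF T_comm, of 0] op_symbol_toeplitz[OF \<Theta>_H_infinity, of 0] by simp

lemma P_apply: "P *\<^sub>V x = A *\<^sub>V A\<^sup>\<dagger> *\<^sub>V x - B *\<^sub>V B\<^sup>\<dagger> *\<^sub>V x"
  by (simp add: leech_gap_def)

lemma P_adj: "P\<^sup>\<dagger> = P"
  by (simp add: leech_gap_def adj_diff adj_comp)

lemma P_strictly_positive: "strictly_positive P"
  using gap by (simp add: leech_gap_def)

lemma P_nonneg: "0 \<le> inner (P *\<^sub>V x) x"
  using P_strictly_positive by (simp add: strictly_positive_def nonneg_op_def inner_eq_Re_cinner)

lemma P_invertible: "invertible_op P"
  using P_strictly_positive by (simp add: strictly_positive_def)

lemmas P_P_inv = op_inv_apply[OF P_invertible]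

lemma P_inv_adj: "P_inv\<^sup>\<dagger> = P_inv"
  by (rule adj_op_inv[OF P_invertible P_adj])

lemma P_inner: "inner (P *\<^sub>V x) x = (norm (A\<^sup>\<dagger> *\<^sub>V x))\<^sup>2 - (norm (B\<^sup>\<dagger> *\<^sub>V x))\<^sup>2"
  by (simp add: P_apply inner_diff_left inner_comp_adj power2_norm_eq_inner)

lemma AA_invertible: "invertible_op (A o\<^sub>C A\<^sup>\<dagger>)"
proof -
  obtain \<delta> where \<delta>: "0 < \<delta>" "\<And>x. \<delta> * (norm x)\<^sup>2 \<le> inner (P *\<^sub>V x) x"
    using strictly_positive_coercive[OF P_strictly_positive P_adj] by blast
  show ?thesis
  proof (rule coercive_invertible[OF _ \<delta>(1)])
    fix x
    show "\<delta> * (norm x)\<^sup>2 \<le> inner ((A o\<^sub>C A\<^sup>\<dagger>) *\<^sub>V x) x"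
      using \<delta>(2)[of x] zero_le_power2[of "norm (B\<^sup>\<dagger> *\<^sub>V x)"]
      unfolding P_inner op_comp.rep_eq inner_comp_adj power2_norm_eq_inner[symmetric] by linarith
  qed
qed

lemma AA_AA_inv: "A *\<^sub>V A\<^sup>\<dagger> *\<^sub>V AA_inv *\<^sub>V x = x"
  using op_inv_apply(1)[OF AA_invertible, of x] by simp

lemma AA_inv_adj: "AA_inv\<^sup>\<dagger> = AA_inv"
  by (rule adj_op_inv[OF AA_invertible]) (simp add: adj_comp)

text \<open>Inversion reverses the order between P and the larger
  \<open>A A\<^sup>\<dagger>\<close>: expand nonnegativity of P at the difference of the two
  preimages of x. This makes \<open>Q_arg\<close> bounded below by the identity.\<close>

lemma AA_inv_le: "inner (AA_inv *\<^sub>V x) x \<le> inner (P_inv *\<^sub>V x) x"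
proof -
  define a where "a = AA_inv *\<^sub>V x"
  define p where "p = P_inv *\<^sub>V x"
  have "inner (P *\<^sub>V p) a = inner x a" "inner (P *\<^sub>V p) p = inner p x" "inner (P *\<^sub>V a) p = inner a x"
    by (simp_all add: p_def P_P_inv inner_commute inner_adj'[of a P] P_adj)
       (simp add: inner_adj P_adj P_P_inv inner_commute)
  then have "inner (P *\<^sub>V (p - a)) (p - a) = inner p x - 2 * inner a x + inner (P *\<^sub>V a) a"
    by (simp add: cblinfun_diff inner_diff_left inner_diff_right inner_commute)
  moreover have "inner (P *\<^sub>V a) a \<le> inner (A *\<^sub>V A\<^sup>\<dagger> *\<^sub>V a) a"
    by (simp add: P_apply inner_diff_left inner_comp_adj)
  moreover have "inner (A *\<^sub>V A\<^sup>\<dagger> *\<^sub>V a) a = inner a x"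
    by (simp add: a_def AA_AA_inv inner_commute)
  ultimately show ?thesis using P_nonneg[of "p - a"] by (simp add: a_def p_def)
qed

lemma orthogonal:
  assumes "A *\<^sub>V x = B *\<^sub>V y"
  shows "inner x (A\<^sup>\<dagger> *\<^sub>V n) = inner y (B\<^sup>\<dagger> *\<^sub>V n)"
  using arg_cong[OF assms, of "\<lambda>w. inner w n"] by (simp add: inner_adj)

lemma orthogonal_trivial: "A *\<^sub>V A\<^sup>\<dagger> *\<^sub>V n = B *\<^sub>V B\<^sup>\<dagger> *\<^sub>V n \<Longrightarrow> n = 0"
  using P_P_inv(2)[of n] by (simp add: P_apply)

lemma inner_T: "inner (T *\<^sub>V x) (T *\<^sub>V y) = inner x y"
  using inner_\<Theta> by (intro inner_preserving) (simp add: inner_function_def)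

lemma T_adj_T: "T\<^sup>\<dagger> *\<^sub>V T *\<^sub>V x = x"
  by (rule inner_eqI) (simp add: inner_adj'[symmetric] inner_T)

lemma A_T: "A *\<^sub>V T *\<^sub>V x = 0" using range_\<Theta> by blast

text \<open>\<open>T\<close> is an isometry onto the kernel of \<open>A\<close>, so
  \<open>T T\<^sup>\<dagger>\<close> is the orthogonal projection onto that kernel.\<close>

lemma ker_A: "A *\<^sub>V x = 0 \<Longrightarrow> x = T *\<^sub>V T\<^sup>\<dagger> *\<^sub>V x"
  using range_\<Theta> T_adj_T by (metis (mono_tags, lifting) imageE mem_Collect_eq)

lemma T_E_split: "T *\<^sub>V E *\<^sub>V e = E *\<^sub>V \<Theta> 0 *\<^sub>V e + S *\<^sub>V S\<^sup>\<dagger> *\<^sub>V T *\<^sub>V E *\<^sub>V e"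
  using E_plus_shift[of "T *\<^sub>V E *\<^sub>V e"] by (simp add: nth_T)

lemma N_apply: "N *\<^sub>V e = - (A *\<^sub>V S\<^sup>\<dagger> *\<^sub>V T *\<^sub>V E *\<^sub>V e)"
  by (simp add: leech_N_def)

lemma A_E_\<Theta>: "A *\<^sub>V E *\<^sub>V \<Theta> 0 *\<^sub>V e = S *\<^sub>V N *\<^sub>V e"
proof -
  have "0 = A *\<^sub>V E *\<^sub>V \<Theta> 0 *\<^sub>V e + S *\<^sub>V A *\<^sub>V S\<^sup>\<dagger> *\<^sub>V T *\<^sub>V E *\<^sub>V e"
    using arg_cong[OF T_E_split[of e], of "\<lambda>x. A *\<^sub>V x"] by (simp add: A_T cblinfun_add A_S)
  then show ?thesis by (simp add: N_apply cblinfun_minus eq_neg_iff_add_eq_0)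
qed

lemma N_eq: "N = S\<^sup>\<dagger> o\<^sub>C A o\<^sub>C E o\<^sub>C \<Theta> 0"
  by (rule cblinfun_eqI) (simp add: A_E_\<Theta>)

text \<open>Since \<open>T\<^sup>\<dagger> S\<^sup>\<dagger> T E = S\<^sup>\<dagger> E = 0\<close>,
  the tail of T E e is orthogonal to the kernel of A. It therefore equals its projection onto the
  range of \<open>A\<^sup>\<dagger>\<close>, which \<open>AA_inv\<close> expresses through N
  e.\<close>

lemma T_E: "T *\<^sub>V E *\<^sub>V e = E *\<^sub>V \<Theta> 0 *\<^sub>V e - S *\<^sub>V A\<^sup>\<dagger> *\<^sub>V AA_inv *\<^sub>V N *\<^sub>V e"
proof -
  define x where "x = S\<^sup>\<dagger> *\<^sub>V T *\<^sub>V E *\<^sub>V e"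
  define h where "h = x - A\<^sup>\<dagger> *\<^sub>V AA_inv *\<^sub>V A *\<^sub>V x"
  have "T\<^sup>\<dagger> *\<^sub>V A\<^sup>\<dagger> *\<^sub>V w = 0" for w
    by (rule inner_eqI) (simp add: inner_adj'[symmetric] A_T)
  moreover have "T\<^sup>\<dagger> *\<^sub>V x = 0"
    by (simp add: x_def S_adj[symmetric] T_adj_T commutes_shift_adj[OF T_comm])
  ultimately have "T\<^sup>\<dagger> *\<^sub>V h = 0" by (simp add: h_def cblinfun_diff)
  moreover have "A *\<^sub>V h = 0" by (simp add: h_def cblinfun_diff AA_AA_inv)
  ultimately have "h = 0" using ker_A[of h] by simp
  then have "x = - (A\<^sup>\<dagger> *\<^sub>V AA_inv *\<^sub>V N *\<^sub>V e)"
    by (simp add: h_def N_apply cblinfun_minus x_def[symmetric])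
  then show ?thesis using T_E_split[of e] by (simp add: x_def[symmetric] cblinfun_minus)
qed

text \<open>The projection of \<open>Ey\<close> onto the kernel of \<open>A\<close>, written in the coordinates of \<open>\<Theta>\<close>, solves \<open>\<Theta>(0) e = y\<close>.\<close>

definition L :: "('y, 'e) cblinfun"
  where "L = E\<^sup>\<dagger> o\<^sub>C T\<^sup>\<dagger> o\<^sub>C (E - S o\<^sub>C A\<^sup>\<dagger> o\<^sub>C AA_inv o\<^sub>C S\<^sup>\<dagger> o\<^sub>C A o\<^sub>C E)"

lemma \<Theta>_L:
  assumes "G 0 *\<^sub>V y = 0"
  shows "\<Theta> 0 *\<^sub>V L *\<^sub>V y = y"
proof -
  define m where "m = E *\<^sub>V y - S *\<^sub>V A\<^sup>\<dagger> *\<^sub>V AA_inv *\<^sub>V S\<^sup>\<dagger> *\<^sub>V A *\<^sub>V E *\<^sub>V y"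
  have "A *\<^sub>V m = 0"
    \<comment> \<open>The zeroth entry of A E y is G(0) y = 0, so A E y is the shift of its tail,
      which the correction term cancels. The correction begins with 0, hence m still begins with
      y.\<close>
    using E_plus_shift[of "A *\<^sub>V E *\<^sub>V y"] assms by (simp add: m_def cblinfun_diff A_S AA_AA_inv nth_A)
  then have "ell2_nth m 0 = ell2_nth (T *\<^sub>V T\<^sup>\<dagger> *\<^sub>V m) 0" using ker_A by simp
  then show ?thesis by (simp add: nth_T L_def m_def[symmetric]) (simp add: m_def)
qed

text \<open>
  For the form \<open>[x, y] = \<langle>x\<^sub>1, y\<^sub>1\<rangle> - \<langle>x\<^sub>2, y\<^sub>2\<rangle>\<close>, the pairs \<open>(g1 q r, g2 q r)\<close> make up the orthogonal
  complement of \<open>S M\<close> in \<open>M = {x. A x\<^sub>1 = B x\<^sub>2}\<close>.  The orthogonal complement of \<open>M\<close> is the range of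
  \<open>(A\<^sup>*, B\<^sup>*)\<close>, and the two meet only in \<open>0\<close> because \<open>A A\<^sup>* - B B\<^sup>* = P\<close> is invertible.
\<close>

definition g1 where "g1 q r = E *\<^sub>V \<Theta> 0 *\<^sub>V q - S *\<^sub>V A\<^sup>\<dagger> *\<^sub>V P_inv *\<^sub>V N *\<^sub>V q + A\<^sup>\<dagger> *\<^sub>V P_inv *\<^sub>V B *\<^sub>V E *\<^sub>V r"
definition g2 where "g2 q r = E *\<^sub>V r + B\<^sup>\<dagger> *\<^sub>V P_inv *\<^sub>V B *\<^sub>V E *\<^sub>V r - S *\<^sub>V B\<^sup>\<dagger> *\<^sub>V P_inv *\<^sub>V N *\<^sub>V q"

lemma R_arg_apply: "R_arg *\<^sub>V r = r + ell2_nth (B\<^sup>\<dagger> *\<^sub>V P_inv *\<^sub>V B *\<^sub>V E *\<^sub>V r) 0"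
  by (simp add: leech_R_arg_def)

lemma Q_arg_inner:
  "inner (Q_arg *\<^sub>V q) q' = inner q q' + inner (P_inv *\<^sub>V N *\<^sub>V q) (N *\<^sub>V q') - inner (AA_inv *\<^sub>V N *\<^sub>V q) (N *\<^sub>V q')"
  by (simp add: leech_Q_arg_def inner_add_left inner_diff_left inner_adj'[symmetric] cblinfun_diff)

lemma R_arg_inner: "inner (R_arg *\<^sub>V r) r' = inner r r' + inner (P_inv *\<^sub>V B *\<^sub>V E *\<^sub>V r) (B *\<^sub>V E *\<^sub>V r')"
  by (simp add: R_arg_apply inner_add_left E_adj[symmetric] inner_adj'[symmetric] del: E_adj)

text \<open>Substituting \<open>A A\<^sup>\<dagger> P_inv = I + B B\<^sup>\<dagger> P_inv\<close>
  leaves - S N q, which cancels against A E \<Theta>(0) q, and B E r, the image of the leading term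
  of g2.\<close>

lemma A_g1: "A *\<^sub>V g1 q r = B *\<^sub>V g2 q r"
proof -
  have 1: "A *\<^sub>V A\<^sup>\<dagger> *\<^sub>V P_inv *\<^sub>V x = x + B *\<^sub>V B\<^sup>\<dagger> *\<^sub>V P_inv *\<^sub>V x" for x
    using P_P_inv(1)[of x] by (simp add: P_apply diff_eq_eq)
  show ?thesis
    by (simp add: g1_def g2_def cblinfun_add cblinfun_diff A_S B_S 1 A_E_\<Theta>)
qed

lemma nth_g1: "ell2_nth (g1 q r) 0 = \<Theta> 0 *\<^sub>V q + ell2_nth (A\<^sup>\<dagger> *\<^sub>V P_inv *\<^sub>V B *\<^sub>V E *\<^sub>V r) 0"
  by (simp add: g1_def)

lemma nth_g2: "ell2_nth (g2 q r) 0 = R_arg *\<^sub>V r"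
  by (simp add: g2_def R_arg_apply)

text \<open>Orthogonality to S M in usable form: the backward shift of the pair lies in the
  complement of M.\<close>

lemma S_adj_g:
  "\<exists>n. S\<^sup>\<dagger> *\<^sub>V g1 q r = A\<^sup>\<dagger> *\<^sub>V n \<and> S\<^sup>\<dagger> *\<^sub>V g2 q r = B\<^sup>\<dagger> *\<^sub>V n"
  by (rule exI[of _ "S\<^sup>\<dagger> *\<^sub>V P_inv *\<^sub>V B *\<^sub>V E *\<^sub>V r - P_inv *\<^sub>V N *\<^sub>V q"])
    (simp add: g1_def g2_def cblinfun_add cblinfun_diff S_adj)

text \<open>The pair (g1 0 r, g2 0 r) is the projection of (0, E r) onto M along its complement, so
  pairing with an element of M reads off the zeroth entry of the second component.\<close>

lemma form_E:
  assumes "A *\<^sub>V x = B *\<^sub>V y"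
  shows "inner x (g1 0 r) - inner y (g2 0 r) = - inner (ell2_nth y 0) r"
proof -
  have "inner y (E *\<^sub>V r) = inner (ell2_nth y 0) r"
    by (simp only: inner_adj' E_adj)
  then show ?thesis
    using orthogonal[OF assms, of "P_inv *\<^sub>V B *\<^sub>V E *\<^sub>V r"]
    by (simp add: g1_def g2_def inner_add_right)
qed

text \<open>The terms with \<open>P_inv\<close> combine because
  \<open>A A\<^sup>\<dagger> - B B\<^sup>\<dagger> = P\<close>. What remains is the inner product of
  \<Theta>(0) q and \<Theta>(0) q', and the isometry T, through \<open>T_E\<close>, rewrites it with
  \<open>AA_inv\<close>.\<close>

lemma form_Q:
  "inner (g1 q 0) (g1 q' 0) - inner (g2 q 0) (g2 q' 0) = inner (Q_arg *\<^sub>V q) q'"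
proof -
  have P: "inner (A\<^sup>\<dagger> *\<^sub>V P_inv *\<^sub>V x) (A\<^sup>\<dagger> *\<^sub>V P_inv *\<^sub>V y) - inner (B\<^sup>\<dagger> *\<^sub>V P_inv *\<^sub>V x) (B\<^sup>\<dagger> *\<^sub>V P_inv *\<^sub>V y)
      = inner (P_inv *\<^sub>V x) y" for x y
    using arg_cong[OF P_P_inv(1)[of y], of "\<lambda>w. inner (P_inv *\<^sub>V x) w"]
    by (simp add: P_apply inner_diff_right inner_adj')
  have AA: "inner (A\<^sup>\<dagger> *\<^sub>V AA_inv *\<^sub>V x) (A\<^sup>\<dagger> *\<^sub>V AA_inv *\<^sub>V y) = inner (AA_inv *\<^sub>V x) y" for x y
    by (simp add: inner_adj'[symmetric] AA_AA_inv)
  have "inner q q' = inner (T *\<^sub>V E *\<^sub>V q) (T *\<^sub>V E *\<^sub>V q')" by (simp add: inner_T)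
  also have "\<dots> = inner (\<Theta> 0 *\<^sub>V q) (\<Theta> 0 *\<^sub>V q') + inner (AA_inv *\<^sub>V N *\<^sub>V q) (N *\<^sub>V q')"
    by (simp add: T_E inner_diff_left inner_diff_right AA)
  finally have q: "inner q q' = inner (\<Theta> 0 *\<^sub>V q) (\<Theta> 0 *\<^sub>V q') + inner (AA_inv *\<^sub>V N *\<^sub>V q) (N *\<^sub>V q')" .
  have "inner (g1 q 0) (g1 q' 0) - inner (g2 q 0) (g2 q' 0)
    = inner (\<Theta> 0 *\<^sub>V q) (\<Theta> 0 *\<^sub>V q') + inner (P_inv *\<^sub>V N *\<^sub>V q) (N *\<^sub>V q')"
    unfolding P[symmetric] by (simp add: g1_def g2_def inner_diff_left inner_diff_right)
  then show ?thesis by (simp add: Q_arg_inner q)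
qed

text \<open>The cross terms vanish because g2 q 0 has zeroth entry 0, so that \<open>form_E\<close>
  pairs it to nothing.\<close>

lemma form_g:
  "inner (g1 q r) (g1 q' r') - inner (g2 q r) (g2 q' r') = inner (Q_arg *\<^sub>V q) q' - inner (R_arg *\<^sub>V r) r'"
proof -
  have split: "g1 q r = g1 q 0 + g1 0 r" "g2 q r = g2 q 0 + g2 0 r" for q r
    by (simp_all add: g1_def g2_def)
  have 1: "inner (g1 q r) (g1 0 r') - inner (g2 q r) (g2 0 r') = - inner (R_arg *\<^sub>V r) r'"
    by (simp only: form_E[OF A_g1] nth_g2)
  have 2: "inner (g1 q' 0) (g1 0 r) - inner (g2 q' 0) (g2 0 r) = 0"
    by (simp add: form_E[OF A_g1] nth_g2)
  have "inner (g1 q r) (g1 q' 0) - inner (g2 q r) (g2 q' 0) = inner (Q_arg *\<^sub>V q) q'"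
    using form_Q[of q q'] 2
    by (simp only: split[of q r] inner_add_left)
      (simp add: inner_commute[of "g1 q' 0" "g1 0 r"] inner_commute[of "g2 q' 0" "g2 0 r"])
  with 1 show ?thesis
    by (simp only: split[of "q'" "r'"] inner_add_right)
qed

subsection \<open>The normalising operators\<close>

lemma Q_arg_adj: "Q_arg\<^sup>\<dagger> = Q_arg"
proof (rule adj_eqI)
  fix q q'
  have "inner (P_inv *\<^sub>V N *\<^sub>V q) (N *\<^sub>V q') = inner (P_inv *\<^sub>V N *\<^sub>V q') (N *\<^sub>V q)"
    "inner (AA_inv *\<^sub>V N *\<^sub>V q) (N *\<^sub>V q') = inner (AA_inv *\<^sub>V N *\<^sub>V q') (N *\<^sub>V q)"
    by (metis P_inv_adj AA_inv_adj inner_adj inner_commute)+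
  then show "inner (Q_arg *\<^sub>V q) q' = inner q (Q_arg *\<^sub>V q')"
    by (subst inner_commute[of q]) (simp add: Q_arg_inner inner_commute[of q])
qed

lemma R_arg_adj: "R_arg\<^sup>\<dagger> = R_arg"
proof (rule adj_eqI)
  fix r r'
  have "inner (P_inv *\<^sub>V B *\<^sub>V E *\<^sub>V r) (B *\<^sub>V E *\<^sub>V r') = inner (P_inv *\<^sub>V B *\<^sub>V E *\<^sub>V r') (B *\<^sub>V E *\<^sub>V r)"
    by (metis P_inv_adj inner_adj inner_commute)
  then show "inner (R_arg *\<^sub>V r) r' = inner r (R_arg *\<^sub>V r')"
    by (subst inner_commute[of r]) (simp add: R_arg_inner inner_commute[of r])
qed

lemma P_inv_nonneg: "0 \<le> inner (P_inv *\<^sub>V x) x"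
  using P_nonneg[of "P_inv *\<^sub>V x"] by (simp add: P_P_inv inner_commute)

text \<open>The factor 1 is the constant \<delta> of \<open>strictly_positiveI\<close> and
  \<open>op_sqrt\<close>.\<close>

lemma Q_arg_ge: "1 * (norm q)\<^sup>2 \<le> inner (Q_arg *\<^sub>V q) q"
  using AA_inv_le[of "N *\<^sub>V q"] by (simp add: Q_arg_inner power2_norm_eq_inner)

lemma R_arg_ge: "1 * (norm r)\<^sup>2 \<le> inner (R_arg *\<^sub>V r) r"
  using P_inv_nonneg[of "B *\<^sub>V E *\<^sub>V r"] by (simp add: R_arg_inner power2_norm_eq_inner)

lemma Q_arg_strictly_positive: "strictly_positive Q_arg"
  by (rule strictly_positiveI[OF Q_arg_adj Q_arg_ge]) simp

lemma R_arg_strictly_positive: "strictly_positive R_arg"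
  by (rule strictly_positiveI[OF R_arg_adj R_arg_ge]) simp

lemmas sQ = op_sqrt[OF Q_arg_adj Q_arg_ge zero_less_one]
lemmas sR = op_sqrt[OF R_arg_adj R_arg_ge zero_less_one]

lemma Q_strictly_positive: "strictly_positive Q"
  unfolding leech_Q_def by (rule strictly_positive_op_inv[OF sQ(3,2)])

lemma R_strictly_positive: "strictly_positive R"
  unfolding leech_R_def by (rule strictly_positive_op_inv[OF sR(3,2)])

lemma sQ_Q: "sQ *\<^sub>V Q *\<^sub>V e = e" "Q *\<^sub>V sQ *\<^sub>V e = e"
  using sQ(3) by (simp_all add: leech_Q_def op_inv_apply strictly_positive_def)

lemma sR_R: "sR *\<^sub>V R *\<^sub>V u = u" "R *\<^sub>V sR *\<^sub>V u = u"
  using sR(3) by (simp_all add: leech_R_def op_inv_apply strictly_positive_def)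

lemma Q_arg_inner_sQ: "inner (Q_arg *\<^sub>V q) q' = inner (sQ *\<^sub>V q) (sQ *\<^sub>V q')"
  by (subst sQ(1)[symmetric]) (simp add: inner_adj sQ(2))

lemma R_arg_inner_sR: "inner (R_arg *\<^sub>V q) q' = inner (sR *\<^sub>V q) (sR *\<^sub>V q')"
  by (subst sR(1)[symmetric]) (simp add: inner_adj sR(2))

lemma R_arg_R_R: "R_arg *\<^sub>V R *\<^sub>V R *\<^sub>V u = u"
  by (subst sR(1)[symmetric]) (simp add: sR_R)

text \<open>The zeroth entry of g1 0 r, which has to be subtracted before L can recover q.\<close>

definition E_APBE :: "('u, 'y) cblinfun" where "E_APBE = E\<^sup>\<dagger> o\<^sub>C A\<^sup>\<dagger> o\<^sub>C P_inv o\<^sub>C B o\<^sub>C E"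

text \<open>Zeroth entries leave no choice: the second component fixes r through the inverse R R of
  \<open>R_arg\<close>, the first then fixes q through L. The difference has the form
  \<open>S A\<^sup>\<dagger> (n - n')\<close>, \<open>S B\<^sup>\<dagger> (n - n')\<close>; lying in
  M forces S P (n - n') = 0.\<close>

lemma g_decomposition:
  assumes M: "A *\<^sub>V m1 = B *\<^sub>V m2" and m1: "S\<^sup>\<dagger> *\<^sub>V m1 = A\<^sup>\<dagger> *\<^sub>V n" and m2: "S\<^sup>\<dagger> *\<^sub>V m2 = B\<^sup>\<dagger> *\<^sub>V n"
  defines "r \<equiv> R *\<^sub>V R *\<^sub>V ell2_nth m2 0"
  defines "q \<equiv> L *\<^sub>V (ell2_nth m1 0 - E_APBE *\<^sub>V r)"
  shows "m1 = g1 q r" "m2 = g2 q r"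
proof -
  have r: "R_arg *\<^sub>V r = ell2_nth m2 0" unfolding r_def by (rule R_arg_R_R)
  have "G 0 *\<^sub>V ell2_nth m1 0 = K 0 *\<^sub>V ell2_nth m2 0"
    using arg_cong[OF M, of "\<lambda>x. ell2_nth x 0"] by (simp add: nth_A nth_B)
  moreover have "G 0 *\<^sub>V E_APBE *\<^sub>V r = K 0 *\<^sub>V ell2_nth m2 0"
    using arg_cong[OF A_g1[of 0 r], of "\<lambda>x. ell2_nth x 0"]
    by (simp add: nth_A nth_B nth_g1 nth_g2 r E_APBE_def)
  ultimately have q: "\<Theta> 0 *\<^sub>V q = ell2_nth m1 0 - E_APBE *\<^sub>V r"
    unfolding q_def by (intro \<Theta>_L) (simp add: cblinfun_diff)
  obtain n' where n': "S\<^sup>\<dagger> *\<^sub>V g1 q r = A\<^sup>\<dagger> *\<^sub>V n'" "S\<^sup>\<dagger> *\<^sub>V g2 q r = B\<^sup>\<dagger> *\<^sub>V n'"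
    using S_adj_g by blast
  have d1: "m1 - g1 q r = S *\<^sub>V A\<^sup>\<dagger> *\<^sub>V (n - n')"
    using E_plus_shift[of "m1 - g1 q r"] by (simp add: cblinfun_diff m1 n' nth_g1 q E_APBE_def)
  have d2: "m2 - g2 q r = S *\<^sub>V B\<^sup>\<dagger> *\<^sub>V (n - n')"
    using E_plus_shift[of "m2 - g2 q r"] by (simp add: cblinfun_diff m2 n' nth_g2 r)
  have "A *\<^sub>V (m1 - g1 q r) = B *\<^sub>V (m2 - g2 q r)" by (simp add: cblinfun_diff M A_g1)
  then have "S\<^sup>\<dagger> *\<^sub>V S *\<^sub>V A *\<^sub>V A\<^sup>\<dagger> *\<^sub>V (n - n') = S\<^sup>\<dagger> *\<^sub>V S *\<^sub>V B *\<^sub>V B\<^sup>\<dagger> *\<^sub>V (n - n')"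
    by (simp only: d1 d2 A_S B_S)
  then have "n - n' = 0" by (intro orthogonal_trivial) (simp only: shift_adj_shift)
  with d1 d2 show "m1 = g1 q r" "m2 = g2 q r" by simp_all
qed

section \<open>The coefficient matrix at a point of the disc\<close>

definition col1 where "col1 e u = g1 (Q *\<^sub>V e) (R *\<^sub>V u)"
definition col2 where "col2 e u = g2 (Q *\<^sub>V e) (R *\<^sub>V u)"

lemma form_col:
  "inner (col1 e u) (col1 e' u') - inner (col2 e u) (col2 e' u') = inner e e' - inner u u'"
  by (simp add: col1_def col2_def form_g Q_arg_inner_sQ R_arg_inner_sR sQ_Q sR_R)

lemma col_decomposition:
  assumes "A *\<^sub>V m1 = B *\<^sub>V m2" "S\<^sup>\<dagger> *\<^sub>V m1 = A\<^sup>\<dagger> *\<^sub>V n" "S\<^sup>\<dagger> *\<^sub>V m2 = B\<^sup>\<dagger> *\<^sub>V n"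
  defines "u \<equiv> R *\<^sub>V ell2_nth m2 0"
  defines "e \<equiv> sQ *\<^sub>V L *\<^sub>V (ell2_nth m1 0 - E_APBE *\<^sub>V R *\<^sub>V u)"
  shows "m1 = col1 e u" "m2 = col2 e u"
  using g_decomposition[OF assms(1-3)] by (simp_all add: col1_def col2_def e_def u_def sQ_Q)

abbreviation U11 where "U11 \<equiv> Upsilon11 G K \<Theta>"
abbreviation U12 where "U12 \<equiv> Upsilon12 G K"
abbreviation U21 where "U21 \<equiv> Upsilon21 G K \<Theta>"
abbreviation U22 where "U22 \<equiv> Upsilon22 G K"

text \<open>
  For \<open>k\<close> in the kernel of \<open>G(z)\<close>, \<open>(\<Lambda>1 k, \<Lambda>2 k)\<close> are the coordinates of the wandering vector
  \<open>(E k, 0) - (S - z) (A\<^sup>*, B\<^sup>*) \<Xi> k\<close>, whose value at \<open>z\<close> is \<open>(k, 0)\<close>.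
\<close>

definition \<Xi> :: "complex \<Rightarrow> ('y, 'v ell2) cblinfun"
  where "\<Xi> z = P_inv o\<^sub>C S\<^sup>\<dagger> o\<^sub>C resolvent z o\<^sub>C A o\<^sub>C E"

definition \<Lambda>2 :: "complex \<Rightarrow> ('y, 'u) cblinfun"
  where "\<Lambda>2 z = R o\<^sub>C (z *\<^sub>C (E\<^sup>\<dagger> o\<^sub>C B\<^sup>\<dagger> o\<^sub>C \<Xi> z))"

definition \<Lambda>1 :: "complex \<Rightarrow> ('y, 'e) cblinfun"
  where "\<Lambda>1 z = sQ o\<^sub>C L o\<^sub>C (id_op + z *\<^sub>C (E\<^sup>\<dagger> o\<^sub>C A\<^sup>\<dagger> o\<^sub>C \<Xi> z) - E_APBE o\<^sub>C R o\<^sub>C \<Lambda>2 z)"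

context
  fixes z :: complex
  assumes z: "z \<in> \<bbbD>"
begin

lemma eval_col1: "eval_op z *\<^sub>V col1 e u = U11 z *\<^sub>V e + U12 z *\<^sub>V u"
  using z by (simp add: col1_def g1_def Upsilon11_def Upsilon12_def cblinfun_add cblinfun_diff)

lemma eval_col2: "eval_op z *\<^sub>V col2 e u = U21 z *\<^sub>V e + U22 z *\<^sub>V u"
  using z by (simp add: col2_def g2_def Upsilon21_def Upsilon22_def cblinfun_add cblinfun_diff)

lemma G_U_eq_K_U: "G z *\<^sub>V (U11 z *\<^sub>V e + U12 z *\<^sub>V u) = K z *\<^sub>V (U21 z *\<^sub>V e + U22 z *\<^sub>V u)"
  unfolding eval_col1[symmetric] eval_col2[symmetric] eval_A[OF z, symmetric] eval_B[OF z, symmetric]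
  by (simp add: col1_def col2_def A_g1)

text \<open>Division of the columns by S - z. By \<open>S_adj_g\<close> the quotient again has the
  form \<open>A\<^sup>\<dagger> n\<close>, \<open>B\<^sup>\<dagger> n\<close>, since the resolvent
  commutes with both adjoints.\<close>

lemma col_split:
  obtains n where
    "E *\<^sub>V (U11 z *\<^sub>V e + U12 z *\<^sub>V u) + S *\<^sub>V A\<^sup>\<dagger> *\<^sub>V n = col1 e u + z *\<^sub>C (A\<^sup>\<dagger> *\<^sub>V n)"
    "E *\<^sub>V (U21 z *\<^sub>V e + U22 z *\<^sub>V u) + S *\<^sub>V B\<^sup>\<dagger> *\<^sub>V n = col2 e u + z *\<^sub>C (B\<^sup>\<dagger> *\<^sub>V n)"
proof -
  obtain n where n: "S\<^sup>\<dagger> *\<^sub>V col1 e u = A\<^sup>\<dagger> *\<^sub>V n" "S\<^sup>\<dagger> *\<^sub>V col2 e u = B\<^sup>\<dagger> *\<^sub>V n"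
    using S_adj_g unfolding col1_def col2_def by blast
  have "S\<^sup>\<dagger> *\<^sub>V resolvent z *\<^sub>V col1 e u = A\<^sup>\<dagger> *\<^sub>V resolvent z *\<^sub>V n"
    "S\<^sup>\<dagger> *\<^sub>V resolvent z *\<^sub>V col2 e u = B\<^sup>\<dagger> *\<^sub>V resolvent z *\<^sub>V n"
    by (simp_all add: resolvent_shift_adj[OF z, symmetric] n resolvent_adj_commute[OF A_comm z]
        resolvent_adj_commute[OF B_comm z])
  with eval_op_decomp[OF z, of "col1 e u"] eval_op_decomp[OF z, of "col2 e u"] show ?thesis
    by (intro that[of "resolvent z *\<^sub>V n"]) (simp_all add: eval_col1 eval_col2 algebra_simps)
qed

text \<open>Evaluate the form on both sides of \<open>col_split\<close>. The mixed terms cancel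
  because the columns lie in M, and the defect is (1 - |z|^2) <P n, n>.\<close>

lemma U_contractive:
  "(norm (U11 z *\<^sub>V e + U12 z *\<^sub>V u))\<^sup>2 - (norm (U21 z *\<^sub>V e + U22 z *\<^sub>V u))\<^sup>2 \<le> (norm e)\<^sup>2 - (norm u)\<^sup>2"
proof -
  obtain n where
    n1: "E *\<^sub>V (U11 z *\<^sub>V e + U12 z *\<^sub>V u) + S *\<^sub>V A\<^sup>\<dagger> *\<^sub>V n = col1 e u + z *\<^sub>C (A\<^sup>\<dagger> *\<^sub>V n)" and
    n2: "E *\<^sub>V (U21 z *\<^sub>V e + U22 z *\<^sub>V u) + S *\<^sub>V B\<^sup>\<dagger> *\<^sub>V n = col2 e u + z *\<^sub>C (B\<^sup>\<dagger> *\<^sub>V n)"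
    by (rule col_split)
  have 1: "(norm (U11 z *\<^sub>V e + U12 z *\<^sub>V u))\<^sup>2 + (norm (A\<^sup>\<dagger> *\<^sub>V n))\<^sup>2
    = (norm (col1 e u))\<^sup>2 + 2 * inner (col1 e u) (A\<^sup>\<dagger> *\<^sub>V z *\<^sub>C n) + (cmod z)\<^sup>2 * (norm (A\<^sup>\<dagger> *\<^sub>V n))\<^sup>2"
    unfolding power2_norm_E_plus_shift[symmetric] n1 power2_norm_add[of "col1 e u"]
    by (simp add: norm_scaleC power_mult_distrib)
  have 2: "(norm (U21 z *\<^sub>V e + U22 z *\<^sub>V u))\<^sup>2 + (norm (B\<^sup>\<dagger> *\<^sub>V n))\<^sup>2
    = (norm (col2 e u))\<^sup>2 + 2 * inner (col2 e u) (B\<^sup>\<dagger> *\<^sub>V z *\<^sub>C n) + (cmod z)\<^sup>2 * (norm (B\<^sup>\<dagger> *\<^sub>V n))\<^sup>2"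
    unfolding power2_norm_E_plus_shift[symmetric] n2 power2_norm_add[of "col2 e u"]
    by (simp add: norm_scaleC power_mult_distrib)
  have 3: "inner (col1 e u) (A\<^sup>\<dagger> *\<^sub>V z *\<^sub>C n) = inner (col2 e u) (B\<^sup>\<dagger> *\<^sub>V z *\<^sub>C n)"
    by (rule orthogonal) (simp add: col1_def col2_def A_g1)
  have 4: "(norm (col1 e u))\<^sup>2 - (norm (col2 e u))\<^sup>2 = (norm e)\<^sup>2 - (norm u)\<^sup>2"
    unfolding power2_norm_eq_inner by (rule form_col)
  have "(cmod z)\<^sup>2 \<le> 1" using z by (simp add: power_le_one)
  then have "0 \<le> (1 - (cmod z)\<^sup>2) * inner (P *\<^sub>V n) n" by (simp add: P_nonneg)
  with 1 2 3 4 show ?thesis by (simp add: P_inner algebra_simps)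
qed

text \<open>With value 0 at z the columns reduce to S - z applied to
  (\<open>A\<^sup>\<dagger> n\<close>, \<open>B\<^sup>\<dagger> n\<close>). Lying in M they give (S
  - z) P n = 0, hence n = 0, and the columns vanish.\<close>

lemma U_injective:
  assumes 1: "U11 z *\<^sub>V e + U12 z *\<^sub>V u = 0" and 2: "U21 z *\<^sub>V e + U22 z *\<^sub>V u = 0"
  shows "e = 0" "u = 0"
proof -
  obtain n where
    n1: "E *\<^sub>V (U11 z *\<^sub>V e + U12 z *\<^sub>V u) + S *\<^sub>V A\<^sup>\<dagger> *\<^sub>V n = col1 e u + z *\<^sub>C (A\<^sup>\<dagger> *\<^sub>V n)" and
    n2: "E *\<^sub>V (U21 z *\<^sub>V e + U22 z *\<^sub>V u) + S *\<^sub>V B\<^sup>\<dagger> *\<^sub>V n = col2 e u + z *\<^sub>C (B\<^sup>\<dagger> *\<^sub>V n)"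
    by (rule col_split)
  define d where "d = A *\<^sub>V A\<^sup>\<dagger> *\<^sub>V n - B *\<^sub>V B\<^sup>\<dagger> *\<^sub>V n"
  have f1: "col1 e u = S *\<^sub>V A\<^sup>\<dagger> *\<^sub>V n - z *\<^sub>C (A\<^sup>\<dagger> *\<^sub>V n)" using n1 1 by (simp add: eq_diff_eq)
  have f2: "col2 e u = S *\<^sub>V B\<^sup>\<dagger> *\<^sub>V n - z *\<^sub>C (B\<^sup>\<dagger> *\<^sub>V n)" using n2 2 by (simp add: eq_diff_eq)
  have "A *\<^sub>V col1 e u = B *\<^sub>V col2 e u" by (simp add: col1_def col2_def A_g1)
  then have "S *\<^sub>V d = z *\<^sub>C d"
    by (simp add: f1 f2 cblinfun_diff A_S B_S d_def scaleC_diff_right algebra_simps)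
  then have "d = 0" using shift_eq_scaleC_iff[OF z] by blast
  then have "n = 0" by (intro orthogonal_trivial) (simp add: d_def)
  then have 0: "col1 e u = 0" "col2 e u = 0" by (simp_all add: f1 f2)
  then have "R_arg *\<^sub>V R *\<^sub>V u = 0" using nth_g2[of "Q *\<^sub>V e" "R *\<^sub>V u"] by (simp add: col2_def)
  then have "R *\<^sub>V u = 0" using R_arg_ge[of "R *\<^sub>V u"] by simp
  then show u: "u = 0" using sR_R(1)[of u] by simp
  show "e = 0" using form_col[of e u e u] unfolding 0 by (simp add: u)
qed

lemma U_\<Lambda>:
  assumes k: "G z *\<^sub>V k = 0"
  shows "U11 z *\<^sub>V \<Lambda>1 z *\<^sub>V k + U12 z *\<^sub>V \<Lambda>2 z *\<^sub>V k = k" "U21 z *\<^sub>V \<Lambda>1 z *\<^sub>V k + U22 z *\<^sub>V \<Lambda>2 z *\<^sub>V k = 0"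
proof -
  define \<xi> where "\<xi> = S\<^sup>\<dagger> *\<^sub>V resolvent z *\<^sub>V A *\<^sub>V E *\<^sub>V k"
  define m1 where "m1 = E *\<^sub>V k - (S *\<^sub>V A\<^sup>\<dagger> *\<^sub>V P_inv *\<^sub>V \<xi> - z *\<^sub>C (A\<^sup>\<dagger> *\<^sub>V P_inv *\<^sub>V \<xi>))"
  define m2 where "m2 = - (S *\<^sub>V B\<^sup>\<dagger> *\<^sub>V P_inv *\<^sub>V \<xi> - z *\<^sub>C (B\<^sup>\<dagger> *\<^sub>V P_inv *\<^sub>V \<xi>))"
  \<comment> \<open>G(z) k = 0 makes the remainder of the division by S - z vanish; this is what
    puts (m1, m2) into M.\<close>
  have \<xi>: "A *\<^sub>V E *\<^sub>V k = S *\<^sub>V \<xi> - z *\<^sub>C \<xi>"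
    using eval_op_decomp[OF z, of "A *\<^sub>V E *\<^sub>V k"] by (simp add: \<xi>_def eval_A[OF z] eval_op_E[OF z] k)
  have P: "A *\<^sub>V A\<^sup>\<dagger> *\<^sub>V P_inv *\<^sub>V x = x + B *\<^sub>V B\<^sup>\<dagger> *\<^sub>V P_inv *\<^sub>V x" for x
    using P_P_inv(1)[of x] by (simp add: P_apply diff_eq_eq)
  have M: "A *\<^sub>V m1 = B *\<^sub>V m2"
    by (simp add: m1_def m2_def cblinfun_linear A_S B_S P \<xi> scaleC_add_right)
  define n where "n = z *\<^sub>C (S\<^sup>\<dagger> *\<^sub>V P_inv *\<^sub>V \<xi>) - P_inv *\<^sub>V \<xi>"
  have n: "S\<^sup>\<dagger> *\<^sub>V m1 = A\<^sup>\<dagger> *\<^sub>V n" "S\<^sup>\<dagger> *\<^sub>V m2 = B\<^sup>\<dagger> *\<^sub>V n"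
    by (simp_all add: m1_def m2_def n_def cblinfun_linear S_adj)
  have nth: "ell2_nth m1 0 = k + z *\<^sub>C ell2_nth (A\<^sup>\<dagger> *\<^sub>V P_inv *\<^sub>V \<xi>) 0"
    "ell2_nth m2 0 = z *\<^sub>C ell2_nth (B\<^sup>\<dagger> *\<^sub>V P_inv *\<^sub>V \<xi>) 0"
    by (simp_all add: m1_def m2_def flip: diff_0)
  have par2: "\<Lambda>2 z *\<^sub>V k = R *\<^sub>V ell2_nth m2 0"
    by (simp add: nth \<Lambda>2_def \<Xi>_def \<xi>_def)
  have par1: "\<Lambda>1 z *\<^sub>V k = sQ *\<^sub>V L *\<^sub>V (ell2_nth m1 0 - E_APBE *\<^sub>V R *\<^sub>V \<Lambda>2 z *\<^sub>V k)"
    by (simp add: nth \<Lambda>1_def \<Xi>_def \<xi>_def)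
  have "m1 = col1 (\<Lambda>1 z *\<^sub>V k) (\<Lambda>2 z *\<^sub>V k)" "m2 = col2 (\<Lambda>1 z *\<^sub>V k) (\<Lambda>2 z *\<^sub>V k)"
    unfolding par1 par2 by (rule col_decomposition[OF M n])+
  moreover have "eval_op z *\<^sub>V m1 = k" "eval_op z *\<^sub>V m2 = 0"
    by (simp_all add: m1_def m2_def cblinfun_linear eval_op_E[OF z] eval_op_shift[OF z])
  ultimately show "U11 z *\<^sub>V \<Lambda>1 z *\<^sub>V k + U12 z *\<^sub>V \<Lambda>2 z *\<^sub>V k = k" "U21 z *\<^sub>V \<Lambda>1 z *\<^sub>V k + U22 z *\<^sub>V \<Lambda>2 z *\<^sub>V k = 0"
    by (simp_all add: eval_col1 eval_col2)
qed

text \<open>In the form, (k1, - k2) represents evaluation at z against (y, u), and p is its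
  projection onto M. The vector m = p - conj(z) S p is wandering; its coordinates are, up to sign,
  the two components of the adjoint of \<Upsilon>(z) at (y, u). Comparing the form at m and p
  produces 1 - |z|^2, which the norms of the Szego kernels absorb.\<close>

lemma U_adj_form:
  fixes y :: 'y and u :: 'u
  defines "h \<equiv> A *\<^sub>V (eval_op z)\<^sup>\<dagger> *\<^sub>V y + B *\<^sub>V (eval_op z)\<^sup>\<dagger> *\<^sub>V u"
  shows "(norm ((U11 z)\<^sup>\<dagger> *\<^sub>V y + (U21 z)\<^sup>\<dagger> *\<^sub>V u))\<^sup>2 - (norm ((U12 z)\<^sup>\<dagger> *\<^sub>V y + (U22 z)\<^sup>\<dagger> *\<^sub>V u))\<^sup>2
    = (norm y)\<^sup>2 - (norm u)\<^sup>2 - (1 - (cmod z)\<^sup>2) * inner (P_inv *\<^sub>V h) h"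
proof -
  define k1 where "k1 = (eval_op z)\<^sup>\<dagger> *\<^sub>V y"
  define k2 where "k2 = (eval_op z)\<^sup>\<dagger> *\<^sub>V u"
  define \<zeta> where "\<zeta> = P_inv *\<^sub>V h"
  define p1 where "p1 = k1 - A\<^sup>\<dagger> *\<^sub>V \<zeta>"
  define p2 where "p2 = - k2 - B\<^sup>\<dagger> *\<^sub>V \<zeta>"
  define m1 where "m1 = p1 - S *\<^sub>V cnj z *\<^sub>C p1"
  define m2 where "m2 = p2 - S *\<^sub>V cnj z *\<^sub>C p2"
  have h: "A *\<^sub>V A\<^sup>\<dagger> *\<^sub>V \<zeta> - B *\<^sub>V B\<^sup>\<dagger> *\<^sub>V \<zeta> = h"
    using P_P_inv(1)[of h] by (simp add: P_apply \<zeta>_def)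
  have h': "h = A *\<^sub>V k1 + B *\<^sub>V k2" by (simp add: h_def k1_def k2_def)
  have Mp: "A *\<^sub>V p1 = B *\<^sub>V p2"
    using h unfolding h' by (simp add: p1_def p2_def cblinfun_linear algebra_simps)
  then have Mp': "A *\<^sub>V cnj z *\<^sub>C p1 = B *\<^sub>V cnj z *\<^sub>C p2" by simp
  have Mm: "A *\<^sub>V m1 = B *\<^sub>V m2" by (simp add: m1_def m2_def cblinfun_diff A_S B_S Mp)
  have Sk: "S\<^sup>\<dagger> *\<^sub>V k1 = cnj z *\<^sub>C k1" "S\<^sup>\<dagger> *\<^sub>V k2 = cnj z *\<^sub>C k2"
    by (simp_all add: k1_def k2_def shift_adj_eval_adj[OF z])
  \<comment> \<open>The eigenvector property of k1 and k2 cancels their contribution to the backward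
    shift of m, leaving only the terms with \<zeta>.\<close>
  define n where "n = cnj z *\<^sub>C \<zeta> - S\<^sup>\<dagger> *\<^sub>V \<zeta>"
  have n: "S\<^sup>\<dagger> *\<^sub>V m1 = A\<^sup>\<dagger> *\<^sub>V n" "S\<^sup>\<dagger> *\<^sub>V m2 = B\<^sup>\<dagger> *\<^sub>V n"
    by (simp_all add: m1_def m2_def n_def p1_def p2_def cblinfun_linear S_adj Sk scaleC_diff_right scaleC_minus_right)
  obtain e v where m: "m1 = col1 e v" "m2 = col2 e v"
    using col_decomposition[OF Mm n] by blast
  have pk: "inner x1 p1 - inner x2 p2 = inner x1 k1 + inner x2 k2" if "A *\<^sub>V x1 = B *\<^sub>V x2" for x1 x2
    using orthogonal[OF that, of \<zeta>] by (simp add: p1_def p2_def inner_diff_right)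
  have test: "inner e e' - inner v v' = inner ((U11 z)\<^sup>\<dagger> *\<^sub>V y + (U21 z)\<^sup>\<dagger> *\<^sub>V u) e' + inner ((U12 z)\<^sup>\<dagger> *\<^sub>V y + (U22 z)\<^sup>\<dagger> *\<^sub>V u) v'" for e' v'
  proof -
    have M': "A *\<^sub>V col1 e' v' = B *\<^sub>V col2 e' v'" by (simp add: col1_def col2_def A_g1)
    obtain n' where n': "S\<^sup>\<dagger> *\<^sub>V col1 e' v' = A\<^sup>\<dagger> *\<^sub>V n'" "S\<^sup>\<dagger> *\<^sub>V col2 e' v' = B\<^sup>\<dagger> *\<^sub>V n'"
      using S_adj_g unfolding col1_def col2_def by blast
    have Sp: "inner (S *\<^sub>V cnj z *\<^sub>C p1) (col1 e' v') = inner (S *\<^sub>V cnj z *\<^sub>C p2) (col2 e' v')"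
      unfolding inner_adj[of S] n' by (rule orthogonal[OF Mp'])
    have "inner e e' - inner v v' = inner m1 (col1 e' v') - inner m2 (col2 e' v')"
      unfolding m by (rule form_col[symmetric])
    also have "\<dots> = inner (col1 e' v') p1 - inner (col2 e' v') p2"
      using Sp by (simp only: m1_def m2_def inner_diff_left) (simp add: inner_commute)
    also have "\<dots> = inner y (eval_op z *\<^sub>V col1 e' v') + inner u (eval_op z *\<^sub>V col2 e' v')"
      unfolding pk[OF M'] by (simp add: k1_def k2_def inner_adj'[symmetric] inner_commute[of "col1 e' v'"] inner_commute[of "col2 e' v'"])
    also have "\<dots> = inner ((U11 z)\<^sup>\<dagger> *\<^sub>V y + (U21 z)\<^sup>\<dagger> *\<^sub>V u) e' + inner ((U12 z)\<^sup>\<dagger> *\<^sub>V y + (U22 z)\<^sup>\<dagger> *\<^sub>V u) v'"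
      by (simp add: eval_col1 eval_col2 inner_add_left inner_add_right inner_adj'[symmetric])
    finally show ?thesis .
  qed
  have e: "e = (U11 z)\<^sup>\<dagger> *\<^sub>V y + (U21 z)\<^sup>\<dagger> *\<^sub>V u" by (rule inner_eqI) (use test[of _ 0] in simp)
  have v: "- v = (U12 z)\<^sup>\<dagger> *\<^sub>V y + (U22 z)\<^sup>\<dagger> *\<^sub>V u" by (rule inner_eqI) (use test[of 0] in simp)
  \<comment> \<open>The mixed term survives in each component and cancels only in the difference of
    the two.\<close>
  have norm_p: "(norm p)\<^sup>2 = (norm m)\<^sup>2 + 2 * inner (S\<^sup>\<dagger> *\<^sub>V m) (cnj z *\<^sub>C p) + (cmod z)\<^sup>2 * (norm p)\<^sup>2"
    if "m = p - S *\<^sub>V cnj z *\<^sub>C p" for m p :: "'c::complex_hilbert ell2"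
  proof -
    have "p = m + S *\<^sub>V cnj z *\<^sub>C p" using that by simp
    then have "(norm p)\<^sup>2 = (norm (m + S *\<^sub>V cnj z *\<^sub>C p))\<^sup>2" by simp
    also have "\<dots> = (norm m)\<^sup>2 + 2 * inner (S\<^sup>\<dagger> *\<^sub>V m) (cnj z *\<^sub>C p) + (cmod z)\<^sup>2 * (norm p)\<^sup>2"
      unfolding power2_norm_add norm_shift_op norm_scaleC power_mult_distrib complex_mod_cnj inner_adj'[of m S] ..
    finally show ?thesis .
  qed
  have cancel: "inner (A\<^sup>\<dagger> *\<^sub>V n) (cnj z *\<^sub>C p1) = inner (B\<^sup>\<dagger> *\<^sub>V n) (cnj z *\<^sub>C p2)"
    using orthogonal[OF Mp', of n] by (simp only: inner_commute)
  have mm: "(norm m1)\<^sup>2 - (norm m2)\<^sup>2 = (1 - (cmod z)\<^sup>2) * ((norm p1)\<^sup>2 - (norm p2)\<^sup>2)"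
    using norm_p[OF m1_def] norm_p[OF m2_def] cancel by (simp only: n) (simp add: algebra_simps)
  have pp: "(norm p1)\<^sup>2 - (norm p2)\<^sup>2 = (norm k1)\<^sup>2 - (norm k2)\<^sup>2 - inner \<zeta> h"
    using pk[OF Mp] by (simp add: power2_norm_eq_inner h' p1_def p2_def inner_diff_left inner_diff_right
        inner_add_right inner_adj')
  have "(norm e)\<^sup>2 - (norm v)\<^sup>2 = (norm m1)\<^sup>2 - (norm m2)\<^sup>2"
    unfolding m power2_norm_eq_inner by (rule form_col[symmetric])
  also have "\<dots> = (1 - (cmod z)\<^sup>2) * (norm k1)\<^sup>2 - (1 - (cmod z)\<^sup>2) * (norm k2)\<^sup>2 - (1 - (cmod z)\<^sup>2) * inner \<zeta> h"
    unfolding mm pp by (simp add: algebra_simps)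
  also have "\<dots> = (norm y)\<^sup>2 - (norm u)\<^sup>2 - (1 - (cmod z)\<^sup>2) * inner \<zeta> h"
    by (simp only: k1_def k2_def norm_eval_adj[OF z])
  finally show ?thesis
    by (simp only: e[symmetric] v[symmetric] norm_minus_cancel \<zeta>_def)
qed

end

section \<open>The linear fractional parametrization\<close>

text \<open>The transform at one point, with an operator in place of a parameter function, so that
  existence can be settled before analyticity.\<close>

definition fraction where
  "fraction z X = (U11 z o\<^sub>C X + U12 z) o\<^sub>C op_inv (U21 z o\<^sub>C X + U22 z)"

definition \<alpha> where "\<alpha> z F = U11 z - F o\<^sub>C U21 z"

definition \<beta> where "\<beta> z F = U12 z - F o\<^sub>C U22 z"

text \<open>
  A left inverse of \<open>\<alpha> z F\<close> when \<open>F\<close> comes from the contraction \<open>X\<close>.  Its bound, uniform in \<open>X\<close>,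
  makes the continuity method of \<open>dominated_fraction\<close> work.
\<close>

definition \<alpha>_inv where "\<alpha>_inv z X = \<Lambda>1 z - X o\<^sub>C \<Lambda>2 z"

definition dominated where
  "dominated z F \<longleftrightarrow> G z o\<^sub>C F = K z \<and> (\<forall>y. norm ((\<beta> z F)\<^sup>\<dagger> *\<^sub>V y) \<le> norm ((\<alpha> z F)\<^sup>\<dagger> *\<^sub>V y))"

context
  fixes z :: complex
  assumes z: "z \<in> \<bbbD>"
begin

section \<open>Denominators and values of the transform at one point\<close>

lemma U_adj_le:
  "(norm ((U11 z)\<^sup>\<dagger> *\<^sub>V y + (U21 z)\<^sup>\<dagger> *\<^sub>V u))\<^sup>2 - (norm ((U12 z)\<^sup>\<dagger> *\<^sub>V y + (U22 z)\<^sup>\<dagger> *\<^sub>V u))\<^sup>2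
    \<le> (norm y)\<^sup>2 - (norm u)\<^sup>2"
proof -
  have "(cmod z)\<^sup>2 \<le> 1" using z by (simp add: power_le_one)
  then show ?thesis by (subst U_adj_form[OF z]) (simp add: P_inv_nonneg)
qed

text \<open>Setting e = 0 in \<open>U_contractive\<close> and y = 0 in \<open>U_adj_le\<close>
  bounds U22 and its adjoint below by 1.\<close>

lemma U22_invertible: "invertible_op (U22 z)"
proof (rule bounded_below_invertible)
  fix u
  show "1 * norm u \<le> norm (U22 z *\<^sub>V u)"
  proof (rule power2_le_imp_le)
    show "(1 * norm u)\<^sup>2 \<le> (norm (U22 z *\<^sub>V u))\<^sup>2"
      using U_contractive[OF z, of 0 u] zero_le_power2[of "norm (U12 z *\<^sub>V u)"]
      unfolding cblinfun_zero add_0 mult_1 norm_zero power_zero_numeral by linarith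
  qed simp
  show "1 * norm u \<le> norm ((U22 z)\<^sup>\<dagger> *\<^sub>V u)"
  proof (rule power2_le_imp_le)
    show "(1 * norm u)\<^sup>2 \<le> (norm ((U22 z)\<^sup>\<dagger> *\<^sub>V u))\<^sup>2"
      using U_adj_le[of 0 u] zero_le_power2[of "norm ((U21 z)\<^sup>\<dagger> *\<^sub>V u)"]
      unfolding cblinfun_zero add_0 mult_1 norm_zero power_zero_numeral by linarith
  qed simp
qed simp_all

text \<open>With u the image of w under the adjoint of U22, \<open>U_adj_le\<close> gives |D^* u|^2
  <= |u|^2 - |w|^2. Strictness comes from the boundedness of U22, which bounds |w| below by a
  multiple of |u|.\<close>

lemma norm_U22_inv_U21: "norm (op_inv (U22 z) o\<^sub>C U21 z) < 1"
proof -
  define D where "D = op_inv (U22 z) o\<^sub>C U21 z"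
  \<comment> \<open>The summand 1 ensures 1 <= c, so that q is nonnegative.\<close>
  define c where "c = norm ((U22 z)\<^sup>\<dagger>) + 1"
  have c: "1 \<le> c" by (simp add: c_def)
  define q where "q = 1 - 1 / c\<^sup>2"
  have "1 \<le> c\<^sup>2" using c by (rule one_le_power)
  then have q: "0 \<le> q" "q < 1" using c by (auto simp: q_def divide_le_eq_1)
  have D: "norm (D\<^sup>\<dagger> *\<^sub>V u) \<le> sqrt q * norm u" for u
  proof (rule power2_le_imp_le)
    define w where "w = (op_inv (U22 z))\<^sup>\<dagger> *\<^sub>V u"
    have u: "(U22 z)\<^sup>\<dagger> *\<^sub>V w = u"
      unfolding w_def by (rule inner_eqI) (simp add: inner_adj'[symmetric] op_inv_apply[OF U22_invertible])
    have "norm u \<le> norm ((U22 z)\<^sup>\<dagger>) * norm w" unfolding u[symmetric] by (rule norm_cblinfun_apply_le)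
    also have "\<dots> \<le> c * norm w" by (simp add: c_def mult_right_mono)
    finally have "(norm u)\<^sup>2 \<le> c\<^sup>2 * (norm w)\<^sup>2"
      using power_mono[of "norm u" "c * norm w" 2] by (simp add: power_mult_distrib)
    then have "(norm u)\<^sup>2 / c\<^sup>2 \<le> (norm w)\<^sup>2" using c by (simp add: field_simps)
    moreover have "(norm ((U21 z)\<^sup>\<dagger> *\<^sub>V w))\<^sup>2 \<le> (norm u)\<^sup>2 - (norm w)\<^sup>2"
      using U_adj_le[of 0 w] by (simp add: u)
    moreover have "D\<^sup>\<dagger> *\<^sub>V u = (U21 z)\<^sup>\<dagger> *\<^sub>V w" by (simp add: D_def adj_comp w_def)
    ultimately have "(norm (D\<^sup>\<dagger> *\<^sub>V u))\<^sup>2 \<le> q * (norm u)\<^sup>2" by (simp add: q_def algebra_simps)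
    then show "(norm (D\<^sup>\<dagger> *\<^sub>V u))\<^sup>2 \<le> (sqrt q * norm u)\<^sup>2" using q by (simp add: power_mult_distrib)
  qed (simp add: q)
  have "norm D \<le> sqrt q"
    by (rule norm_cblinfun_le) (use norm_adj_apply_le[OF D] q in simp_all)
  also have "\<dots> < 1" using q by simp
  finally show ?thesis by (simp add: D_def)
qed

lemma denominator_invertible:
  assumes X: "norm X \<le> 1"
  shows "invertible_op (U21 z o\<^sub>C X + U22 z)"
proof -
  define D where "D = op_inv (U22 z) o\<^sub>C U21 z"
  have "norm (D o\<^sub>C X) \<le> norm D * norm X" by (rule norm_op_comp_le)
  also have "\<dots> \<le> norm D" using X by (simp add: mult_left_le)
  also have "\<dots> < 1" unfolding D_def by (rule norm_U22_inv_U21)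
  finally have "invertible_op (U22 z o\<^sub>C (id_op + D o\<^sub>C X))"
    by (intro invertible_op_comp U22_invertible invertible_id_plus)
  also have "U22 z o\<^sub>C (id_op + D o\<^sub>C X) = U21 z o\<^sub>C X + U22 z"
    by (rule cblinfun_eqI) (simp add: D_def cblinfun_add op_inv_apply[OF U22_invertible])
  finally show ?thesis .
qed

lemma fraction_apply:
  assumes X: "norm X \<le> 1"
  shows "fraction z X *\<^sub>V (U21 z *\<^sub>V X *\<^sub>V v + U22 z *\<^sub>V v) = U11 z *\<^sub>V X *\<^sub>V v + U12 z *\<^sub>V v"
  using op_inv_apply(2)[OF denominator_invertible[OF X], of v] by (simp add: fraction_def)

lemma denominator_surj:
  assumes X: "norm X \<le> 1"
  obtains v where "U21 z *\<^sub>V X *\<^sub>V v + U22 z *\<^sub>V v = x"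
  using op_inv_apply(1)[OF denominator_invertible[OF X], of x] by (auto simp: that)

lemma fraction_eqI:
  assumes X: "norm X \<le> 1"
    and F: "\<And>v. F *\<^sub>V (U21 z *\<^sub>V X *\<^sub>V v + U22 z *\<^sub>V v) = U11 z *\<^sub>V X *\<^sub>V v + U12 z *\<^sub>V v"
  shows "F = fraction z X"
proof (rule cblinfun_eqI)
  fix x
  obtain v where "U21 z *\<^sub>V X *\<^sub>V v + U22 z *\<^sub>V v = x" by (rule denominator_surj[OF X])
  then show "F *\<^sub>V x = fraction z X *\<^sub>V x" using F[of v] fraction_apply[OF X, of v] by simp
qed

lemma norm_fraction_le:
  assumes X: "norm X \<le> 1"
  shows "norm (fraction z X) \<le> 1"
proof (rule norm_cblinfun_le)
  fix x
  obtain v where v: "U21 z *\<^sub>V X *\<^sub>V v + U22 z *\<^sub>V v = x" by (rule denominator_surj[OF X])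
  have "norm (X *\<^sub>V v) \<le> norm v"
    using norm_cblinfun_apply_le[of X v] mult_right_mono[OF X, of "norm v"] by simp
  then have "(norm (X *\<^sub>V v))\<^sup>2 \<le> (norm v)\<^sup>2" by (rule power_mono) simp
  then have "(norm (fraction z X *\<^sub>V x))\<^sup>2 \<le> (norm x)\<^sup>2"
    using U_contractive[OF z, of "X *\<^sub>V v" v]
    unfolding fraction_apply[OF X, of v, symmetric] v by linarith
  then show "norm (fraction z X *\<^sub>V x) \<le> 1 * norm x" by (simp add: power2_le_iff_abs_le)
qed simp

lemma G_fraction:
  assumes X: "norm X \<le> 1"
  shows "G z o\<^sub>C fraction z X = K z"
proof (rule cblinfun_eqI)
  fix x
  obtain v where v: "U21 z *\<^sub>V X *\<^sub>V v + U22 z *\<^sub>V v = x" by (rule denominator_surj[OF X])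
  show "(G z o\<^sub>C fraction z X) *\<^sub>V x = K z *\<^sub>V x"
    using G_U_eq_K_U[OF z, of "X *\<^sub>V v" v] fraction_apply[OF X, of v] by (simp add: v)
qed

text \<open>A common value of both fractions exhibits one vector as the image under \<Upsilon>(z) of
  (X w, w) and of (X' v, v), and \<Upsilon>(z) is injective.\<close>

lemma fraction_inj:
  assumes X: "norm X \<le> 1" and X': "norm X' \<le> 1" and eq: "fraction z X = fraction z X'"
  shows "X = X'"
proof (rule cblinfun_eqI)
  fix w
  define x where "x = U21 z *\<^sub>V X *\<^sub>V w + U22 z *\<^sub>V w"
  obtain v where v: "U21 z *\<^sub>V X' *\<^sub>V v + U22 z *\<^sub>V v = x" by (rule denominator_surj[OF X'])
  have "U11 z *\<^sub>V X *\<^sub>V w + U12 z *\<^sub>V w = U11 z *\<^sub>V X' *\<^sub>V v + U12 z *\<^sub>V v"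
    using fraction_apply[OF X, of w] fraction_apply[OF X', of v] by (simp add: eq v x_def)
  then have "U11 z *\<^sub>V (X *\<^sub>V w - X' *\<^sub>V v) + U12 z *\<^sub>V (w - v) = 0"
    by (simp add: cblinfun_diff algebra_simps)
  moreover have "U21 z *\<^sub>V (X *\<^sub>V w - X' *\<^sub>V v) + U22 z *\<^sub>V (w - v) = 0"
    using v unfolding x_def by (simp add: cblinfun_diff algebra_simps)
  ultimately have "X *\<^sub>V w - X' *\<^sub>V v = 0" "w - v = 0" by (rule U_injective[OF z])+
  then show "X *\<^sub>V w = X' *\<^sub>V w" by simp
qed

text \<open>Clearing the denominator makes the equation for X linear.\<close>

lemma fraction_iff_\<alpha>_\<beta>:
  assumes X: "norm X \<le> 1"
  shows "F = fraction z X \<longleftrightarrow> \<alpha> z F o\<^sub>C X = - \<beta> z F"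
proof
  assume F: "F = fraction z X"
  show "\<alpha> z F o\<^sub>C X = - \<beta> z F"
    by (rule cblinfun_eqI)
      (use fraction_apply[OF X] in \<open>simp add: F \<alpha>_def \<beta>_def cblinfun_add algebra_simps\<close>)
next
  assume eq: "\<alpha> z F o\<^sub>C X = - \<beta> z F"
  show "F = fraction z X"
  proof (rule fraction_eqI[OF X])
    fix v
    show "F *\<^sub>V (U21 z *\<^sub>V X *\<^sub>V v + U22 z *\<^sub>V v) = U11 z *\<^sub>V X *\<^sub>V v + U12 z *\<^sub>V v"
      using arg_cong[OF eq, of "\<lambda>T. T *\<^sub>V v"] by (simp add: \<alpha>_def \<beta>_def cblinfun_add algebra_simps)
  qed
qed

section \<open>The operator \<alpha>, its left inverse and the continuity method\<close>

lemma G_\<alpha>_\<beta>: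
  assumes F: "G z o\<^sub>C F = K z"
  shows "G z *\<^sub>V \<alpha> z F *\<^sub>V e = 0" "G z *\<^sub>V \<beta> z F *\<^sub>V u = 0"
proof -
  have "G z *\<^sub>V F *\<^sub>V x = K z *\<^sub>V x" for x using arg_cong[OF F, of "\<lambda>T. T *\<^sub>V x"] by simp
  then show "G z *\<^sub>V \<alpha> z F *\<^sub>V e = 0" "G z *\<^sub>V \<beta> z F *\<^sub>V u = 0"
    using G_U_eq_K_U[OF z, of e 0] G_U_eq_K_U[OF z, of 0 u] by (simp_all add: \<alpha>_def \<beta>_def cblinfun_diff)
qed

lemma norm_\<alpha>_inv_le: "norm X \<le> 1 \<Longrightarrow> norm (\<alpha>_inv z X) \<le> norm (\<Lambda>1 z) + norm (\<Lambda>2 z)"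
  unfolding \<alpha>_inv_def
  by (rule order_trans[OF norm_triangle_ineq4], rule add_left_mono, rule order_trans[OF norm_op_comp_le])
    (simp add: mult_left_le_one_le)

text \<open>\<alpha> X = - \<beta> turns the left side into \<alpha> \<Lambda>1 k + \<beta>
  \<Lambda>2 k, which by \<open>U_\<Lambda>\<close> is k - F 0.\<close>

lemma \<alpha>_\<alpha>_inv:
  assumes X: "norm X \<le> 1" and k: "G z *\<^sub>V k = 0"
  shows "\<alpha> z (fraction z X) *\<^sub>V \<alpha>_inv z X *\<^sub>V k = k"
proof -
  define F where "F = fraction z X"
  have "\<alpha> z F o\<^sub>C X = - \<beta> z F" using fraction_iff_\<alpha>_\<beta>[OF X] F_def by blast
  then have *: "\<alpha> z F *\<^sub>V X *\<^sub>V u = - (\<beta> z F *\<^sub>V u)" for u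
    by (metis op_comp.rep_eq uminus_cblinfun.rep_eq)
  have "\<alpha> z F *\<^sub>V \<alpha>_inv z X *\<^sub>V k = \<alpha> z F *\<^sub>V \<Lambda>1 z *\<^sub>V k + \<beta> z F *\<^sub>V \<Lambda>2 z *\<^sub>V k"
    by (simp add: \<alpha>_inv_def cblinfun_diff *)
  also have "\<dots> = (U11 z *\<^sub>V \<Lambda>1 z *\<^sub>V k + U12 z *\<^sub>V \<Lambda>2 z *\<^sub>V k) - F *\<^sub>V (U21 z *\<^sub>V \<Lambda>1 z *\<^sub>V k + U22 z *\<^sub>V \<Lambda>2 z *\<^sub>V k)"
    by (simp add: \<alpha>_def \<beta>_def cblinfun_add)
  also have "\<dots> = k" by (simp add: U_\<Lambda>[OF z k])
  finally show ?thesis by (simp add: F_def)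
qed

text \<open>Choosing v so that the denominator maps it to U21 e makes \<Upsilon>(z) annihilate (e -
  X v, - v).\<close>

lemma \<alpha>_injective:
  assumes X: "norm X \<le> 1" and e: "\<alpha> z (fraction z X) *\<^sub>V e = 0"
  shows "e = 0"
proof -
  obtain v where v: "U21 z *\<^sub>V X *\<^sub>V v + U22 z *\<^sub>V v = U21 z *\<^sub>V e" by (rule denominator_surj[OF X])
  have "U11 z *\<^sub>V e = U11 z *\<^sub>V X *\<^sub>V v + U12 z *\<^sub>V v"
    using e fraction_apply[OF X, of v] by (simp add: \<alpha>_def v)
  then have "U11 z *\<^sub>V (e - X *\<^sub>V v) + U12 z *\<^sub>V (- v) = 0"
    by (simp add: cblinfun_linear)
  moreover have "U21 z *\<^sub>V (e - X *\<^sub>V v) + U22 z *\<^sub>V (- v) = 0"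
    by (simp add: cblinfun_linear v[symmetric])
  ultimately have "e - X *\<^sub>V v = 0" "- v = 0" by (rule U_injective[OF z])+
  then show "e = 0" by simp
qed

text \<open>The values of \<alpha> lie in the kernel of G(z), where \<alpha>_inv is a right inverse;
  injectivity of \<alpha> makes it a left inverse.\<close>

lemma \<alpha>_inv_\<alpha>:
  assumes X: "norm X \<le> 1"
  shows "\<alpha>_inv z X *\<^sub>V \<alpha> z (fraction z X) *\<^sub>V e = e"
proof -
  have "\<alpha> z (fraction z X) *\<^sub>V (\<alpha>_inv z X *\<^sub>V \<alpha> z (fraction z X) *\<^sub>V e - e) = 0"
    by (simp add: cblinfun_diff \<alpha>_\<alpha>_inv[OF X] G_\<alpha>_\<beta>[OF G_fraction[OF X]])
  from \<alpha>_injective[OF X this] show ?thesis by simp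
qed

text \<open>Replacing the fraction by F changes \<alpha> by (F - fraction z X) U21, so J \<alpha>
  becomes I - W with |W| < 1. Correcting J accordingly inverts \<alpha> at F and produces the new
  parameter.\<close>

lemma dominated_fraction_near:
  assumes X: "norm X \<le> 1" and F: "dominated z F"
    and near: "norm (F - fraction z X) * norm (U21 z) * (norm (\<Lambda>1 z) + norm (\<Lambda>2 z)) < 1"
  shows "\<exists>X'. norm X' \<le> 1 \<and> F = fraction z X'"
proof -
  define J where "J = \<alpha>_inv z X"
  define W where "W = J o\<^sub>C ((F - fraction z X) o\<^sub>C U21 z)"
  have "norm W \<le> norm J * (norm (F - fraction z X) * norm (U21 z))"
    unfolding W_def by (rule order_trans[OF norm_op_comp_le mult_left_mono[OF norm_op_comp_le]]) simp
  also have "\<dots> \<le> (norm (\<Lambda>1 z) + norm (\<Lambda>2 z)) * (norm (F - fraction z X) * norm (U21 z))"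
    unfolding J_def by (intro mult_right_mono norm_\<alpha>_inv_le[OF X]) simp
  also have "\<dots> < 1" using near by (simp add: mult_ac)
  finally have inv: "invertible_op (id_op - W)" by (rule invertible_id_minus)
  have GF: "G z o\<^sub>C F = K z" using F by (simp add: dominated_def)
  have W: "J *\<^sub>V \<alpha> z F *\<^sub>V e = (id_op - W) *\<^sub>V e" for e
  proof -
    have "\<alpha> z F *\<^sub>V e = \<alpha> z (fraction z X) *\<^sub>V e - (F - fraction z X) *\<^sub>V U21 z *\<^sub>V e"
      by (simp add: \<alpha>_def)
    then have "J *\<^sub>V \<alpha> z F *\<^sub>V e = J *\<^sub>V (\<alpha> z (fraction z X) *\<^sub>V e - (F - fraction z X) *\<^sub>V U21 z *\<^sub>V e)"
      by (rule arg_cong)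
    also have "\<dots> = (id_op - W) *\<^sub>V e"
      using \<alpha>_inv_\<alpha>[OF X, of e]
      by (simp only: cblinfun_diff[of J] J_def[symmetric] minus_cblinfun.rep_eq[of id_op] id_op.rep_eq W_def op_comp.rep_eq)
    finally show ?thesis .
  qed
  define J' where "J' = op_inv (id_op - W) o\<^sub>C J"
  have J'\<alpha>: "J' *\<^sub>V \<alpha> z F *\<^sub>V e = e" for e
    by (simp only: J'_def op_comp.rep_eq W op_inv_apply(2)[OF inv])
  \<comment> \<open>J is injective on the kernel of G(z), so it suffices to compare the two vectors
    after applying J.\<close>
  have \<alpha>J': "\<alpha> z F *\<^sub>V J' *\<^sub>V k = k" if k: "G z *\<^sub>V k = 0" for k
  proof -
    define k' where "k' = \<alpha> z F *\<^sub>V J' *\<^sub>V k"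
    have k': "G z *\<^sub>V k' = 0" unfolding k'_def by (rule G_\<alpha>_\<beta>[OF GF])
    have "J *\<^sub>V k' = J *\<^sub>V k"
      unfolding k'_def W by (simp only: J'_def op_comp.rep_eq op_inv_apply(1)[OF inv])
    then have "k' = k" using \<alpha>_\<alpha>_inv[OF X k] \<alpha>_\<alpha>_inv[OF X k'] by (simp add: J_def)
    then show ?thesis by (simp add: k'_def)
  qed
  define X' where "X' = - (J' o\<^sub>C \<beta> z F)"
  have eq: "\<alpha> z F o\<^sub>C X' = - \<beta> z F"
    by (rule cblinfun_eqI) (simp add: X'_def cblinfun_minus \<alpha>J' G_\<alpha>_\<beta>[OF GF])
  \<comment> \<open>The left inverse makes the adjoint of \<alpha> surjective; on \<alpha>^* w the
    adjoint of X' equals - \<beta>^* w, and domination is exactly contractivity.\<close>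
  have "norm (X'\<^sup>\<dagger> *\<^sub>V x) \<le> 1 * norm x" for x
  proof -
    define w where "w = J'\<^sup>\<dagger> *\<^sub>V x"
    have x: "(\<alpha> z F)\<^sup>\<dagger> *\<^sub>V w = x"
      unfolding w_def by (rule inner_eqI) (simp add: inner_adj'[symmetric] J'\<alpha>)
    have "X'\<^sup>\<dagger> *\<^sub>V x = - ((\<beta> z F)\<^sup>\<dagger> *\<^sub>V w)"
      unfolding x[symmetric]
    proof (rule inner_eqI)
      fix u
      have "\<alpha> z F *\<^sub>V X' *\<^sub>V u = - (\<beta> z F *\<^sub>V u)"
        using arg_cong[OF eq, of "\<lambda>T. T *\<^sub>V u"] by simp
      then show "inner (X'\<^sup>\<dagger> *\<^sub>V (\<alpha> z F)\<^sup>\<dagger> *\<^sub>V w) u = inner (- ((\<beta> z F)\<^sup>\<dagger> *\<^sub>V w)) u"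
        by (simp add: inner_adj'[symmetric])
    qed
    then show ?thesis using F by (simp add: dominated_def x[symmetric])
  qed
  from norm_adj_apply_le[OF this] have X': "norm X' \<le> 1"
    by (intro norm_cblinfun_le) simp_all
  with eq fraction_iff_\<alpha>_\<beta> show ?thesis by blast
qed

lemma dominated_fraction:
  assumes F: "\<And>t. 0 \<le> t \<Longrightarrow> t \<le> 1 \<Longrightarrow> dominated z (F0 + t *\<^sub>R (F1 - F0))"
    and F0: "F0 = fraction z X0" and X0: "norm X0 \<le> 1"
  shows "\<exists>X. norm X \<le> 1 \<and> F1 = fraction z X"
proof -
  \<comment> \<open>With more than C equal steps, each perturbation has size C / n < 1, whatever
    parameter the previous step returned.\<close>
  define C where "C = norm (F1 - F0) * norm (U21 z) * (norm (\<Lambda>1 z) + norm (\<Lambda>2 z))"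
  obtain n :: nat where n: "C < real n" using reals_Archimedean2 by blast
  have C0: "0 \<le> C" by (simp add: C_def)
  then have n0: "0 < real n" using n by linarith
  have "\<exists>X. norm X \<le> 1 \<and> F0 + (real j / real n) *\<^sub>R (F1 - F0) = fraction z X" if "j \<le> n" for j
    using that
  proof (induction j)
    case 0
    show ?case using F0 X0 by auto
  next
    case (Suc j)
    then obtain X where X: "norm X \<le> 1" "F0 + (real j / real n) *\<^sub>R (F1 - F0) = fraction z X" by auto
    show ?case
    proof (rule dominated_fraction_near[OF X(1)])
      show "dominated z (F0 + (real (Suc j) / real n) *\<^sub>R (F1 - F0))"
        by (rule F) (use Suc.prems n0 in \<open>simp_all add: divide_le_eq\<close>)
      have "F0 + (real (Suc j) / real n) *\<^sub>R (F1 - F0) - fraction z X = (1 / real n) *\<^sub>R (F1 - F0)"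
        unfolding X(2)[symmetric] by (simp add: algebra_simps add_divide_distrib)
      then have "norm (F0 + (real (Suc j) / real n) *\<^sub>R (F1 - F0) - fraction z X) = norm (F1 - F0) / real n"
        by simp
      then have "norm (F0 + (real (Suc j) / real n) *\<^sub>R (F1 - F0) - fraction z X) * norm (U21 z) *
          (norm (\<Lambda>1 z) + norm (\<Lambda>2 z)) = C / real n" by (simp add: C_def)
      also have "\<dots> < 1" using n n0 by simp
      finally show "norm (F0 + (real (Suc j) / real n) *\<^sub>R (F1 - F0) - fraction z X) * norm (U21 z) *
          (norm (\<Lambda>1 z) + norm (\<Lambda>2 z)) < 1" .
    qed
  qed
  from this[of n] show ?thesis using n0 by simp
qed

text \<open>
  With \<open>D = I - T\<^sub>F T\<^sub>F\<^sup>*\<close> one has \<open>A D A\<^sup>* = P\<close>, and the claim is the nonnegativity of the Schur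
  complement \<open>D - D A\<^sup>* P\<^sup>-\<^sup>1 A D\<close> on the kernel vectors of the point evaluation.
\<close>

lemma solution_dominated:
  assumes F: "F \<in> leech_solutions G K"
  shows "dominated z (F z)"
proof -
  have FS: "F \<in> Schur_class" and GF: "\<And>w. w \<in> \<bbbD> \<Longrightarrow> G w o\<^sub>C F w = K w"
    using F by (auto simp: leech_solutions_def)
  have FH: "F \<in> H_infinity" using FS by (simp add: Schur_class_def)
  define C where "C = toeplitz F"
  have C: "commutes_shift C" unfolding C_def by (rule commutes_shift_toeplitz[OF FH])
  have C_le: "norm (C *\<^sub>V x) \<le> 1 * norm x" for x
    unfolding C_def using FS by (intro norm_toeplitz_apply_le) (auto simp: Schur_class_iff)
  have C_adj_le: "(norm (C\<^sup>\<dagger> *\<^sub>V x))\<^sup>2 \<le> (norm x)\<^sup>2" for x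
    using norm_adj_apply_le[OF C_le] by (intro power_mono) simp_all
  \<comment> \<open>The pointwise identity G F = K becomes an operator identity because evaluations
    separate sequences.\<close>
  have AC: "A *\<^sub>V C *\<^sub>V x = B *\<^sub>V x" for x
  proof -
    have "A *\<^sub>V C *\<^sub>V x - B *\<^sub>V x = 0"
    proof (rule ell2_eqI_eval)
      fix w :: complex assume w: "w \<in> \<bbbD>"
      have "G w *\<^sub>V F w *\<^sub>V v = K w *\<^sub>V v" for v
        using arg_cong[OF GF[OF w], of "\<lambda>T. T *\<^sub>V v"] by simp
      then show "eval_op w *\<^sub>V (A *\<^sub>V C *\<^sub>V x - B *\<^sub>V x) = 0"
        by (simp add: cblinfun_diff eval_A[OF w] eval_B[OF w] eval_op_commute[OF C w] op_symbol_toeplitz[OF FH w] C_def[symmetric])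
          (simp add: C_def op_symbol_toeplitz[OF FH w])
    qed
    then show ?thesis by simp
  qed
  have C_adj_A_adj: "C\<^sup>\<dagger> *\<^sub>V A\<^sup>\<dagger> *\<^sub>V x = B\<^sup>\<dagger> *\<^sub>V x" for x
    by (rule inner_eqI) (simp add: inner_adj'[symmetric] AC)
  define d where "d x = x - C *\<^sub>V C\<^sup>\<dagger> *\<^sub>V x" for x
  have d_inner: "inner (d x) y = inner x y - inner (C\<^sup>\<dagger> *\<^sub>V x) (C\<^sup>\<dagger> *\<^sub>V y)" for x y
    by (simp add: d_def inner_diff_left inner_comp_adj)
  have AdA: "A *\<^sub>V d (A\<^sup>\<dagger> *\<^sub>V x) = P *\<^sub>V x" for x
    by (simp add: d_def cblinfun_diff AC C_adj_A_adj P_apply)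
  have "norm ((\<beta> z (F z))\<^sup>\<dagger> *\<^sub>V y) \<le> norm ((\<alpha> z (F z))\<^sup>\<dagger> *\<^sub>V y)" for y
  proof -
    define k where "k = (eval_op z)\<^sup>\<dagger> *\<^sub>V y"
    have Ck: "C\<^sup>\<dagger> *\<^sub>V k = (eval_op z)\<^sup>\<dagger> *\<^sub>V (F z)\<^sup>\<dagger> *\<^sub>V y"
      unfolding k_def adj_eval_adj[OF C z] by (simp add: C_def op_symbol_toeplitz[OF FH z])
    \<comment> \<open>The vector h of \<open>U_adj_form\<close> for u = - F(z)^* y; for a solution
      it collapses to A d k.\<close>
    define h where "h = A *\<^sub>V k + B *\<^sub>V (eval_op z)\<^sup>\<dagger> *\<^sub>V (- ((F z)\<^sup>\<dagger> *\<^sub>V y))"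
    have h: "h = A *\<^sub>V d k"
      by (simp add: h_def d_def cblinfun_linear AC Ck)
    define p where "p = P_inv *\<^sub>V h"
    \<comment> \<open>The minimising shift of k within the range of \<open>A\<^sup>\<dagger>\<close>
      for the quadratic form of d; nonnegativity at k - s is that of the Schur complement.\<close>
    define s where "s = A\<^sup>\<dagger> *\<^sub>V p"
    have dks: "inner (d k) s = inner h p" by (simp add: s_def h inner_adj)
    have dss: "inner (d s) s = inner h p"
    proof -
      have "inner (d s) s = inner (A *\<^sub>V d (A\<^sup>\<dagger> *\<^sub>V p)) p" by (simp add: s_def inner_adj)
      also have "\<dots> = inner h p" by (simp add: AdA p_def P_P_inv)
      finally show ?thesis .
    qed
    have "0 \<le> inner (d (k - s)) (k - s)"
      using C_adj_le[of "k - s"] by (simp add: d_inner power2_norm_eq_inner)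
    also have "\<dots> = inner (d k) k - 2 * inner (d k) s + inner (d s) s"
      by (simp only: d_inner cblinfun_diff inner_diff_left inner_diff_right) (simp add: inner_commute)
    also have "\<dots> = (norm k)\<^sup>2 - (norm (C\<^sup>\<dagger> *\<^sub>V k))\<^sup>2 - inner p h"
      unfolding dks dss unfolding d_inner power2_norm_eq_inner by (simp add: inner_commute)
    finally have le: "inner p h \<le> (norm k)\<^sup>2 - (norm (C\<^sup>\<dagger> *\<^sub>V k))\<^sup>2" by simp
    have z2: "0 \<le> 1 - (cmod z)\<^sup>2" using z by (simp add: power_le_one)
    have "(1 - (cmod z)\<^sup>2) * inner p h \<le> (norm y)\<^sup>2 - (norm ((F z)\<^sup>\<dagger> *\<^sub>V y))\<^sup>2"
      using mult_left_mono[OF le z2] norm_eval_adj[OF z, of y] norm_eval_adj[OF z, of "(F z)\<^sup>\<dagger> *\<^sub>V y"]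
      by (simp add: right_diff_distrib Ck) (simp add: k_def)
    \<comment> \<open>With u = - F(z)^* y the two components of the adjoint of \<Upsilon>(z) are the
      adjoints of \<alpha> and \<beta> applied to y.\<close>
    then have "0 \<le> (norm ((U11 z)\<^sup>\<dagger> *\<^sub>V y + (U21 z)\<^sup>\<dagger> *\<^sub>V (- ((F z)\<^sup>\<dagger> *\<^sub>V y))))\<^sup>2
        - (norm ((U12 z)\<^sup>\<dagger> *\<^sub>V y + (U22 z)\<^sup>\<dagger> *\<^sub>V (- ((F z)\<^sup>\<dagger> *\<^sub>V y))))\<^sup>2"
      unfolding U_adj_form[OF z] by (simp only: p_def h_def k_def norm_minus_cancel)
    also have "(U11 z)\<^sup>\<dagger> *\<^sub>V y + (U21 z)\<^sup>\<dagger> *\<^sub>V (- ((F z)\<^sup>\<dagger> *\<^sub>V y)) = (\<alpha> z (F z))\<^sup>\<dagger> *\<^sub>V y"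
      by (simp add: \<alpha>_def adj_diff adj_comp cblinfun_minus)
    also have "(U12 z)\<^sup>\<dagger> *\<^sub>V y + (U22 z)\<^sup>\<dagger> *\<^sub>V (- ((F z)\<^sup>\<dagger> *\<^sub>V y)) = (\<beta> z (F z))\<^sup>\<dagger> *\<^sub>V y"
      by (simp add: \<beta>_def adj_diff adj_comp cblinfun_minus)
    finally show ?thesis by (simp add: power2_le_iff_abs_le)
  qed
  then show ?thesis using GF[OF z] by (simp add: dominated_def)
qed

lemma U_analytic_at:
  "analytic_at (Upsilon11 G K \<Theta>) z" "analytic_at (Upsilon12 G K) z"
  "analytic_at (Upsilon21 G K \<Theta>) z" "analytic_at (Upsilon22 G K) z"
  unfolding Upsilon11_def[abs_def] Upsilon12_def[abs_def] Upsilon21_def[abs_def] Upsilon22_def[abs_def]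
  by (intro analytic_at_op_comp analytic_at_add analytic_at_diff analytic_at_minus analytic_at_scaleC
      analytic_at_const analytic_at_eval_op z)+

end

section \<open>From pointwise parameters to Schur class parameters\<close>

lemma transform_eq_fraction: "leech_transform G K \<Theta> X z = fraction z (X z)"
  by (simp add: leech_transform_def fraction_def)

text \<open>F is prescribed on the disc only, since functions are compared there and may differ
  outside.\<close>

lemma transform_solution:
  assumes X: "X \<in> Schur_class" and F: "\<And>z. z \<in> \<bbbD> \<Longrightarrow> F z = fraction z (X z)"
  shows "F \<in> leech_solutions G K"
proof -
  have X1: "norm (X z) \<le> 1" and Xa: "analytic_at X z" if "z \<in> \<bbbD>" for z
    using X that by (auto simp: Schur_class_iff analytic_on_disc_iff)
  have "analytic_at F z" if z: "z \<in> \<bbbD>" for z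
  proof (rule analytic_at_transform)
    show "analytic_at (\<lambda>z. fraction z (X z)) z"
      unfolding fraction_def
      by (intro analytic_at_op_comp analytic_at_add analytic_at_op_inv denominator_invertible
          U_analytic_at X1 Xa z)
    show "open \<bbbD>" by simp
  qed (use z F in simp_all)
  then have "analytic_on_disc F" by (simp add: analytic_on_disc_iff)
  moreover have "norm (F z) \<le> 1" "G z o\<^sub>C F z = K z" if "z \<in> \<bbbD>" for z
    using that F norm_fraction_le X1 G_fraction by simp_all
  ultimately show ?thesis by (simp add: leech_solutions_def Schur_class_iff)
qed

lemma convex_solution:
  assumes F0: "F0 \<in> leech_solutions G K" and F1: "F1 \<in> leech_solutions G K" and t: "0 \<le> t" "t \<le> 1"
  shows "(\<lambda>z. F0 z + t *\<^sub>R (F1 z - F0 z)) \<in> leech_solutions G K"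
proof -
  have an: "analytic_at F0 z" "analytic_at F1 z" and n: "norm (F0 z) \<le> 1" "norm (F1 z) \<le> 1"
    and GF: "G z o\<^sub>C F0 z = K z" "G z o\<^sub>C F1 z = K z" if "z \<in> \<bbbD>" for z
    using F0 F1 that by (auto simp: leech_solutions_def Schur_class_iff analytic_on_disc_iff)
  have "analytic_at (\<lambda>z. F0 z + t *\<^sub>R (F1 z - F0 z)) z" if "z \<in> \<bbbD>" for z
  proof -
    \<comment> \<open>The real factor is written as composition with a constant operator, so that
      closure under products applies.\<close>
    have "analytic_at (\<lambda>z. F0 z + (of_real t *\<^sub>C id_op) o\<^sub>C (F1 z - F0 z)) z"
      by (intro analytic_at_add analytic_at_op_comp analytic_at_diff analytic_at_const an that)
    moreover have "(of_real t *\<^sub>C id_op) o\<^sub>C T = t *\<^sub>R T" for T :: "('u, 'y) cblinfun"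
      by (rule cblinfun_eqI) (simp add: scaleC_of_real)
    ultimately show ?thesis by simp
  qed
  moreover have "norm (F0 z + t *\<^sub>R (F1 z - F0 z)) \<le> 1" if "z \<in> \<bbbD>" for z
  proof -
    have "F0 z + t *\<^sub>R (F1 z - F0 z) = (1 - t) *\<^sub>R F0 z + t *\<^sub>R F1 z" by (simp add: algebra_simps)
    also have "norm \<dots> \<le> (1 - t) * norm (F0 z) + t * norm (F1 z)"
      using norm_triangle_ineq[of "(1 - t) *\<^sub>R F0 z" "t *\<^sub>R F1 z"] t by simp
    also have "\<dots> \<le> (1 - t) * 1 + t * 1" using t n[OF that] by (intro add_mono mult_left_mono) auto
    finally show ?thesis by simp
  qed
  moreover have "G z o\<^sub>C (F0 z + t *\<^sub>R (F1 z - F0 z)) = K z" if "z \<in> \<bbbD>" for z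
  proof (rule cblinfun_eqI)
    fix x
    have "G z *\<^sub>V F0 z *\<^sub>V x = K z *\<^sub>V x" "G z *\<^sub>V F1 z *\<^sub>V x = K z *\<^sub>V x"
      using GF[OF that] by (metis op_comp.rep_eq)+
    then show "(G z o\<^sub>C (F0 z + t *\<^sub>R (F1 z - F0 z))) *\<^sub>V x = K z *\<^sub>V x" by (simp add: cblinfun_linear)
  qed
  ultimately show ?thesis by (simp add: leech_solutions_def Schur_class_iff analytic_on_disc_iff)
qed

lemma solution_pointwise:
  assumes F: "F \<in> leech_solutions G K" and z: "z \<in> \<bbbD>"
  shows "\<exists>X. norm X \<le> 1 \<and> F z = fraction z X"
proof -
  define F0 where "F0 z = fraction z 0" for z
  have "(\<lambda>_. 0) \<in> Schur_class" by (simp add: Schur_class_iff analytic_on_disc_iff)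
  then have F0: "F0 \<in> leech_solutions G K" by (rule transform_solution) (simp add: F0_def)
  show ?thesis
  proof (rule dominated_fraction[OF z, of "F0 z" "F z" 0])
    show "dominated z (F0 z + t *\<^sub>R (F z - F0 z))" if "0 \<le> t" "t \<le> 1" for t
      using solution_dominated[OF z convex_solution[OF F0 F that]] .
  qed (simp_all add: F0_def)
qed

text \<open>Analyticity is local: near z, with one left inverse J held fixed, M w = J \<alpha>(w) is
  analytic and stays invertible, and \<alpha> X = - \<beta> becomes X = - M^{-1} J \<beta>.\<close>

lemma solution_parameter:
  assumes F: "F \<in> leech_solutions G K"
  shows "\<exists>X\<in>Schur_class. \<forall>z\<in>\<bbbD>. F z = fraction z (X z)"
proof -
  from solution_pointwise[OF F] obtain X
    where X1: "\<And>z. z \<in> \<bbbD> \<Longrightarrow> norm (X z) \<le> 1" and FX: "\<And>z. z \<in> \<bbbD> \<Longrightarrow> F z = fraction z (X z)"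
    by metis
  have Fa: "analytic_at F z" if "z \<in> \<bbbD>" for z
    using F that by (auto simp: leech_solutions_def Schur_class_iff analytic_on_disc_iff)
  have "analytic_at X z" if z: "z \<in> \<bbbD>" for z
  proof -
    \<comment> \<open>Frozen at z, because a left inverse moving with w would involve the values X w
      whose analyticity is still to be shown.\<close>
    define J where "J = \<alpha>_inv z (X z)"
    define M where "M w = J o\<^sub>C \<alpha> w (F w)" for w
    have Mz: "M z = id_op"
      by (rule cblinfun_eqI) (simp add: M_def J_def FX[OF z] \<alpha>_inv_\<alpha>[OF z X1[OF z]])
    have inv_z: "invertible_op (M z)" unfolding Mz by (rule invertible_opI[where B = id_op]) simp_all
    have \<alpha>_an: "analytic_at (\<lambda>w. \<alpha> w (F w)) z" and \<beta>_an: "analytic_at (\<lambda>w. \<beta> w (F w)) z"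
      unfolding \<alpha>_def \<beta>_def by (intro analytic_at_diff analytic_at_op_comp U_analytic_at Fa z)+
    have M_an: "analytic_at M z"
      unfolding M_def[abs_def] by (intro analytic_at_op_comp analytic_at_const \<alpha>_an)
    have "(M \<longlongrightarrow> M z) (nhds z)"
      using analytic_at_isCont[OF M_an] by (simp add: isCont_def tendsto_at_iff_tendsto_nhds)
    then have "((\<lambda>w. norm (op_inv (M z)) * norm (M w - M z)) \<longlongrightarrow> norm (op_inv (M z)) * norm (M z - M z)) (nhds z)"
      by (intro tendsto_intros)
    then have "eventually (\<lambda>w. norm (op_inv (M z)) * norm (M w - M z) < 1/2) (nhds z)"
      by (rule order_tendstoD) simp
    then obtain V where V: "open V" "z \<in> V" "\<And>w. w \<in> V \<Longrightarrow> norm (op_inv (M z)) * norm (M w - M z) < 1/2"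
      unfolding eventually_nhds by blast
    have X_eq: "- (op_inv (M w) o\<^sub>C (J o\<^sub>C \<beta> w (F w))) = X w" if w: "w \<in> V \<inter> \<bbbD>" for w
    proof -
      have wD: "w \<in> \<bbbD>" using w by simp
      have inv: "invertible_op (M w)" by (rule invertible_perturb(1)[OF inv_z]) (use V(3)[of w] w in simp)
      have "\<alpha> w (F w) o\<^sub>C X w = - \<beta> w (F w)"
        using fraction_iff_\<alpha>_\<beta>[OF wD X1[OF wD]] FX[OF wD] by blast
      then have eq: "\<beta> w (F w) *\<^sub>V u = - (\<alpha> w (F w) *\<^sub>V X w *\<^sub>V u)" for u
        by (metis op_comp.rep_eq uminus_cblinfun.rep_eq minus_minus)
      have MX: "J *\<^sub>V \<alpha> w (F w) *\<^sub>V X w *\<^sub>V u = M w *\<^sub>V X w *\<^sub>V u" for u by (simp add: M_def)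
      show ?thesis
        by (rule cblinfun_eqI) (simp add: eq cblinfun_minus MX op_inv_apply(2)[OF inv])
    qed
    show ?thesis
    proof (rule analytic_at_transform[where S = "V \<inter> \<bbbD>"])
      show "analytic_at (\<lambda>w. - (op_inv (M w) o\<^sub>C (J o\<^sub>C \<beta> w (F w)))) z"
        by (intro analytic_at_minus analytic_at_op_comp analytic_at_const analytic_at_op_inv M_an inv_z \<beta>_an)
      show "open (V \<inter> \<bbbD>)" "z \<in> V \<inter> \<bbbD>" using V z by auto
    qed (rule X_eq)
  qed
  then have "X \<in> Schur_class" using X1 by (simp add: Schur_class_iff analytic_on_disc_iff)
  with FX show ?thesis by blast
qed

end

theorem theorem9p1:
  fixes G :: "complex \<Rightarrow> ('y::complex_hilbert, 'v::complex_hilbert) cblinfun"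
    and K :: "complex \<Rightarrow> ('u::complex_hilbert, 'v) cblinfun"
    and \<Theta> :: "complex \<Rightarrow> ('e::complex_hilbert, 'y) cblinfun"
  assumes "G \<in> H_infinity"
    and "K \<in> H_infinity"
    and "strictly_positive (toeplitz G o\<^sub>C (toeplitz G)\<^sup>\<dagger> - toeplitz K o\<^sub>C (toeplitz K)\<^sup>\<dagger>)"
    and "inner_function \<Theta>"
    and "range (cblinfun_apply (toeplitz \<Theta>)) = {x. toeplitz G *\<^sub>V x = 0}"
  shows "leech_N G \<Theta> = shift_op\<^sup>\<dagger> o\<^sub>C toeplitz G o\<^sub>C E_op o\<^sub>C \<Theta> 0
    \<and> invertible_op (toeplitz G o\<^sub>C (toeplitz G)\<^sup>\<dagger>)
    \<and> strictly_positive (leech_Q_arg G K \<Theta>) \<and> strictly_positive (leech_Q G K \<Theta>)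
    \<and> strictly_positive (leech_R_arg G K) \<and> strictly_positive (leech_R G K)
    \<and> analytic_on_disc (Upsilon11 G K \<Theta>) \<and> analytic_on_disc (Upsilon12 G K)
    \<and> analytic_on_disc (Upsilon21 G K \<Theta>) \<and> analytic_on_disc (Upsilon22 G K)
    \<and> (\<forall>X \<in> Schur_class. \<forall>z\<in>\<bbbD>. invertible_op (Upsilon21 G K \<Theta> z o\<^sub>C X z + Upsilon22 G K z))
    \<and> (\<forall>F. F \<in> leech_solutions G K \<longleftrightarrow>
          (\<exists>X \<in> Schur_class. \<forall>z\<in>\<bbbD>. F z = leech_transform G K \<Theta> X z))
    \<and> (\<forall>X \<in> Schur_class. \<forall>X' \<in> Schur_class.
          (\<forall>z\<in>\<bbbD>. leech_transform G K \<Theta> X z = leech_transform G K \<Theta> X' z)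
          \<longrightarrow> (\<forall>z\<in>\<bbbD>. X z = X' z))"
proof -
  interpret leech G K \<Theta> by unfold_locales (rule assms)+
  have Schur: "norm (X z) \<le> 1" if "X \<in> Schur_class" "z \<in> \<bbbD>"
    for X :: "complex \<Rightarrow> ('u, 'e) cblinfun" and z
    using that by (simp add: Schur_class_iff)
  show ?thesis
    unfolding transform_eq_fraction analytic_on_disc_iff
  proof (intro conjI allI ballI impI)
    show "(F \<in> leech_solutions G K) = (\<exists>X\<in>Schur_class. \<forall>z\<in>\<bbbD>. F z = fraction z (X z))" for F
      using transform_solution solution_parameter by blast
    show "X z = X' z" if "X \<in> Schur_class" "X' \<in> Schur_class"
      "\<forall>z\<in>\<bbbD>. fraction z (X z) = fraction z (X' z)" "z \<in> \<bbbD>" for X X' z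
      using that fraction_inj[of z "X z" "X' z"] Schur by blast
  qed (rule N_eq AA_invertible Q_arg_strictly_positive Q_strictly_positive R_arg_strictly_positive
      R_strictly_positive U_analytic_at denominator_invertible Schur | assumption)+
qed

end
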